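(* Let $a>0$, $\tau>0$, $\xi>0$ with $\xi>\frac{2\tau}{a}$ and $\tau\le a$. Then there exist constants $C,\omega>0$ such that the $C_0$-semigroup $e^{t\mathcal{A}}$ generated by $\mathcal{A}$ on $\mathcal{H}$ satisfies $\|e^{t\mathcal{A}}\|_{\mathcal{L}(\mathcal{H})}\le Ce^{-\omega t}$ for all $t>0$.
   Context: Let $H_1$ and $H$ be Hilbert spaces, let $B:D(B)\subset H_1\to H$ be a linear unbounded operator and $B^*:D(B^* )\subset H\to H_1$ its adjoint. Assume there is $C_0>0$ with $\|B^*v\|_{H_1}\ge C_0\|v\|_H$ for all $v\in D(B^* )$, that $V:=D(B^* )$ is complete for the norm $\|B^*v\|_{H_1}$, and that $V$ is compactly embedded into $H$. Let $\mathcal{H}:=D(B^* )\times H\times L^2(0,1;H_1)$ with inner product $((u,v,z),(u_1,v_1,z_1))_{\mathcal H}=(B^*u,B^*u_1)_{H_1}+(v,v_1)_H+\xi\int_0^1(z(\rho),z_1(\rho))_{H_1}\,d\rho$. Define $\mathcal{A}(u,v,z)=\big(v,\,-B(aB^*v+z(1)),\,-\tau^{-1}z_\rho\big)$ with domain $D(\mathcal{A})=\{(u,v,z)\in D(B^* )\times D(B^* )\times H^1(0,1;H_1):\ aB^*v+z(1)\in D(B),\ B^*u=z(0)\}$. *)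

theory Defs
  imports "HOL-Analysis.Analysis"
begin

text \<open>An unbounded operator B : D(B) \<subseteq> H1 \<rightarrow> H is given by its domain DB and a
  function B (values outside DB are irrelevant).  It is assumed densely defined, so that
  the adjoint is well defined.\<close>

definition lin_op_on :: "'a::real_vector set \<Rightarrow> ('a \<Rightarrow> 'b::real_vector) \<Rightarrow> bool" where
  "lin_op_on D B \<longleftrightarrow> subspace D \<and>
     (\<forall>x\<in>D. \<forall>y\<in>D. B (x + y) = B x + B y) \<and> (\<forall>c. \<forall>x\<in>D. B (c *\<^sub>R x) = c *\<^sub>R B x)"

definition adj_dom :: "'a::real_inner set \<Rightarrow> ('a \<Rightarrow> 'b::real_inner) \<Rightarrow> 'b set" where
  "adj_dom D B = {v. \<exists>w. \<forall>u\<in>D. inner (B u) v = inner u w}"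

definition adj :: "'a::real_inner set \<Rightarrow> ('a \<Rightarrow> 'b::real_inner) \<Rightarrow> 'b \<Rightarrow> 'a" where
  "adj D B v = (SOME w. \<forall>u\<in>D. inner (B u) v = inner u w)"

definition strongly_meas01 :: "(real \<Rightarrow> 'a::real_normed_vector) \<Rightarrow> bool" where
  "strongly_meas01 z \<longleftrightarrow> (\<exists>s. (\<forall>n. simple_function (lebesgue_on {0..1}) (s n)) \<and>
      (AE \<rho> in lebesgue_on {0..1}. (\<lambda>n. s n \<rho>) \<longlonglongrightarrow> z \<rho>))"

definition L2_01 :: "(real \<Rightarrow> 'a::real_normed_vector) set" where
  "L2_01 = {z. strongly_meas01 z \<and> integrable (lebesgue_on {0..1}) (\<lambda>\<rho>. (norm (z \<rho>))\<^sup>2)}"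

definition L2_norm2 :: "(real \<Rightarrow> 'a::real_normed_vector) \<Rightarrow> real" where
  "L2_norm2 z = integral\<^sup>L (lebesgue_on {0..1}) (\<lambda>\<rho>. (norm (z \<rho>))\<^sup>2)"

definition is_H1_deriv :: "(real \<Rightarrow> 'a::banach) \<Rightarrow> (real \<Rightarrow> 'a) \<Rightarrow> bool" where
  "is_H1_deriv z g \<longleftrightarrow> g \<in> L2_01 \<and> (\<forall>\<rho>\<in>{0..1}. (g has_integral (z \<rho> - z 0)) {0..\<rho>})"

definition H1_01 :: "(real \<Rightarrow> 'a::banach) set" where
  "H1_01 = {z. z \<in> L2_01 \<and> (\<exists>g. is_H1_deriv z g)}"

definition H1_deriv :: "(real \<Rightarrow> 'a::banach) \<Rightarrow> real \<Rightarrow> 'a" where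
  "H1_deriv z = (SOME g. is_H1_deriv z g)"

type_synonym ('h,'h1) state = "'h \<times> 'h \<times> (real \<Rightarrow> 'h1)"

definition sadd :: "('h::real_vector,'h1::real_vector) state \<Rightarrow> ('h,'h1) state \<Rightarrow> ('h,'h1) state" where
  "sadd x y = (case x of (u,v,z) \<Rightarrow> case y of (u',v',z') \<Rightarrow> (u + u', v + v', \<lambda>\<rho>. z \<rho> + z' \<rho>))"

definition sscale :: "real \<Rightarrow> ('h::real_vector,'h1::real_vector) state \<Rightarrow> ('h,'h1) state" where
  "sscale c x = (case x of (u,v,z) \<Rightarrow> (c *\<^sub>R u, c *\<^sub>R v, \<lambda>\<rho>. c *\<^sub>R z \<rho>))"

definition ssub :: "('h::real_vector,'h1::real_vector) state \<Rightarrow> ('h,'h1) state \<Rightarrow> ('h,'h1) state" where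
  "ssub x y = sadd x (sscale (-1) y)"

definition state_space :: "'h1::real_inner set \<Rightarrow> ('h1 \<Rightarrow> 'h::real_inner) \<Rightarrow> ('h,'h1) state set" where
  "state_space DB B = {(u,v,z). u \<in> adj_dom DB B \<and> z \<in> L2_01}"

text \<open>Norm induced by the inner product of \<H> (a seminorm on representatives: functions
  that agree a.e. on [0,1] are identified through it).\<close>
definition state_norm :: "'h1::real_inner set \<Rightarrow> ('h1 \<Rightarrow> 'h::real_inner) \<Rightarrow> real \<Rightarrow> ('h,'h1) state \<Rightarrow> real" where
  "state_norm DB B \<xi> x = (case x of (u,v,z) \<Rightarrow>
      sqrt ((norm (adj DB B u))\<^sup>2 + (norm v)\<^sup>2 + \<xi> * L2_norm2 z))"

definition opA_dom :: "'h1::{real_inner,banach} set \<Rightarrow> ('h1 \<Rightarrow> 'h::real_inner) \<Rightarrow> real \<Rightarrow> ('h,'h1) state set" where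
  "opA_dom DB B a = {(u,v,z). u \<in> adj_dom DB B \<and> v \<in> adj_dom DB B \<and> z \<in> H1_01 \<and>
      a *\<^sub>R adj DB B v + z 1 \<in> DB \<and> adj DB B u = z 0}"

definition opA :: "'h1::{real_inner,banach} set \<Rightarrow> ('h1 \<Rightarrow> 'h::real_inner) \<Rightarrow> real \<Rightarrow> real \<Rightarrow> ('h,'h1) state \<Rightarrow> ('h,'h1) state" where
  "opA DB B a \<tau> x = (case x of (u,v,z) \<Rightarrow>
      (v, - B (a *\<^sub>R adj DB B v + z 1), \<lambda>\<rho>. (- 1 / \<tau>) *\<^sub>R H1_deriv z \<rho>))"

text \<open>All identities are modulo the (semi)norm N, i.e. in the quotient space.\<close>
definition C0_semigroup ::
  "'s set \<Rightarrow> ('s \<Rightarrow> real) \<Rightarrow> ('s \<Rightarrow> 's \<Rightarrow> 's) \<Rightarrow> (real \<Rightarrow> 's \<Rightarrow> 's) \<Rightarrow> (real \<Rightarrow> 's \<Rightarrow> 's) \<Rightarrow> bool" where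
  "C0_semigroup X N add scl T \<longleftrightarrow>
     (\<forall>t\<ge>0. \<forall>x\<in>X. T t x \<in> X) \<and>
     (\<forall>t\<ge>0. \<forall>x\<in>X. \<forall>y\<in>X. \<forall>c. N (add (T t (add x (scl c y))) (scl (-1) (add (T t x) (scl c (T t y))))) = 0) \<and>
     (\<forall>t\<ge>0. \<exists>M. \<forall>x\<in>X. N (T t x) \<le> M * N x) \<and>
     (\<forall>x\<in>X. N (add (T 0 x) (scl (-1) x)) = 0) \<and>
     (\<forall>t\<ge>0. \<forall>s\<ge>0. \<forall>x\<in>X. N (add (T (t + s) x) (scl (-1) (T t (T s x)))) = 0) \<and>
     (\<forall>x\<in>X. ((\<lambda>h. N (add (T h x) (scl (-1) x))) \<longlongrightarrow> 0) (at_right 0))"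

text \<open>T is a C_0-semigroup whose generator is (A, D): the difference quotient converges
  exactly on (the classes of) D, and to A.\<close>
definition C0_semigroup_generated_by ::
  "'s set \<Rightarrow> ('s \<Rightarrow> real) \<Rightarrow> ('s \<Rightarrow> 's \<Rightarrow> 's) \<Rightarrow> (real \<Rightarrow> 's \<Rightarrow> 's) \<Rightarrow> (real \<Rightarrow> 's \<Rightarrow> 's) \<Rightarrow> ('s \<Rightarrow> 's) \<Rightarrow> 's set \<Rightarrow> bool" where
  "C0_semigroup_generated_by X N add scl T A D \<longleftrightarrow>
     C0_semigroup X N add scl T \<and> D \<subseteq> X \<and> (\<forall>x\<in>D. A x \<in> X) \<and>
     (\<forall>x\<in>D. ((\<lambda>h. N (add (scl (1 / h) (add (T h x) (scl (-1) x))) (scl (-1) (A x)))) \<longlongrightarrow> 0) (at_right 0)) \<and>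
     (\<forall>x\<in>X. \<forall>y\<in>X. ((\<lambda>h. N (add (scl (1 / h) (add (T h x) (scl (-1) x))) (scl (-1) y))) \<longlongrightarrow> 0) (at_right 0)
        \<longrightarrow> (\<exists>x'\<in>D. N (add x (scl (-1) x')) = 0 \<and> N (add (A x') (scl (-1) y)) = 0))"

end

(*
  Write w = B* u, y = B* v and zeta = - z_rho / tau; zeta solves the same transport equation as z, with
  zeta(0) = y, and w - z(1) = tau * int zeta.  For E = (|v|^2 + |w|^2) / 2 and
  F = (tau^2 / 2) * int (1 - rho) |zeta|^2 this gives
      (E + F)' = - (a - tau) |y|^2 - (tau / 2) * int |zeta - y|^2,
  which is where tau <= a enters.  When tau = a only the fluctuation of zeta is dissipated; the rest is
  recovered from two cross terms: (u, v)' contributes - |w|^2, and for h = w - int z, which equals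
  tau * int (1 - rho) zeta, the derivative of - (h, w) is - (tau / 2) |y|^2 up to fluctuations.  A suitable
  combination L of E + F, (u, v), - (h, w) and int (2 - rho) |z|^2 satisfies L' <= - rate * L.
  F is not bounded by the energy, but a weight (t / tau - rho)_+^2 travelling with the delay bounds
  int |zeta|^2 at time 2 tau by the initial energy.  The computation is done for orbits starting in the
  domain of A^2, which is dense.
*)
theory Submission
  imports Defs "HOL-Probability.Discrete_Topology"
begin

section \<open>Strongly continuous semigroups on a closed subspace of a Banach space\<close>

text \<open>E alone has no signed derivative: E' = - a |y|^2 + (w - z(1), y), and the product equals
  tau * int (zeta, y). F repairs this because zeta(rho) at time t is y at time t - tau * rho once t
  > tau * rho, so F remembers past dissipation; its inflow (tau / 2) |y|^2 and its loss (tau / 2) *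
  int |zeta|^2 complete the product to a square. The same reading explains the smoothing: for t >=
  tau, int |zeta|^2 is the mean of |y|^2 over the last delay interval, which the viscous term a
  |y|^2 has already paid for.

  Two obstacles shape the rest. F requires z to be weakly differentiable, and F' requires the trace
  of zeta at 0; hence zeta must itself come from the domain, and the constants must not depend on
  the orbit, so that density concludes. Moreover, the semigroup laws hold modulo a seminorm on
  functions, while the traces z(0) and z(1) belong to single representatives. Classes are therefore
  embedded in a Banach space, where orbits are continuous and differentiable, and representatives
  from the domain are chosen anew at every time.\<close>

lemma uniform_boundedness_on_closed_subspace:
  fixes S :: "'y::banach set" and F :: "nat \<Rightarrow> 'y \<Rightarrow> 'z::real_normed_vector"
  assumes sub: "subspace S" and cl: "closed S"
    and lin: "\<And>n x y c. x \<in> S \<Longrightarrow> y \<in> S \<Longrightarrow> F n (x + c *\<^sub>R y) = F n x + c *\<^sub>R F n y"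
    and bdd: "\<And>n. \<exists>M. \<forall>x\<in>S. norm (F n x) \<le> M * norm x"
    and pw: "\<And>x. x \<in> S \<Longrightarrow> \<exists>K. \<forall>n. norm (F n x) \<le> K"
  shows "\<exists>M. \<forall>n. \<forall>x\<in>S. norm (F n x) \<le> M * norm x"
proof -
  \<comment> \<open>Banach-Steinhaus through Baire, run inside the subspace topology of
    \<open>S\<close>: the maps are linear on \<open>S\<close> alone and arbitrary elsewhere.\<close>
  define E where "E k = {x\<in>S. \<forall>n. norm (F n x) \<le> real k}" for k :: nat
  have diff: "F n (x - y) = F n x - F n y" if "x \<in> S" "y \<in> S" for n x y
    using lin[OF that, of n "-1"] by simp
  have scl: "F n (c *\<^sub>R x) = c *\<^sub>R F n x" if "x \<in> S" for n x c
  proof -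
    have z: "0 \<in> S" using sub subspace_0 by blast
    have "F n 0 = 0" using diff[OF z z, of n] by simp
    then show ?thesis using lin[OF z that, of n c] by simp
  qed
  have cont: "continuous_on S (F n)" for n
  proof -
    obtain M where M: "\<And>x. x \<in> S \<Longrightarrow> norm (F n x) \<le> M * norm x" using bdd by blast
    have "(max M 0)-lipschitz_on S (F n)"
    proof (rule lipschitz_onI)
      fix x y assume xy: "x \<in> S" "y \<in> S"
      have "norm (F n x - F n y) \<le> M * norm (x - y)"
        using M[of "x - y"] diff[OF xy] subspace_diff[OF sub xy] by simp
      also have "\<dots> \<le> max M 0 * norm (x - y)" by (intro mult_right_mono) auto
      finally show "dist (F n x) (F n y) \<le> max M 0 * dist x y" by (simp add: dist_norm)
    qed simp
    then show ?thesis by (rule lipschitz_on_continuous_on)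
  qed
  have Ecl: "closedin (top_of_set S) (E k)" for k
  proof -
    have "closedin (top_of_set S) {x\<in>S. norm (F n x) \<le> real k}" for n
      using continuous_closedin_preimage[OF continuous_on_norm[OF cont[of n]], of "{..real k}"]
      by (simp add: vimage_def Int_def)
    then have "closedin (top_of_set S) (\<Inter>n. {x\<in>S. norm (F n x) \<le> real k})" by blast
    also have "(\<Inter>n. {x\<in>S. norm (F n x) \<le> real k}) = E k" by (auto simp: E_def)
    finally show ?thesis .
  qed
  have cover: "\<Union>(range E) = S"
  proof
    show "S \<subseteq> \<Union>(range E)"
    proof
      fix x assume x: "x \<in> S"
      obtain K where "\<And>n. norm (F n x) \<le> K" using pw[OF x] by blast
      moreover obtain k :: nat where "K \<le> real k" using real_arch_simple by blast
      ultimately have "x \<in> E k" using x by (auto simp: E_def intro: order_trans)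
      then show "x \<in> \<Union>(range E)" by blast
    qed
  qed (auto simp: E_def)
  have cm: "completely_metrizable_space (top_of_set S)"
    by (rule completely_metrizable_space_closedin[OF completely_metrizable_space_euclidean])
       (use cl in simp)
  have "\<exists>k. (top_of_set S) interior_of (E k) \<noteq> {}"
  proof (rule ccontr)
    assume "\<not> ?thesis"
    then have "(top_of_set S) interior_of \<Union>(range E) = {}"
      using Baire_category_alt[of "top_of_set S" "range E"] cm Ecl by auto
    moreover have "(top_of_set S) interior_of S = S"
      using interior_of_topspace[of "top_of_set S"] by simp
    ultimately show False using cover subspace_0[OF sub] by auto
  qed
  then obtain k x0 where "x0 \<in> (top_of_set S) interior_of (E k)" by blast
  then obtain W where W: "openin (top_of_set S) W" "W \<subseteq> E k" "x0 \<in> W"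
    by (auto simp: interior_of_def)
  then obtain r where r: "r > 0" "\<And>y. y \<in> S \<Longrightarrow> dist y x0 < r \<Longrightarrow> y \<in> W"
    unfolding openin_euclidean_subtopology_iff by blast
  have x0: "x0 \<in> S" "x0 \<in> E k" using W by (auto simp: E_def)
  have "norm (F n x) \<le> (4 * real k / r) * norm x" if x: "x \<in> S" for n x
  proof (cases "x = 0")
    case True
    then show ?thesis using scl[OF x, of n 0] by simp
  next
    case False
    \<comment> \<open>Scales \<open>x\<close> to norm \<open>r / 2\<close>, so that
      \<open>x0 + c *\<^sub>R x\<close> stays in the ball around \<open>x0\<close> inside
      \<open>E k\<close>; subtracting the value at \<open>x0\<close> costs a second
      \<open>k\<close>.\<close>
    define c where "c = r / (2 * norm x)"
    have c: "c > 0" using False r by (simp add: c_def)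
    have cx: "c *\<^sub>R x \<in> S" using sub x by (rule subspace_scale)
    have "x0 + c *\<^sub>R x \<in> E k"
      using r(2)[of "x0 + c *\<^sub>R x"] subspace_add[OF sub x0(1) cx] r(1) False W
      by (auto simp: dist_norm c_def)
    then have "norm (F n x0 + c *\<^sub>R F n x) \<le> k" using lin[OF x0(1) x] by (auto simp: E_def)
    moreover have "norm (F n x0) \<le> k" using x0 by (auto simp: E_def)
    ultimately have "norm (c *\<^sub>R F n x) \<le> 2 * k"
      using norm_triangle_ineq4[of "F n x0 + c *\<^sub>R F n x" "F n x0"] by simp
    then have "c * norm (F n x) \<le> 2 * k" using c by simp
    then have "norm (F n x) \<le> 2 * k / c" using c by (simp add: field_simps)
    also have "2 * k / c = (4 * real k / r) * norm x" using r False by (simp add: c_def)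
    finally show ?thesis .
  qed
  then show ?thesis by blast
qed

text \<open>Puts derivatives into the form of the difference quotients that define generators, for
  one-sided and two-sided filters alike.\<close>

lemma has_vector_derivative_iff_quotient:
  "(f has_vector_derivative f') (at t within A) \<longleftrightarrow>
     ((\<lambda>s. (1 / (s - t)) *\<^sub>R (f s - f t)) \<longlongrightarrow> f') (at t within A)"
proof -
  have eq: "norm ((1 / norm (s - t)) *\<^sub>R (f s - (f t + (s - t) *\<^sub>R f')))
      = norm ((1 / (s - t)) *\<^sub>R (f s - f t) - f')" if "s \<noteq> t" for s
  proof -
    have "(1 / (s - t)) *\<^sub>R (f s - f t) - f' = (1 / (s - t)) *\<^sub>R (f s - (f t + (s - t) *\<^sub>R f'))"
      using that by (simp add: scaleR_diff_right scaleR_add_right)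
    then show ?thesis by simp
  qed
  have "(f has_vector_derivative f') (at t within A) \<longleftrightarrow>
      ((\<lambda>s. norm ((1 / norm (s - t)) *\<^sub>R (f s - (f t + (s - t) *\<^sub>R f')))) \<longlongrightarrow> 0) (at t within A)"
    by (simp only: has_vector_derivative_def has_derivative_within tendsto_norm_zero_iff
        bounded_linear_scaleR_left simp_thms)
  also have "\<dots> \<longleftrightarrow> ((\<lambda>s. norm ((1 / (s - t)) *\<^sub>R (f s - f t) - f')) \<longlongrightarrow> 0) (at t within A)"
    by (rule filterlim_cong) (auto simp: eventually_at_filter eq simp del: norm_scaleR real_norm_def)
  also have "\<dots> \<longleftrightarrow> ((\<lambda>s. (1 / (s - t)) *\<^sub>R (f s - f t)) \<longlongrightarrow> f') (at t within A)"
    by (simp add: tendsto_norm_zero_iff LIM_zero_iff)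
  finally show ?thesis .
qed

text \<open>The carrier is a closed set and not a type because the state space modulo null functions
  will appear as the image of an isometry. Boundedness is assumed at each time separately and
  continuity only at 0; local uniform bounds and continuity everywhere are derived.\<close>

locale C0_semigroup_on =
  fixes S :: "'y::banach set" and U :: "real \<Rightarrow> 'y \<Rightarrow> 'y"
  assumes sub: "subspace S" and cl: "closed S"
    and U_in: "\<And>t x. 0 \<le> t \<Longrightarrow> x \<in> S \<Longrightarrow> U t x \<in> S"
    and U_lin: "\<And>t x y c. 0 \<le> t \<Longrightarrow> x \<in> S \<Longrightarrow> y \<in> S \<Longrightarrow> U t (x + c *\<^sub>R y) = U t x + c *\<^sub>R U t y"
    and U_bdd: "\<And>t. 0 \<le> t \<Longrightarrow> \<exists>M. \<forall>x\<in>S. norm (U t x) \<le> M * norm x"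
    and U_0: "\<And>x. x \<in> S \<Longrightarrow> U 0 x = x"
    and U_add: "\<And>t s x. 0 \<le> t \<Longrightarrow> 0 \<le> s \<Longrightarrow> x \<in> S \<Longrightarrow> U (t + s) x = U t (U s x)"
    and U_right: "\<And>x. x \<in> S \<Longrightarrow> ((\<lambda>h. U h x) \<longlongrightarrow> x) (at_right 0)"
begin

lemma U_diff: "0 \<le> t \<Longrightarrow> x \<in> S \<Longrightarrow> y \<in> S \<Longrightarrow> U t (x - y) = U t x - U t y"
  using U_lin[of t x y "-1"] by simp

lemma U_scale: "0 \<le> t \<Longrightarrow> x \<in> S \<Longrightarrow> U t (c *\<^sub>R x) = c *\<^sub>R U t x"
  using U_lin[of t 0 x c] U_diff[of t x x] subspace_0[OF sub] by simp

lemma S_diff: "x \<in> S \<Longrightarrow> y \<in> S \<Longrightarrow> x - y \<in> S"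
  and S_add: "x \<in> S \<Longrightarrow> y \<in> S \<Longrightarrow> x + y \<in> S"
  and S_scale: "x \<in> S \<Longrightarrow> c *\<^sub>R x \<in> S"
  using sub by (auto intro: subspace_diff subspace_add subspace_scale)

text \<open>If the bound failed near 0, some times \<open>t n\<close> tending to 0 would have
  operators of norm above \<open>n + 1\<close>; but every orbit converges along \<open>t n\<close>,
  which contradicts uniform boundedness.\<close>

lemma bounded_near_0: "\<exists>\<delta>>0. \<exists>M\<ge>1. \<forall>t\<in>{0..\<delta>}. \<forall>x\<in>S. norm (U t x) \<le> M * norm x"
proof (rule ccontr)
  assume neg: "\<not> ?thesis"
  have "\<exists>t x. t \<in> {0..1 / Suc n} \<and> x \<in> S \<and> norm (U t x) > real (Suc n) * norm x" for n
  proof -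
    have "\<not> (\<forall>t\<in>{0..1 / Suc n}. \<forall>x\<in>S. norm (U t x) \<le> real (Suc n) * norm x)"
    proof
      assume "\<forall>t\<in>{0..1 / Suc n}. \<forall>x\<in>S. norm (U t x) \<le> real (Suc n) * norm x"
      then have "\<exists>\<delta>>0. \<exists>M\<ge>1. \<forall>t\<in>{0..\<delta>}. \<forall>x\<in>S. norm (U t x) \<le> M * norm x"
        by (intro exI[of _ "1 / Suc n"] conjI exI[of _ "real (Suc n)"]) auto
      with neg show False by contradiction
    qed
    then show ?thesis by (auto simp: not_le)
  qed
  then obtain t where t: "\<And>n. t n \<in> {0..1 / Suc n}"
    and "\<And>n. \<exists>x. x \<in> S \<and> norm (U (t n) x) > real (Suc n) * norm x" by metis
  then obtain x where x: "\<And>n. x n \<in> S" "\<And>n. norm (U (t n) (x n)) > real (Suc n) * norm (x n)"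
    by metis
  have t0: "t \<longlonglongrightarrow> 0"
  proof (rule tendsto_sandwich[of "\<lambda>_. 0" t _ "\<lambda>n. 1 / Suc n"])
    show "(\<lambda>n. 1 / real (Suc n)) \<longlonglongrightarrow> 0" by (rule LIMSEQ_Suc[OF lim_1_over_n])
  qed (use t in auto)
  have "\<exists>M. \<forall>n. \<forall>x\<in>S. norm (U (t n) x) \<le> M * norm x"
  proof (rule uniform_boundedness_on_closed_subspace[OF sub cl])
    fix n show "\<exists>M. \<forall>x\<in>S. norm (U (t n) x) \<le> M * norm x" using U_bdd t by auto
  next
    fix y assume y: "y \<in> S"
    have "((\<lambda>h. U h y) \<longlongrightarrow> y) (at 0 within {0..})"
    proof (rule tendstoI)
      fix e :: real assume "e > 0"
      then have "eventually (\<lambda>h. dist (U h y) y < e) (at_right 0)" by (rule tendstoD[OF U_right[OF y]])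
      then obtain b where "b > 0" "\<And>h. 0 < h \<Longrightarrow> h < b \<Longrightarrow> dist (U h y) y < e"
        by (auto simp: eventually_at_right_field)
      then show "eventually (\<lambda>h. dist (U h y) y < e) (at 0 within {0..})"
        by (auto simp: eventually_at dist_real_def intro!: exI[of _ b])
    qed
    \<comment> \<open>Some \<open>t n\<close> may equal 0, hence continuity including the value
      \<open>U 0 y\<close> and not just the right limit.\<close>
    then have "continuous (at 0 within {0..}) (\<lambda>h. U h y)"
      by (simp add: continuous_within U_0[OF y])
    then have "(\<lambda>n. U (t n) y) \<longlonglongrightarrow> U 0 y"
      using continuous_within_sequentially[of 0 "{0..}" "\<lambda>h. U h y"] t t0 by (auto simp: o_def)
    then have "Bseq (\<lambda>n. U (t n) y)" using convergent_imp_Bseq convergentI by blast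
    then show "\<exists>K. \<forall>n. norm (U (t n) y) \<le> K" by (auto simp: Bseq_def)
  qed (use U_lin t in auto)
  then obtain M where M: "\<And>n x. x \<in> S \<Longrightarrow> norm (U (t n) x) \<le> M * norm x" by blast
  obtain n :: nat where n: "M \<le> real n" using real_arch_simple by blast
  have "norm (U (t n) (x n)) \<le> real (Suc n) * norm (x n)"
    by (rule order_trans[OF M[OF x(1)]]) (use n in \<open>auto intro!: mult_right_mono\<close>)
  with x(2)[of n] show False by simp
qed

lemma bounded_on_interval:
  assumes "0 \<le> b"
  obtains M where "M \<ge> 1" "\<And>t x. 0 \<le> t \<Longrightarrow> t \<le> b \<Longrightarrow> x \<in> S \<Longrightarrow> norm (U t x) \<le> M * norm x"
proof -
  obtain \<delta> M where d: "\<delta> > 0" "M \<ge> 1" "\<And>t x. t \<in> {0..\<delta>} \<Longrightarrow> x \<in> S \<Longrightarrow> norm (U t x) \<le> M * norm x"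
    using bounded_near_0 by blast
  have *: "norm (U t x) \<le> M ^ Suc n * norm x" if "0 \<le> t" "t \<le> real (Suc n) * \<delta>" "x \<in> S" for n t x
    using that
  proof (induction n arbitrary: t)
    case 0
    then show ?case using d(3)[of t x] by simp
  next
    case (Suc n)
    show ?case
    proof (cases "t \<le> \<delta>")
      case True
      have "1 \<le> M ^ Suc n" using d(2) by (rule one_le_power)
      then have "M * 1 \<le> M * M ^ Suc n" using d(2) by (intro mult_left_mono) auto
      then have "M * norm x \<le> M ^ Suc (Suc n) * norm x" by (intro mult_right_mono) auto
      moreover have "norm (U t x) \<le> M * norm x" using d(3)[of t x] True Suc.prems by simp
      ultimately show ?thesis by linarith
    next
      case False
      have "norm (U t x) = norm (U \<delta> (U (t - \<delta>) x))"
        using U_add[of \<delta> "t - \<delta>" x] False d(1) Suc.prems by simp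
      also have "\<dots> \<le> M * norm (U (t - \<delta>) x)"
        using d False Suc.prems by (intro d(3)) (auto intro!: U_in)
      also have "norm (U (t - \<delta>) x) \<le> M ^ Suc n * norm x"
        using Suc False by (intro Suc.IH) (auto simp: algebra_simps)
      finally show ?thesis using d(2) by (simp add: mult.assoc mult_left_mono)
    qed
  qed
  obtain n :: nat where "b / \<delta> \<le> real n" using real_arch_simple by blast
  then have "b \<le> real (Suc n) * \<delta>" using d(1) by (simp add: field_simps)
  then show ?thesis using *[of _ n] d(2) by (intro that[of "M ^ Suc n"]) (auto simp: one_le_power simp del: power_Suc)
qed

text \<open>Factoring out the operator at the smaller time reduces increments to the left and to the
  right of \<open>t\<close> to increments at 0, in one formula.\<close>

lemma U_split:
  assumes "0 \<le> s" "0 \<le> t" "x \<in> S"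
  shows "U s x - U t x = (if s \<ge> t then 1 else -1) *\<^sub>R U (min s t) (U \<bar>s - t\<bar> x - x)"
proof -
  have "U (min s t) (U \<bar>s - t\<bar> x - x) = U (min s t + \<bar>s - t\<bar>) x - U (min s t) x"
    using assms by (simp add: U_diff U_in U_add)
  then show ?thesis using assms by (auto simp: min_def abs_if)
qed

lemma U_continuous:
  assumes x: "x \<in> S"
  shows "continuous_on {0..} (\<lambda>t. U t x)"
proof -
  have "((\<lambda>s. U s x) \<longlongrightarrow> U t x) (at t within {0..})" if t: "0 \<le> t" for t
  proof -
    obtain M where M: "M \<ge> 1" "\<And>s y. 0 \<le> s \<Longrightarrow> s \<le> t \<Longrightarrow> y \<in> S \<Longrightarrow> norm (U s y) \<le> M * norm y"
      using bounded_on_interval[OF t] by blast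
    show ?thesis
    proof (rule tendstoI)
      fix e :: real assume "e > 0"
      then have "e / M > 0" using M by simp
      then have "eventually (\<lambda>h. dist (U h x) x < e / M) (at_right 0)" by (rule tendstoD[OF U_right[OF x]])
      then obtain b where b: "b > 0" "\<And>h. 0 < h \<Longrightarrow> h < b \<Longrightarrow> dist (U h x) x < e / M"
        by (auto simp: eventually_at_right_field)
      have "dist (U s x) (U t x) < e" if "0 \<le> s" "s \<noteq> t" "\<bar>s - t\<bar> < b" for s
      proof -
        have "dist (U s x) (U t x) = norm (U (min s t) (U \<bar>s - t\<bar> x - x))"
          using U_split[OF that(1) t x] by (simp add: dist_norm)
        also have "\<dots> \<le> M * norm (U \<bar>s - t\<bar> x - x)" using that t x by (intro M) (auto intro!: S_diff U_in)
        also have "\<dots> < M * (e / M)" using b(2)[of "\<bar>s - t\<bar>"] that M by (intro mult_strict_left_mono) (auto simp: dist_norm)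
        finally show ?thesis using M by simp
      qed
      then show "eventually (\<lambda>s. dist (U s x) (U t x) < e) (at t within {0..})"
        using b(1) by (auto simp: eventually_at dist_real_def)
    qed
  qed
  then show ?thesis by (simp add: continuous_on)
qed

section \<open>The generator and differentiability of orbits\<close>

definition gen :: "'y \<Rightarrow> 'y \<Rightarrow> bool" where
  "gen x y \<longleftrightarrow> x \<in> S \<and> y \<in> S \<and> ((\<lambda>h. (1 / h) *\<^sub>R (U h x - x)) \<longlongrightarrow> y) (at_right 0)"

lemma gen_U: assumes "gen x y" "0 \<le> t" shows "gen (U t x) (U t y)"
proof -
  have S: "x \<in> S" "y \<in> S" and L: "((\<lambda>h. (1 / h) *\<^sub>R (U h x - x)) \<longlongrightarrow> y) (at_right 0)"
    using assms by (auto simp: gen_def)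
  obtain M where M: "\<And>x. x \<in> S \<Longrightarrow> norm (U t x) \<le> M * norm x" using U_bdd assms by blast
  have "((\<lambda>h. (1 / h) *\<^sub>R (U h (U t x) - U t x) - U t y) \<longlongrightarrow> 0) (at_right 0)"
  proof (rule Lim_null_comparison)
    show "eventually (\<lambda>h. norm ((1 / h) *\<^sub>R (U h (U t x) - U t x) - U t y)
        \<le> M * norm ((1 / h) *\<^sub>R (U h x - x) - y)) (at_right 0)"
      unfolding eventually_at_right_field
    proof (intro exI[of _ 1] conjI allI impI)
      fix h :: real assume h: "0 < h" "h < 1"
      have "U h (U t x) = U t (U h x)" using U_add[of h t x] U_add[of t h x] h assms(2) S by (simp add: add.commute)
      then have "(1 / h) *\<^sub>R (U h (U t x) - U t x) - U t y = U t ((1 / h) *\<^sub>R (U h x - x) - y)"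
        using h assms(2) S by (simp add: U_diff U_scale S_diff S_scale U_in)
      then show "norm ((1 / h) *\<^sub>R (U h (U t x) - U t x) - U t y) \<le> M * norm ((1 / h) *\<^sub>R (U h x - x) - y)"
        using M h S by (simp add: S_diff S_scale U_in)
    qed simp
    have "((\<lambda>h. M * norm ((1 / h) *\<^sub>R (U h x - x) - y)) \<longlongrightarrow> M * norm (y - y)) (at_right 0)"
      by (intro tendsto_intros L)
    then show "((\<lambda>h. M * norm ((1 / h) *\<^sub>R (U h x - x) - y)) \<longlongrightarrow> 0) (at_right 0)" by simp
  qed
  then show ?thesis using S assms(2) LIM_zero_cancel by (auto simp: gen_def U_in)
qed

lemma gen_lin: "gen x y \<Longrightarrow> gen x' y' \<Longrightarrow> gen (c *\<^sub>R x + d *\<^sub>R x') (c *\<^sub>R y + d *\<^sub>R y')"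
proof -
  assume *: "gen x y" "gen x' y'"
  have "((\<lambda>h. c *\<^sub>R ((1 / h) *\<^sub>R (U h x - x)) + d *\<^sub>R ((1 / h) *\<^sub>R (U h x' - x'))) \<longlongrightarrow> c *\<^sub>R y + d *\<^sub>R y') (at_right 0)"
    using * by (intro tendsto_intros) (auto simp: gen_def)
  moreover have "eventually (\<lambda>h. c *\<^sub>R ((1 / h) *\<^sub>R (U h x - x)) + d *\<^sub>R ((1 / h) *\<^sub>R (U h x' - x'))
      = (1 / h) *\<^sub>R (U h (c *\<^sub>R x + d *\<^sub>R x') - (c *\<^sub>R x + d *\<^sub>R x'))) (at_right 0)"
    unfolding eventually_at_right_field
    using * by (intro exI[of _ 1]) (auto simp: gen_def U_lin U_scale S_scale algebra_simps)
  ultimately show ?thesis using * unfolding gen_def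
    by (auto intro: S_add S_scale Lim_transform_eventually)
qed

text \<open>The generator speaks of right quotients at 0 only. A quotient at \<open>t\<close> is
  \<open>U (min s t)\<close> applied to a quotient at 0, so from the left a moving operator stands
  in front: the local uniform bound handles the error of the quotient, strong continuity the
  motion.\<close>

lemma gen_deriv:
  assumes g: "gen x y" and t: "0 \<le> t"
  shows "((\<lambda>s. U s x) has_vector_derivative U t y) (at t within {0..})"
proof -
  have S: "x \<in> S" "y \<in> S" and L: "((\<lambda>h. (1 / h) *\<^sub>R (U h x - x)) \<longlongrightarrow> y) (at_right 0)"
    using g by (auto simp: gen_def)
  obtain M where M: "M \<ge> 1" "\<And>s y. 0 \<le> s \<Longrightarrow> s \<le> t \<Longrightarrow> y \<in> S \<Longrightarrow> norm (U s y) \<le> M * norm y"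
    using bounded_on_interval[OF t] by blast
  have "((\<lambda>s. (1 / (s - t)) *\<^sub>R (U s x - U t x) - U t y) \<longlongrightarrow> 0) (at t within {0..})"
  proof (rule tendstoI)
    fix e :: real assume e: "e > 0"
    then have "e / (2 * M) > 0" using M by simp
    then have "eventually (\<lambda>h. dist ((1 / h) *\<^sub>R (U h x - x)) y < e / (2 * M)) (at_right 0)"
      by (rule tendstoD[OF L])
    then obtain b where b: "b > 0" "\<And>h. 0 < h \<Longrightarrow> h < b \<Longrightarrow> dist ((1 / h) *\<^sub>R (U h x - x)) y < e / (2 * M)"
      by (auto simp: eventually_at_right_field)
    have "((\<lambda>s. U s y) \<longlongrightarrow> U t y) (at t within {0..})"
      using U_continuous[OF S(2)] t by (auto simp: continuous_on)
    from tendstoD[OF this, of "e / 2"] obtain b' where b': "b' > 0"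
      "\<And>s. 0 \<le> s \<Longrightarrow> s \<noteq> t \<Longrightarrow> \<bar>s - t\<bar> < b' \<Longrightarrow> dist (U s y) (U t y) < e / 2"
      using e by (auto simp: eventually_at dist_real_def)
    have "norm ((1 / (s - t)) *\<^sub>R (U s x - U t x) - U t y) < e"
      if s: "0 \<le> s" "s \<noteq> t" "\<bar>s - t\<bar> < min b b'" for s
    proof -
      let ?m = "min s t" let ?h = "\<bar>s - t\<bar>"
      have h: "?h > 0" "?h < b" "?m \<ge> 0" "?m \<le> t" using s t by auto
      have dS: "(1 / ?h) *\<^sub>R (U ?h x - x) \<in> S" using S by (intro S_scale S_diff U_in) auto
      have "(1 / (s - t)) *\<^sub>R (U s x - U t x) = (1 / ?h) *\<^sub>R U ?m (U ?h x - x)"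
        using U_split[OF s(1) t S(1)] s(2) by (auto simp: abs_if field_simps)
      also have "\<dots> = U ?m ((1 / ?h) *\<^sub>R (U ?h x - x))"
        using h S by (simp add: U_scale S_diff U_in)
      finally have "(1 / (s - t)) *\<^sub>R (U s x - U t x) - U t y
          = U ?m ((1 / ?h) *\<^sub>R (U ?h x - x) - y) + (U ?m y - U t y)"
        using h(3) dS S by (simp add: U_diff)
      moreover have "norm (U ?m ((1 / ?h) *\<^sub>R (U ?h x - x) - y)) < e / 2"
      proof -
        have "norm (U ?m ((1 / ?h) *\<^sub>R (U ?h x - x) - y)) \<le> M * norm ((1 / ?h) *\<^sub>R (U ?h x - x) - y)"
          using h dS S by (intro M) (auto intro: S_diff)
        also have "\<dots> < M * (e / (2 * M))"
          using b(2)[OF h(1,2)] M(1) by (intro mult_strict_left_mono) (auto simp: dist_norm)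
        finally show ?thesis using M by simp
      qed
      moreover have "norm (U ?m y - U t y) < e / 2"
        using b'(2)[OF s(1,2)] s(3) e by (cases "s \<le> t") (simp_all add: dist_norm)
      ultimately show ?thesis by (metis norm_triangle_lt add_strict_mono field_sum_of_halves)
    qed
    then show "eventually (\<lambda>s. dist ((1 / (s - t)) *\<^sub>R (U s x - U t x) - U t y) 0 < e) (at t within {0..})"
      using b(1) b'(1) by (auto simp: eventually_at dist_real_def intro!: exI[of _ "min b b'"])
  qed
  then show ?thesis
    by (simp add: has_vector_derivative_iff_quotient LIM_zero_cancel)
qed


text \<open>\<open>V\<close> is linear and bounded on \<open>S\<close> only, so the rule for
  integrals under bounded linear maps of a whole space does not apply. Riemann sums of
  \<open>f\<close> stay in \<open>S\<close> and \<open>V\<close> passes through them; a partition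
  fine for both integrals gives sums close to both sides at once.\<close>

lemma integral_on_closed_subspace:
  fixes f :: "real \<Rightarrow> 'y" and V :: "'y \<Rightarrow> 'z::banach"
  assumes f: "f integrable_on {a..b}" and fS: "\<And>t. t \<in> {a..b} \<Longrightarrow> f t \<in> S"
    and V: "\<And>x y c. x \<in> S \<Longrightarrow> y \<in> S \<Longrightarrow> V (x + c *\<^sub>R y) = V x + c *\<^sub>R V y"
    and M: "\<And>x. x \<in> S \<Longrightarrow> norm (V x) \<le> M * norm x"
    and Vf: "(\<lambda>t. V (f t)) integrable_on {a..b}"
  shows "integral {a..b} f \<in> S" and "V (integral {a..b} f) = integral {a..b} (\<lambda>t. V (f t))"
proof -
  let ?I = "integral {a..b} f" and ?J = "integral {a..b} (\<lambda>t. V (f t))"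
  have Vd: "V (x - y) = V x - V y" if "x \<in> S" "y \<in> S" for x y using V[OF that, of "-1"] by simp
  have V0: "V 0 = 0" using Vd[of 0 0] subspace_0[OF sub] by simp
  have sums: "(\<Sum>(x,k)\<in>p. measure lborel k *\<^sub>R f x) \<in> S \<and>
      V (\<Sum>(x,k)\<in>p. measure lborel k *\<^sub>R f x) = (\<Sum>(x,k)\<in>p. measure lborel k *\<^sub>R V (f x))"
    if "finite p" "\<And>x k. (x,k) \<in> p \<Longrightarrow> x \<in> {a..b}" for p :: "(real \<times> real set) set"
    using that
  proof (induction p rule: finite_induct)
    case empty then show ?case using V0 subspace_0[OF sub] by simp
  next
    case (insert q p)
    obtain x k where q: "q = (x,k)" by (cases q)
    have "f x \<in> S" using insert.prems[of x k] q by (auto intro: fS)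
    moreover have "(\<Sum>(x,k)\<in>p. measure lborel k *\<^sub>R f x) \<in> S \<and>
      V (\<Sum>(x,k)\<in>p. measure lborel k *\<^sub>R f x) = (\<Sum>(x,k)\<in>p. measure lborel k *\<^sub>R V (f x))"
      by (rule insert.IH) (use insert.prems in blast)
    ultimately show ?case using insert.hyps V[of "\<Sum>(x,k)\<in>p. measure lborel k *\<^sub>R f x" "f x" "measure lborel k"]
      by (simp add: q add.commute S_add S_scale)
  qed
  have approx: "\<exists>r\<in>S. norm (r - ?I) < e \<and> norm (V r - ?J) < e" if e: "e > 0" for e
  proof -
    have hi: "(f has_integral ?I) (cbox a b)" "((\<lambda>t. V (f t)) has_integral ?J) (cbox a b)"
      unfolding cbox_interval by (rule integrable_integral[OF f], rule integrable_integral[OF Vf])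
    obtain d1 where d1: "gauge d1" "\<And>p. p tagged_division_of (cbox a b) \<Longrightarrow> d1 fine p \<Longrightarrow>
        norm ((\<Sum>(x,k)\<in>p. measure lborel k *\<^sub>R f x) - ?I) < e"
      using has_integralD[OF hi(1) e] by metis
    obtain d2 where d2: "gauge d2" "\<And>p. p tagged_division_of (cbox a b) \<Longrightarrow> d2 fine p \<Longrightarrow>
        norm ((\<Sum>(x,k)\<in>p. measure lborel k *\<^sub>R V (f x)) - ?J) < e"
      using has_integralD[OF hi(2) e] by metis
    obtain p where p: "p tagged_division_of (cbox a b)" "(\<lambda>x. d1 x \<inter> d2 x) fine p"
      using fine_division_exists[OF gauge_Int[OF d1(1) d2(1)]] by blast
    have "(\<Sum>(x,k)\<in>p. measure lborel k *\<^sub>R f x) \<in> S \<and>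
      V (\<Sum>(x,k)\<in>p. measure lborel k *\<^sub>R f x) = (\<Sum>(x,k)\<in>p. measure lborel k *\<^sub>R V (f x))"
      using tag_in_interval[OF p(1)] p(1) by (intro sums) (auto simp: tagged_division_of_def tagged_partial_division_of_def)
    then show ?thesis using p d1(2)[OF p(1)] d2(2)[OF p(1)]
      by (intro bexI[of _ "\<Sum>(x,k)\<in>p. measure lborel k *\<^sub>R f x"]) (simp_all add: fine_Int)
  qed
  show I: "?I \<in> S"
  proof -
    have "?I \<in> closure S" unfolding closure_approachable using approx by (auto simp: dist_norm)
    then show ?thesis using cl by simp
  qed
  have "norm (V ?I - ?J) \<le> 0 + e" if "e > 0" for e
  proof -
    \<comment> \<open>\<open>M\<close> may be zero or negative; \<open>\<bar>M\<bar> + 1\<close> is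
      a safe divisor, and the two errors then add up to exactly \<open>e\<close>.\<close>
    have "e / (\<bar>M\<bar> + 1) > 0" using that by auto
    from approx[OF this] obtain r where r: "r \<in> S" "norm (r - ?I) < e / (\<bar>M\<bar> + 1)"
      "norm (V r - ?J) < e / (\<bar>M\<bar> + 1)" by blast
    have "norm (V r - V ?I) \<le> M * norm (r - ?I)" using M[of "r - ?I"] r I by (simp add: Vd S_diff)
    also have "\<dots> \<le> \<bar>M\<bar> * (e / (\<bar>M\<bar> + 1))" using r(2) by (intro mult_mono) auto
    finally have "norm (V ?I - ?J) \<le> \<bar>M\<bar> * (e / (\<bar>M\<bar> + 1)) + e / (\<bar>M\<bar> + 1)"
      using r(3) norm_triangle_ineq4[of "V r - ?J" "V r - V ?I"] by simp
    also have "\<dots> = (\<bar>M\<bar> + 1) * (e / (\<bar>M\<bar> + 1))" by (simp only: distrib_right mult_1)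
    also have "\<dots> = e" using abs_ge_zero[of M] by (intro nonzero_mult_div_cancel_left[of "\<bar>M\<bar> + 1" e, unfolded times_divide_eq_right[symmetric]]) linarith
    finally show ?thesis by simp
  qed
  then show "V ?I = ?J" using field_le_epsilon[of "norm (V ?I - ?J)" 0] by simp
qed

text \<open>\<open>U k\<close> shifts the window of integration, so the quotient of the integral is
  the quotient of \<open>\<Phi>\<close> at \<open>h\<close> minus that at 0, and these tend to the
  integrand at the two ends. No differentiability of the orbit is involved.\<close>

lemma gen_mean:
  assumes x: "x \<in> S" and h: "h > 0"
  shows "gen ((1 / h) *\<^sub>R integral {0..h} (\<lambda>s. U s x)) ((1 / h) *\<^sub>R (U h x - x))"
proof -
  define \<Phi> where "\<Phi> = (\<lambda>t. integral {0..t} (\<lambda>s. U s x))"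
  have contx: "continuous_on {c..d} (\<lambda>s. U s x)" if "0 \<le> c" for c d
    using U_continuous[OF x] by (rule continuous_on_subset) (use that in auto)
  have int: "(\<lambda>s. U s x) integrable_on {c..d}" if "0 \<le> c" for c d
    by (rule integrable_continuous_real[OF contx[OF that]])
  have \<Phi>S: "\<Phi> h \<in> S" unfolding \<Phi>_def
    by (rule integral_on_closed_subspace(1)[where V="\<lambda>x. x" and M=1]) (use int in \<open>auto intro: U_in x\<close>)
  have shift: "U k (\<Phi> h) = \<Phi> (h + k) - \<Phi> k" if k: "0 \<le> k" for k
  proof -
    obtain M where M: "\<And>y. y \<in> S \<Longrightarrow> norm (U k y) \<le> M * norm y" using U_bdd k by blast
    have hi: "((\<lambda>s. U s x) has_integral integral {k..h+k} (\<lambda>s. U s x)) (cbox k (h+k))"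
      using int[OF k] by auto
    have "((\<lambda>s. U (s + k) x) has_integral integral {k..h+k} (\<lambda>s. U s x)) {0..h}"
      using has_integral_affinity'[OF hi, of 1 k] by simp
    then have hs: "((\<lambda>s. U k (U s x)) has_integral integral {k..h+k} (\<lambda>s. U s x)) {0..h}"
      by (rule has_integral_eq[rotated]) (use k x U_add[of k _ x] in \<open>auto simp: add.commute[of _ k]\<close>)
    have "U k (\<Phi> h) = integral {0..h} (\<lambda>s. U k (U s x))" unfolding \<Phi>_def
      by (rule integral_on_closed_subspace(2)[where M=M]) (use int hs M U_lin k in \<open>auto intro: U_in x\<close>)
    also have "\<dots> = integral {k..h+k} (\<lambda>s. U s x)" using hs by (rule integral_unique)
    also have "\<dots> = \<Phi> (h + k) - \<Phi> k"
      using Henstock_Kurzweil_Integration.integral_combine[of 0 k "h+k" "\<lambda>s. U s x"] k h int[of 0 "h+k"]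
      by (simp add: \<Phi>_def algebra_simps)
    finally show ?thesis .
  qed
  have der: "(\<Phi> has_vector_derivative U t x) (at t within {0..h+1})" if "t \<in> {0..h+1}" for t
    unfolding \<Phi>_def using integral_has_vector_derivative[OF contx that] by simp
  have q: "((\<lambda>k. (1 / k) *\<^sub>R (\<Phi> (t + k) - \<Phi> t)) \<longlongrightarrow> U t x) (at_right 0)" if t: "0 \<le> t" "t \<le> h" for t
  proof -
    have "((\<lambda>s. (1 / (s - t)) *\<^sub>R (\<Phi> s - \<Phi> t)) \<longlongrightarrow> U t x) (at t within {0..h+1})"
      using der[of t] t by (simp add: has_vector_derivative_iff_quotient)
    then have "((\<lambda>s. (1 / (s - t)) *\<^sub>R (\<Phi> s - \<Phi> t)) \<longlongrightarrow> U t x) (at t within {t..h+1})"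
      by (rule tendsto_within_subset) (use t in auto)
    then have "((\<lambda>s. (1 / (s - t)) *\<^sub>R (\<Phi> s - \<Phi> t)) \<longlongrightarrow> U t x) (at_right t)"
      using t at_within_Icc_at_right[of t "h+1"] by simp
    then show ?thesis by (subst (asm) filterlim_at_right_to_0) (simp add: add.commute)
  qed
  have "((\<lambda>k. (1 / k) *\<^sub>R (\<Phi> (h + k) - \<Phi> h) - (1 / k) *\<^sub>R (\<Phi> (0 + k) - \<Phi> 0)) \<longlongrightarrow> U h x - U 0 x) (at_right 0)"
    using h by (intro tendsto_diff q) auto
  moreover have "eventually (\<lambda>k. (1 / k) *\<^sub>R (\<Phi> (h + k) - \<Phi> h) - (1 / k) *\<^sub>R (\<Phi> (0 + k) - \<Phi> 0)
      = (1 / k) *\<^sub>R (U k (\<Phi> h) - \<Phi> h)) (at_right 0)"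
    unfolding eventually_at_right_field
    by (intro exI[of _ 1]) (auto simp: shift scaleR_diff_right[symmetric], simp add: \<Phi>_def algebra_simps)
  ultimately have "gen (\<Phi> h) (U h x - x)" using \<Phi>S x h U_0[OF x]
    by (auto simp: gen_def intro!: S_diff U_in intro: Lim_transform_eventually)
  from gen_lin[OF this this, of "1 / h" 0] show ?thesis by (simp add: \<Phi>_def)
qed

lemma mean_tendsto:
  assumes x: "x \<in> S" and e: "e > 0"
  shows "\<exists>h>0. norm ((1 / h) *\<^sub>R integral {0..h} (\<lambda>s. U s x) - x) < e"
proof -
  have cont: "continuous_on {0..1} (\<lambda>s. U s x)"
    using U_continuous[OF x] by (rule continuous_on_subset) auto
  have "((\<lambda>t. integral {0..t} (\<lambda>s. U s x)) has_vector_derivative U 0 x) (at 0 within {0..1})"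
    using integral_has_vector_derivative[OF cont] by simp
  then have "((\<lambda>h. (1 / h) *\<^sub>R integral {0..h} (\<lambda>s. U s x)) \<longlongrightarrow> x) (at 0 within {0..1})"
    by (simp add: has_vector_derivative_iff_quotient U_0[OF x])
  from tendstoD[OF this e] obtain d where d: "d > 0"
    "\<And>h. h \<in> {0..1} \<Longrightarrow> h \<noteq> 0 \<Longrightarrow> \<bar>h\<bar> < d \<Longrightarrow> norm ((1 / h) *\<^sub>R integral {0..h} (\<lambda>s. U s x) - x) < e"
    by (auto simp: eventually_at dist_real_def dist_norm)
  show ?thesis using d(2)[of "min (d/2) 1"] d(1) by (intro exI[of _ "min (d/2) 1"]) auto
qed

text \<open>Averages twice. The inner mean \<open>m\<close> lies in the domain, so the derivative of
  the outer mean, a multiple of \<open>U k m - m\<close>, is a combination of domain elements and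
  can be differentiated again.\<close>

lemma gen2_dense:
  assumes x: "x \<in> S" and e: "e > 0"
  shows "\<exists>x' y z. gen x' y \<and> gen y z \<and> norm (x' - x) < e"
proof -
  have e2: "e / 2 > 0" using e by simp
  obtain h where h: "h > 0" "norm ((1 / h) *\<^sub>R integral {0..h} (\<lambda>s. U s x) - x) < e / 2"
    using mean_tendsto[OF x e2] by blast
  define m where "m = (1 / h) *\<^sub>R integral {0..h} (\<lambda>s. U s x)"
  have gm: "gen m ((1 / h) *\<^sub>R (U h x - x))" unfolding m_def by (rule gen_mean[OF x h(1)])
  then have mS: "m \<in> S" by (simp add: gen_def)
  obtain k where k: "k > 0" "norm ((1 / k) *\<^sub>R integral {0..k} (\<lambda>s. U s m) - m) < e / 2"
    using mean_tendsto[OF mS e2] by blast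
  have "gen ((1 / k) *\<^sub>R integral {0..k} (\<lambda>s. U s m)) ((1 / k) *\<^sub>R (U k m - m))"
    by (rule gen_mean[OF mS k(1)])
  moreover have "\<exists>z. gen ((1 / k) *\<^sub>R (U k m - m)) z"
    using gen_lin[OF gen_U[OF gm, of k] gm, of "1 / k" "- (1 / k)"] k(1)
    by (auto simp: scaleR_diff_right)
  moreover have "norm ((1 / k) *\<^sub>R integral {0..k} (\<lambda>s. U s m) - x) < e"
    using k(2) h(2) norm_triangle_ineq[of "(1 / k) *\<^sub>R integral {0..k} (\<lambda>s. U s m) - m" "m - x"]
    by (simp add: m_def)
  ultimately show ?thesis by blast
qed

end

section \<open>Integration by parts without differentiation\<close>

text \<open>Sums of squared increments over a fine partition are at most the largest increment of
  \<open>G\<close> times its total growth, and the former tends to 0 by uniform continuity.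
  Increments of \<open>G\<close> in place of the usual \<open>(\<beta> - \<alpha>)\<^sup>2\<close>
  admit integrable densities that are unbounded.\<close>

lemma const_of_square_increments:
  fixes k G :: "real \<Rightarrow> real"
  assumes c: "0 \<le> c" and cont: "continuous_on {0..c} G"
    and incr: "\<And>\<alpha> \<beta>. 0 \<le> \<alpha> \<Longrightarrow> \<alpha> \<le> \<beta> \<Longrightarrow> \<beta> \<le> c \<Longrightarrow> \<bar>k \<beta> - k \<alpha>\<bar> \<le> (G \<beta> - G \<alpha>)\<^sup>2"
    and mono: "\<And>\<alpha> \<beta>. 0 \<le> \<alpha> \<Longrightarrow> \<alpha> \<le> \<beta> \<Longrightarrow> \<beta> \<le> c \<Longrightarrow> G \<alpha> \<le> G \<beta>"
  shows "k c = k 0"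
proof -
  have GG: "0 \<le> G c - G 0" using mono[of 0 c] c by simp
  have bound: "\<bar>k c - k 0\<bar> \<le> e * (G c - G 0)" if e: "e > 0" for e
  proof -
    have "uniformly_continuous_on {0..c} G" by (rule compact_uniformly_continuous[OF cont]) simp
    then obtain d where d: "d > 0" "\<And>x y. x \<in> {0..c} \<Longrightarrow> y \<in> {0..c} \<Longrightarrow> dist y x < d \<Longrightarrow> dist (G y) (G x) < e"
      unfolding uniformly_continuous_on_def using e by metis
    obtain n :: nat where n: "c / d < real n" using reals_Archimedean2 by blast
    have n0: "real n > 0" using n c d(1) by (smt (verit) divide_nonneg_pos)
    define x where "x i = c * real i / real n" for i :: nat
    have x: "0 \<le> x i" "x i \<le> x (Suc i)" "x (Suc i) \<le> c" "x (Suc i) - x i < d" if "i < n" for i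
    proof -
      show "0 \<le> x i" using c by (simp add: x_def)
      show "x i \<le> x (Suc i)" using c n0 by (auto simp: x_def intro!: divide_right_mono mult_left_mono)
      have "c * real (Suc i) \<le> c * real n" using that c by (intro mult_left_mono) auto
      then show "x (Suc i) \<le> c" using n0 by (simp add: x_def field_simps)
      have "x (Suc i) - x i = c / real n" by (simp add: x_def add_divide_distrib distrib_left)
      also have "\<dots> < d" using n n0 d(1) by (simp add: field_simps)
      finally show "x (Suc i) - x i < d" .
    qed
    have "\<bar>k c - k 0\<bar> = \<bar>\<Sum>i<n. k (x (Suc i)) - k (x i)\<bar>"
      using n0 by (subst sum_lessThan_telescope) (simp add: x_def)
    also have "\<dots> \<le> (\<Sum>i<n. \<bar>k (x (Suc i)) - k (x i)\<bar>)" by (rule sum_abs)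
    also have "\<dots> \<le> (\<Sum>i<n. e * (G (x (Suc i)) - G (x i)))"
    proof (rule sum_mono)
      fix i assume "i \<in> {..<n}"
      then have i: "i < n" by simp
      have "\<bar>k (x (Suc i)) - k (x i)\<bar> \<le> (G (x (Suc i)) - G (x i))\<^sup>2" using x[OF i] by (intro incr) auto
      also have "\<dots> \<le> e * (G (x (Suc i)) - G (x i))"
        unfolding power2_eq_square
      proof (rule mult_right_mono)
        show "G (x (Suc i)) - G (x i) \<le> e"
          using d(2)[of "x i" "x (Suc i)"] x[OF i] by (auto simp: dist_real_def)
        show "0 \<le> G (x (Suc i)) - G (x i)" using mono x[OF i] by simp
      qed
      finally show "\<bar>k (x (Suc i)) - k (x i)\<bar> \<le> e * (G (x (Suc i)) - G (x i))" .
    qed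
    also have "\<dots> = e * (\<Sum>i<n. G (x (Suc i)) - G (x i))" by (simp only: sum_distrib_left)
    also have "(\<Sum>i<n. G (x (Suc i)) - G (x i)) = G c - G 0"
      using n0 by (subst sum_lessThan_telescope) (simp add: x_def)
    finally show ?thesis .
  qed
  have "\<bar>k c - k 0\<bar> \<le> 0 + e" if e: "e > 0" for e
  proof -
    \<comment> \<open>The added 1 covers a constant \<open>G\<close>.\<close>
    have "\<bar>k c - k 0\<bar> \<le> e / (G c - G 0 + 1) * (G c - G 0)"
      using e GG by (intro bound) auto
    also have "\<dots> \<le> e" using e GG by (simp add: field_simps)
    finally show ?thesis by simp
  qed
  then show ?thesis using field_le_epsilon[of "\<bar>k c - k 0\<bar>" 0] by simp
qed

lemma has_integral_increment:
  fixes p :: "real \<Rightarrow> 'a::banach"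
  assumes "\<And>\<rho>. \<rho> \<in> {0..c} \<Longrightarrow> (p has_integral (P \<rho> - P 0)) {0..\<rho>}"
    and "0 \<le> \<alpha>" "\<alpha> \<le> \<beta>" "\<beta> \<le> c"
  shows "(p has_integral (P \<beta> - P \<alpha>)) {\<alpha>..\<beta>}"
proof -
  have \<beta>: "(p has_integral (P \<beta> - P 0)) {0..\<beta>}" and \<alpha>: "(p has_integral (P \<alpha> - P 0)) {0..\<alpha>}"
    using assms by auto
  have "p integrable_on {\<alpha>..\<beta>}"
    using integrable_subinterval_real[OF has_integral_integrable[OF \<beta>], of \<alpha> \<beta>] assms by auto
  then obtain I where I: "(p has_integral I) {\<alpha>..\<beta>}" by blast
  have "(p has_integral (P \<alpha> - P 0 + I)) {0..\<beta>}"
    using assms by (intro has_integral_combine[OF _ _ \<alpha> I]) auto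
  then have "P \<alpha> - P 0 + I = P \<beta> - P 0" using \<beta> has_integral_unique by blast
  then have "I = P \<beta> - P \<alpha>" by (metis add_diff_cancel_left' add.commute diff_add_cancel diff_diff_eq2)
  then show ?thesis using I by simp
qed

text \<open>No differentiability almost everywhere is needed (it may not be at hand in a nonseparable space):
  the increments of the difference of both sides are quadratically small.\<close>

lemma integration_by_parts_inner:
  fixes P Q p q :: "real \<Rightarrow> 'a::{real_inner,banach}"
  assumes c: "0 \<le> c"
    and P: "\<And>\<rho>. \<rho> \<in> {0..c} \<Longrightarrow> (p has_integral (P \<rho> - P 0)) {0..\<rho>}"
    and Q: "\<And>\<rho>. \<rho> \<in> {0..c} \<Longrightarrow> (q has_integral (Q \<rho> - Q 0)) {0..\<rho>}"
    and np: "(\<lambda>\<sigma>. norm (p \<sigma>)) integrable_on {0..c}" and nq: "(\<lambda>\<sigma>. norm (q \<sigma>)) integrable_on {0..c}"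
    and r: "(\<lambda>\<sigma>. inner (P \<sigma>) (q \<sigma>) + inner (p \<sigma>) (Q \<sigma>)) integrable_on {0..c}"
  shows "((\<lambda>\<sigma>. inner (P \<sigma>) (q \<sigma>) + inner (p \<sigma>) (Q \<sigma>)) has_integral
           (inner (P c) (Q c) - inner (P 0) (Q 0))) {0..c}"
proof -
  let ?r = "\<lambda>\<sigma>. inner (P \<sigma>) (q \<sigma>) + inner (p \<sigma>) (Q \<sigma>)"
  let ?n = "\<lambda>\<sigma>. norm (p \<sigma>) + norm (q \<sigma>)"
  \<comment> \<open>\<open>G\<close> accumulates both densities and hence dominates the increments
    of \<open>P\<close> and of \<open>Q\<close> simultaneously.\<close>
  define G where "G \<rho> = integral {0..\<rho>} ?n" for \<rho>
  define k where "k \<rho> = inner (P \<rho>) (Q \<rho>) - integral {0..\<rho>} ?r" for \<rho>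
  have ni: "?n integrable_on {0..c}" using np nq by (rule integrable_add)
  have sub: "f integrable_on {\<alpha>..\<beta>}" if "f integrable_on {0..c}" "0 \<le> \<alpha>" "\<beta> \<le> c" for f :: "real \<Rightarrow> real" and \<alpha> \<beta>
    using integrable_subinterval_real[OF that(1)] that by auto
  have comb: "integral {0..\<beta>} f - integral {0..\<alpha>} f = integral {\<alpha>..\<beta>} f"
    if "f integrable_on {0..c}" "0 \<le> \<alpha>" "\<alpha> \<le> \<beta>" "\<beta> \<le> c" for f :: "real \<Rightarrow> real" and \<alpha> \<beta>
    using Henstock_Kurzweil_Integration.integral_combine[of 0 \<alpha> \<beta> f] sub[OF that(1), of 0 \<beta>] that by simp
  have Ginc: "G \<beta> - G \<alpha> = integral {\<alpha>..\<beta>} ?n" if "0 \<le> \<alpha>" "\<alpha> \<le> \<beta>" "\<beta> \<le> c" for \<alpha> \<beta>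
    unfolding G_def using comb[OF ni that] .
  have Gmono: "G \<alpha> \<le> G \<beta>" if "0 \<le> \<alpha>" "\<alpha> \<le> \<beta>" "\<beta> \<le> c" for \<alpha> \<beta>
    using Ginc[OF that] Henstock_Kurzweil_Integration.integral_nonneg[OF sub[OF ni that(1,3)]] by simp
  have Pinc: "norm (R \<tau> - R \<sigma>) \<le> G \<tau> - G \<sigma>"
    if R: "(s has_integral (R \<tau> - R \<sigma>)) {\<sigma>..\<tau>}" and s: "\<And>x. norm (s x) \<le> ?n x"
      and *: "0 \<le> \<sigma>" "\<sigma> \<le> \<tau>" "\<tau> \<le> c" for R s :: "real \<Rightarrow> 'a" and \<sigma> \<tau>
    unfolding Ginc[OF *] integral_unique[OF R, symmetric]
    by (rule Henstock_Kurzweil_Integration.integral_norm_bound_integral[OF has_integral_integrable[OF R] sub[OF ni *(1,3)]])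
       (use s in auto)
  have "k c = k 0"
  proof (rule const_of_square_increments[OF c])
    show "continuous_on {0..c} G" unfolding G_def by (rule indefinite_integral_continuous_1[OF ni])
  next
    fix \<alpha> \<beta> assume ab: "0 \<le> \<alpha>" "\<alpha> \<le> \<beta>" "\<beta> \<le> c"
    show "G \<alpha> \<le> G \<beta>" by (rule Gmono[OF ab])
    \<comment> \<open>With \<open>P\<close> frozen at the right end and \<open>Q\<close> at the left
      end both products integrate exactly, and their sum is the increment of the inner
      product.\<close>
    have 1: "((\<lambda>\<sigma>. inner (P \<beta>) (q \<sigma>)) has_integral inner (P \<beta>) (Q \<beta> - Q \<alpha>)) {\<alpha>..\<beta>}"
      using has_integral_linear[OF has_integral_increment[OF Q ab] bounded_linear_inner_right[of "P \<beta>"]]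
      by (simp add: o_def)
    have 2: "((\<lambda>\<sigma>. inner (p \<sigma>) (Q \<alpha>)) has_integral inner (P \<beta> - P \<alpha>) (Q \<alpha>)) {\<alpha>..\<beta>}"
      using has_integral_linear[OF has_integral_increment[OF P ab] bounded_linear_inner_left[of "Q \<alpha>"]]
      by (simp add: o_def)
    have 3: "(?r has_integral integral {\<alpha>..\<beta>} ?r) {\<alpha>..\<beta>}"
      using sub[OF r ab(1,3)] by (rule integrable_integral)
    have 4: "((\<lambda>\<sigma>. inner (P \<beta>) (q \<sigma>) + inner (p \<sigma>) (Q \<alpha>) - ?r \<sigma>) has_integral
        inner (P \<beta>) (Q \<beta> - Q \<alpha>) + inner (P \<beta> - P \<alpha>) (Q \<alpha>) - integral {\<alpha>..\<beta>} ?r) {\<alpha>..\<beta>}"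
      using 1 2 3 by (intro has_integral_diff has_integral_add)
    have keq: "k \<beta> - k \<alpha> = inner (P \<beta>) (Q \<beta> - Q \<alpha>) + inner (P \<beta> - P \<alpha>) (Q \<alpha>) - integral {\<alpha>..\<beta>} ?r"
      unfolding k_def using comb[OF r ab] by (simp add: inner_diff_left inner_diff_right)
    have "norm (integral {\<alpha>..\<beta>} (\<lambda>\<sigma>. inner (P \<beta>) (q \<sigma>) + inner (p \<sigma>) (Q \<alpha>) - ?r \<sigma>))
        \<le> integral {\<alpha>..\<beta>} (\<lambda>\<sigma>. (G \<beta> - G \<alpha>) * ?n \<sigma>)"
    proof (rule Henstock_Kurzweil_Integration.integral_norm_bound_integral)
      show "(\<lambda>\<sigma>. inner (P \<beta>) (q \<sigma>) + inner (p \<sigma>) (Q \<alpha>) - ?r \<sigma>) integrable_on {\<alpha>..\<beta>}"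
        using 4 by blast
      show "(\<lambda>\<sigma>. (G \<beta> - G \<alpha>) * ?n \<sigma>) integrable_on {\<alpha>..\<beta>}"
        using sub[OF ni ab(1,3)] by (rule integrable_on_mult_right)
      fix \<sigma> assume \<sigma>: "\<sigma> \<in> {\<alpha>..\<beta>}"
      \<comment> \<open>What is left pairs an increment, at most
        \<open>G \<beta> - G \<alpha>\<close>, with a density; integrating the density produces the
        second factor of the square.\<close>
      have "inner (P \<beta>) (q \<sigma>) + inner (p \<sigma>) (Q \<alpha>) - ?r \<sigma> = inner (P \<beta> - P \<sigma>) (q \<sigma>) - inner (p \<sigma>) (Q \<sigma> - Q \<alpha>)"
        by (simp add: inner_diff_left inner_diff_right)
      also have "norm \<dots> \<le> norm (P \<beta> - P \<sigma>) * norm (q \<sigma>) + norm (p \<sigma>) * norm (Q \<sigma> - Q \<alpha>)"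
        using Cauchy_Schwarz_ineq2[of "P \<beta> - P \<sigma>" "q \<sigma>"] Cauchy_Schwarz_ineq2[of "p \<sigma>" "Q \<sigma> - Q \<alpha>"] by simp
      also have "\<dots> \<le> (G \<beta> - G \<alpha>) * norm (q \<sigma>) + norm (p \<sigma>) * (G \<beta> - G \<alpha>)"
      proof (intro add_mono mult_right_mono mult_left_mono)
        have "norm (P \<beta> - P \<sigma>) \<le> G \<beta> - G \<sigma>"
          using \<sigma> ab by (intro Pinc[OF has_integral_increment[OF P]]) auto
        also have "\<dots> \<le> G \<beta> - G \<alpha>" using Gmono[of \<alpha> \<sigma>] \<sigma> ab by simp
        finally show "norm (P \<beta> - P \<sigma>) \<le> G \<beta> - G \<alpha>" .
        have "norm (Q \<sigma> - Q \<alpha>) \<le> G \<sigma> - G \<alpha>"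
          using \<sigma> ab by (intro Pinc[OF has_integral_increment[OF Q]]) auto
        also have "\<dots> \<le> G \<beta> - G \<alpha>" using Gmono[of \<sigma> \<beta>] \<sigma> ab by simp
        finally show "norm (Q \<sigma> - Q \<alpha>) \<le> G \<beta> - G \<alpha>" .
      qed auto
      also have "\<dots> = (G \<beta> - G \<alpha>) * ?n \<sigma>" by (simp add: algebra_simps)
      finally show "norm (inner (P \<beta>) (q \<sigma>) + inner (p \<sigma>) (Q \<alpha>) - ?r \<sigma>) \<le> (G \<beta> - G \<alpha>) * ?n \<sigma>" .
    qed
    also have "\<dots> = (G \<beta> - G \<alpha>) * (G \<beta> - G \<alpha>)" by (simp add: Ginc[OF ab])
    finally show "\<bar>k \<beta> - k \<alpha>\<bar> \<le> (G \<beta> - G \<alpha>)\<^sup>2"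
      unfolding keq integral_unique[OF 4] power2_eq_square by simp
  qed
  then have "integral {0..c} ?r = inner (P c) (Q c) - inner (P 0) (Q 0)" by (simp add: k_def)
  then show ?thesis using integrable_integral[OF r] by simp
qed

section \<open>Square integrable functions with values in a Hilbert space\<close>

abbreviation "I01 \<equiv> lebesgue_on {0..1::real}"

lemma space_I01 [simp]: "space I01 = {0..1}"
  by (simp add: space_restrict_space)

lemma integrable_I01_bound:
  fixes f :: "real \<Rightarrow> real" and g :: "real \<Rightarrow> 'a::{banach,second_countable_topology}"
  assumes "integrable I01 f" "g \<in> borel_measurable I01" "\<And>\<rho>. \<rho> \<in> {0..1} \<Longrightarrow> norm (g \<rho>) \<le> f \<rho>"
  shows "integrable I01 g"
  using assms(1,2)
proof (rule Bochner_Integration.integrable_bound)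
  show "AE \<rho> in I01. norm (g \<rho>) \<le> norm (f \<rho>)"
    using assms(3) by (intro AE_I2) (metis abs_ge_self order_trans real_norm_def space_I01)
qed

lemma integrable_I01_const [simp]: "integrable I01 (\<lambda>_. c::real)"
proof -
  interpret finite_measure I01 by (rule finite_measure_lebesgue_on) simp
  show ?thesis by simp
qed

lemma integral_I01_const [simp]: "(\<integral>\<rho>. c \<partial>I01) = (c::real)"
  by (simp add: measure_restrict_space)

lemma continuous_imp_measurable_I01: "continuous_on {0..1} f \<Longrightarrow> f \<in> borel_measurable I01"
  for f :: "real \<Rightarrow> real"
  by (rule continuous_imp_measurable_on_sets_lebesgue) auto

text \<open>The pointwise \<open>lim\<close> is measurable and differs from \<open>g\<close> on a
  null set only; completeness of Lebesgue measure does the rest.\<close>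

lemma measurable_I01_AE_limit:
  fixes f :: "nat \<Rightarrow> real \<Rightarrow> real"
  assumes f: "\<And>n. f n \<in> borel_measurable I01" and lim: "AE \<rho> in I01. (\<lambda>n. f n \<rho>) \<longlonglongrightarrow> g \<rho>"
  shows "g \<in> borel_measurable I01"
proof -
  define h where "h \<rho> = lim (\<lambda>n. f n \<rho>)" for \<rho>
  have h: "h \<in> borel_measurable I01" unfolding h_def by (rule borel_measurable_lim_metric[OF f])
  have "AE \<rho> in I01. h \<rho> = g \<rho>" using lim by eventually_elim (auto simp: h_def limI)
  then have "AE \<rho> in lebesgue. \<rho> \<in> {0..1} \<longrightarrow> h \<rho> = g \<rho>"
    by (subst (asm) AE_restrict_space_iff) auto
  then have "AE \<rho> in lebesgue. indicator {0..1} \<rho> *\<^sub>R h \<rho> = indicator {0..1} \<rho> *\<^sub>R g \<rho>"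
    by eventually_elim (auto simp: indicator_def)
  moreover have "(\<lambda>\<rho>. indicator {0..1} \<rho> *\<^sub>R h \<rho>) \<in> borel_measurable lebesgue"
    using h by (subst (asm) borel_measurable_restrict_space_iff) auto
  ultimately have "(\<lambda>\<rho>. indicator {0..1} \<rho> *\<^sub>R g \<rho>) \<in> borel_measurable lebesgue"
    by (rule borel_measurable_AE[rotated])
  then show ?thesis by (subst borel_measurable_restrict_space_iff) auto
qed

section \<open>Strongly measurable functions with values in a normed space\<close>

lemma strongly_meas01_simple: "simple_function I01 z \<Longrightarrow> strongly_meas01 z"
  unfolding strongly_meas01_def by (intro exI[of _ "\<lambda>_. z"]) auto

text \<open>Applies \<open>h\<close> to the approximating simple functions. Sums of Borel functions
  into a nonseparable space need not be Borel, so this takes the place of the usual closure rules;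
  scalar results become Borel afterwards through \<open>strongly_meas01_real\<close>.\<close>

lemma strongly_meas01_map2:
  assumes "strongly_meas01 z" "strongly_meas01 z'"
    and h: "\<And>f g x y. f \<longlonglongrightarrow> x \<Longrightarrow> g \<longlonglongrightarrow> y \<Longrightarrow> (\<lambda>n. h (f n) (g n)) \<longlonglongrightarrow> h x y"
  shows "strongly_meas01 (\<lambda>\<rho>. h (z \<rho>) (z' \<rho>))"
proof -
  obtain s s' where s: "\<And>n. simple_function I01 (s n)" "AE \<rho> in I01. (\<lambda>n. s n \<rho>) \<longlonglongrightarrow> z \<rho>"
    and s': "\<And>n. simple_function I01 (s' n)" "AE \<rho> in I01. (\<lambda>n. s' n \<rho>) \<longlonglongrightarrow> z' \<rho>"
    using assms(1,2) unfolding strongly_meas01_def by blast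
  have "AE \<rho> in I01. (\<lambda>n. h (s n \<rho>) (s' n \<rho>)) \<longlonglongrightarrow> h (z \<rho>) (z' \<rho>)"
    using s(2) s'(2) by eventually_elim (rule h)
  then show ?thesis using simple_function_compose2[OF s(1) s'(1), of h]
    unfolding strongly_meas01_def by (intro exI[of _ "\<lambda>n \<rho>. h (s n \<rho>) (s' n \<rho>)"]) auto
qed

lemma strongly_meas01_real: "strongly_meas01 f \<Longrightarrow> f \<in> borel_measurable I01" for f :: "real \<Rightarrow> real"
  unfolding strongly_meas01_def
  by (auto intro: measurable_I01_AE_limit borel_measurable_simple_function)

lemma strongly_meas01_const: "strongly_meas01 (\<lambda>_. c)"
  by (rule strongly_meas01_simple) simp

lemma strongly_meas01_add:
  assumes "strongly_meas01 z" "strongly_meas01 z'"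
  shows "strongly_meas01 (\<lambda>\<rho>. z \<rho> + z' \<rho>)"
  by (rule strongly_meas01_map2[OF assms, where h="\<lambda>x y. x + y"]) (rule tendsto_add)

lemma strongly_meas01_scaleR:
  assumes "strongly_meas01 z"
  shows "strongly_meas01 (\<lambda>\<rho>. c *\<^sub>R z \<rho>)"
  by (rule strongly_meas01_map2[OF assms assms, where h="\<lambda>x y. c *\<^sub>R x"]) (rule tendsto_scaleR[OF tendsto_const])

lemma strongly_meas01_inner:
  assumes "strongly_meas01 z" "strongly_meas01 z'"
  shows "(\<lambda>\<rho>. inner (z \<rho>) (z' \<rho>)) \<in> borel_measurable I01"
  by (rule strongly_meas01_real, rule strongly_meas01_map2[OF assms, where h=inner]) (rule tendsto_inner)

lemma strongly_meas01_norm: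
  assumes "strongly_meas01 z"
  shows "(\<lambda>\<rho>. norm (z \<rho>)) \<in> borel_measurable I01"
  by (rule strongly_meas01_real, rule strongly_meas01_map2[OF assms assms, where h="\<lambda>x y. norm x"])
    (rule tendsto_norm)

lemma norm_add_sq_le: "(norm (x + y))\<^sup>2 \<le> 2 * (norm x)\<^sup>2 + 2 * (norm y)\<^sup>2"
  for x y :: "'a::real_normed_vector"
proof -
  have "(norm (x + y))\<^sup>2 \<le> (norm x + norm y)\<^sup>2" by (intro power_mono norm_triangle_ineq) auto
  also have "\<dots> \<le> 2 * (norm x)\<^sup>2 + 2 * (norm y)\<^sup>2"
    using sum_squares_bound[of "norm x" "norm y"] by (simp add: power2_sum)
  finally show ?thesis .
qed

section \<open>Vector operations on square integrable functions\<close>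

lemma L2_01_iff: "z \<in> L2_01 \<longleftrightarrow> strongly_meas01 z \<and> integrable I01 (\<lambda>\<rho>. (norm (z \<rho>))\<^sup>2)"
  by (simp add: L2_01_def)

lemma L2_01_add:
  assumes "z \<in> L2_01" "z' \<in> L2_01"
  shows "(\<lambda>\<rho>. z \<rho> + z' \<rho>) \<in> L2_01"
proof -
  have m: "strongly_meas01 (\<lambda>\<rho>. z \<rho> + z' \<rho>)" using assms by (simp add: L2_01_iff strongly_meas01_add)
  have "integrable I01 (\<lambda>\<rho>. (norm (z \<rho> + z' \<rho>))\<^sup>2)"
  proof (rule integrable_I01_bound)
    show "integrable I01 (\<lambda>\<rho>. 2 * (norm (z \<rho>))\<^sup>2 + 2 * (norm (z' \<rho>))\<^sup>2)"
      using assms by (simp add: L2_01_iff)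
    show "(\<lambda>\<rho>. (norm (z \<rho> + z' \<rho>))\<^sup>2) \<in> borel_measurable I01"
      by (intro borel_measurable_power strongly_meas01_norm m)
  qed (simp add: norm_add_sq_le)
  with m show ?thesis by (simp add: L2_01_iff)
qed

lemma L2_01_scaleR: "z \<in> L2_01 \<Longrightarrow> (\<lambda>\<rho>. c *\<^sub>R z \<rho>) \<in> L2_01"
  unfolding L2_01_iff by (auto intro!: strongly_meas01_scaleR simp: power_mult_distrib)

lemma L2_01_diff: "z \<in> L2_01 \<Longrightarrow> z' \<in> L2_01 \<Longrightarrow> (\<lambda>\<rho>. z \<rho> - z' \<rho>) \<in> L2_01"
  using L2_01_add[of z "\<lambda>\<rho>. - 1 *\<^sub>R z' \<rho>"] L2_01_scaleR[of z' "-1"] by simp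

lemma L2_01_const: "(\<lambda>_. c) \<in> L2_01"
  by (simp add: L2_01_iff strongly_meas01_const)

lemma L2_01_simple: "simple_function I01 z \<Longrightarrow> z \<in> L2_01" for z :: "real \<Rightarrow> 'a::real_normed_vector"
proof -
  assume z: "simple_function I01 z"
  have "integrable I01 (\<lambda>\<rho>. (norm (z \<rho>))\<^sup>2)"
  proof (rule integrable_I01_bound)
    show "integrable I01 (\<lambda>_. \<Sum>x\<in>z ` {0..1}. (norm x)\<^sup>2)" by simp
    show "(\<lambda>\<rho>. (norm (z \<rho>))\<^sup>2) \<in> borel_measurable I01"
      by (intro borel_measurable_power strongly_meas01_norm strongly_meas01_simple z)
    show "norm ((norm (z \<rho>))\<^sup>2) \<le> (\<Sum>x\<in>z ` {0..1}. (norm x)\<^sup>2)" if "\<rho> \<in> {0..1}" for \<rho>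
      using that z by (auto intro!: member_le_sum[of "z \<rho>" _ "\<lambda>x. (norm x)\<^sup>2"] simp: simple_function_def)
  qed
  then show ?thesis using strongly_meas01_simple[OF z] by (simp add: L2_01_iff)
qed

lemma L2_norm2_nonneg [simp]: "0 \<le> L2_norm2 z"
  by (simp add: L2_norm2_def)

lemma L2_norm2_add_le:
  assumes "z \<in> L2_01" "z' \<in> L2_01"
  shows "L2_norm2 (\<lambda>\<rho>. z \<rho> + z' \<rho>) \<le> 2 * L2_norm2 z + 2 * L2_norm2 z'"
proof -
  have "L2_norm2 (\<lambda>\<rho>. z \<rho> + z' \<rho>) \<le> (\<integral>\<rho>. 2 * (norm (z \<rho>))\<^sup>2 + 2 * (norm (z' \<rho>))\<^sup>2 \<partial>I01)"
    unfolding L2_norm2_def using L2_01_add[OF assms] assms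
    by (intro integral_mono) (auto simp: L2_01_iff norm_add_sq_le)
  also have "\<dots> = 2 * L2_norm2 z + 2 * L2_norm2 z'"
    using assms by (simp add: L2_norm2_def L2_01_iff)
  finally show ?thesis .
qed

section \<open>Weighted inner products and the Cauchy-Schwarz inequality\<close>

definition wip :: "(real \<Rightarrow> real) \<Rightarrow> (real \<Rightarrow> 'a::real_inner) \<Rightarrow> (real \<Rightarrow> 'a) \<Rightarrow> real" where
  "wip \<phi> z z' = (\<integral>\<rho>. \<phi> \<rho> * inner (z \<rho>) (z' \<rho>) \<partial>I01)"

lemma wip_sym: "wip \<phi> z z' = wip \<phi> z' z"
  by (simp add: wip_def inner_commute)

lemma wip_1_same: "wip (\<lambda>_. 1) z z = L2_norm2 z"
  by (simp add: wip_def L2_norm2_def power2_norm_eq_inner)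

lemma weight_bound:
  fixes \<phi> :: "real \<Rightarrow> real"
  assumes "continuous_on {0..1} \<phi>"
  obtains K where "K > 0" "\<And>\<rho>. \<rho> \<in> {0..1} \<Longrightarrow> \<bar>\<phi> \<rho>\<bar> \<le> K"
proof -
  have "bounded (\<phi> ` {0..1})" using assms compact_continuous_image compact_imp_bounded by blast
  then show ?thesis using that unfolding bounded_pos by auto
qed

lemma integrable_wip:
  assumes z: "z \<in> L2_01" "z' \<in> L2_01" and \<phi>: "continuous_on {0..1} \<phi>"
  shows "integrable I01 (\<lambda>\<rho>. \<phi> \<rho> * inner (z \<rho>) (z' \<rho>))"
proof -
  obtain K where K: "K > 0" "\<And>\<rho>. \<rho> \<in> {0..1} \<Longrightarrow> \<bar>\<phi> \<rho>\<bar> \<le> K" using weight_bound[OF \<phi>] by blast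
  show ?thesis
  proof (rule integrable_I01_bound)
    show "integrable I01 (\<lambda>\<rho>. K * ((norm (z \<rho>))\<^sup>2 + (norm (z' \<rho>))\<^sup>2))"
      using z by (simp add: L2_01_iff)
    show "(\<lambda>\<rho>. \<phi> \<rho> * inner (z \<rho>) (z' \<rho>)) \<in> borel_measurable I01"
      using z by (intro borel_measurable_times continuous_imp_measurable_I01 \<phi> strongly_meas01_inner) (auto simp: L2_01_iff)
    fix \<rho> :: real assume \<rho>: "\<rho> \<in> {0..1}"
    have "\<bar>inner (z \<rho>) (z' \<rho>)\<bar> \<le> (norm (z \<rho>))\<^sup>2 + (norm (z' \<rho>))\<^sup>2"
      using Cauchy_Schwarz_ineq2[of "z \<rho>" "z' \<rho>"] sum_squares_bound[of "norm (z \<rho>)" "norm (z' \<rho>)"]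
        mult_nonneg_nonneg[OF norm_ge_zero[of "z \<rho>"] norm_ge_zero[of "z' \<rho>"]]
      by linarith
    then show "norm (\<phi> \<rho> * inner (z \<rho>) (z' \<rho>)) \<le> K * ((norm (z \<rho>))\<^sup>2 + (norm (z' \<rho>))\<^sup>2)"
      using K(2)[OF \<rho>] by (auto simp: abs_mult intro!: mult_mono)
  qed
qed

lemma wip_add_left:
  assumes "z \<in> L2_01" "z' \<in> L2_01" "y \<in> L2_01" "continuous_on {0..1} \<phi>"
  shows "wip \<phi> (\<lambda>\<rho>. z \<rho> + z' \<rho>) y = wip \<phi> z y + wip \<phi> z' y"
  using assms by (simp add: wip_def inner_add_left distrib_left integrable_wip)

lemma wip_scaleR_left: "wip \<phi> (\<lambda>\<rho>. c *\<^sub>R z \<rho>) y = c * wip \<phi> z y"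
  by (simp add: wip_def mult.left_commute)

lemma wip_add_right:
  assumes "z \<in> L2_01" "z' \<in> L2_01" "y \<in> L2_01" "continuous_on {0..1} \<phi>"
  shows "wip \<phi> y (\<lambda>\<rho>. z \<rho> + z' \<rho>) = wip \<phi> y z + wip \<phi> y z'"
  using wip_add_left[OF assms] by (simp only: wip_sym[of _ y])

lemma wip_scaleR_right: "wip \<phi> y (\<lambda>\<rho>. c *\<^sub>R z \<rho>) = c * wip \<phi> y z"
  by (simp only: wip_sym[of _ y] wip_scaleR_left)

lemma L2_norm2_const: "L2_norm2 (\<lambda>_. e) = (norm e)\<^sup>2"
  unfolding L2_norm2_def by (rule integral_I01_const)

lemma wip_diff_left:
  assumes "z \<in> L2_01" "z' \<in> L2_01" "y \<in> L2_01" "continuous_on {0..1} \<phi>"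
  shows "wip \<phi> (\<lambda>\<rho>. z \<rho> - z' \<rho>) y = wip \<phi> z y - wip \<phi> z' y"
  using assms by (simp add: wip_def inner_diff_left right_diff_distrib integrable_wip)

lemma le_sqrt_mult_of_scaled:
  fixes x A B :: real
  assumes *: "\<And>s. s > 0 \<Longrightarrow> x \<le> (s * A + B / s) / 2" and A: "A \<ge> 0" and B: "B \<ge> 0"
  shows "x \<le> sqrt A * sqrt B"
proof (rule field_le_epsilon)
  fix e :: real assume e: "e > 0"
  have "((\<lambda>d. sqrt (A + d) * sqrt (B + d)) \<longlongrightarrow> sqrt (A + 0) * sqrt (B + 0)) (at_right 0)"
    by (intro tendsto_intros)
  then have "((\<lambda>d. sqrt (A + d) * sqrt (B + d)) \<longlongrightarrow> sqrt A * sqrt B) (at_right 0)" by simp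
  from order_tendstoD(2)[OF this, of "sqrt A * sqrt B + e"] e
  obtain b where b: "b > 0" "\<And>d. 0 < d \<Longrightarrow> d < b \<Longrightarrow> sqrt (A + d) * sqrt (B + d) < sqrt A * sqrt B + e"
    by (auto simp: eventually_at_right_field)
  define d where "d = b / 2"
  have d: "d > 0" "d < b" using b by (auto simp: d_def)
  define a' b' where "a' = sqrt (A + d)" and "b' = sqrt (B + d)"
  have pos: "a' > 0" "b' > 0" using d A B by (auto simp: a'_def b'_def)
  have sq: "A \<le> a' * a'" "B \<le> b' * b'" using d A B by (auto simp: a'_def b'_def)
  have "x \<le> (b' / a' * A + B / (b' / a')) / 2" using pos by (intro *) auto
  also have "\<dots> \<le> (b' / a' * (a' * a') + b' * b' / (b' / a')) / 2"
    using pos sq by (intro divide_right_mono add_mono mult_left_mono) auto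
  also have "\<dots> = a' * b'" using pos by (simp add: field_simps)
  also have "\<dots> \<le> sqrt A * sqrt B + e" using b(2)[OF d] by (simp add: a'_def b'_def)
  finally show "x \<le> sqrt A * sqrt B + e" .
qed

text \<open>Integrates a pointwise Young inequality with a free scale \<open>s\<close> and optimizes
  over \<open>s\<close> at the end. The weight may change sign, so a discriminant argument for
  \<open>wip \<phi>\<close> itself would not do.\<close>

lemma wip_bound:
  assumes z: "z \<in> L2_01" "z' \<in> L2_01" and \<phi>: "continuous_on {0..1} \<phi>"
    and K: "\<And>\<rho>. \<rho> \<in> {0..1} \<Longrightarrow> \<bar>\<phi> \<rho>\<bar> \<le> K"
  shows "\<bar>wip \<phi> z z'\<bar> \<le> K * sqrt (L2_norm2 z) * sqrt (L2_norm2 z')"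
proof -
  have K0: "K \<ge> 0" using K[of 0] by simp
  have half: "x \<le> r / 2" if "x \<le> n * m" "2 * n * m \<le> r" for x n m r :: real using that by simp
  have "\<bar>wip \<phi> z z'\<bar> \<le> sqrt (K * L2_norm2 z) * sqrt (K * L2_norm2 z')"
  proof (rule le_sqrt_mult_of_scaled)
    fix s :: real assume s: "s > 0"
    have i: "integrable I01 (\<lambda>\<rho>. K * (s * (norm (z \<rho>))\<^sup>2 + (norm (z' \<rho>))\<^sup>2 / s) / 2)"
      using z by (simp add: L2_01_iff)
    have "\<bar>wip \<phi> z z'\<bar> \<le> (\<integral>\<rho>. \<bar>\<phi> \<rho> * inner (z \<rho>) (z' \<rho>)\<bar> \<partial>I01)"
      unfolding wip_def by (rule integral_abs_bound)
    also have "\<dots> \<le> (\<integral>\<rho>. K * (s * (norm (z \<rho>))\<^sup>2 + (norm (z' \<rho>))\<^sup>2 / s) / 2 \<partial>I01)"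
    proof (rule integral_mono[OF integrable_abs[OF integrable_wip[OF z \<phi>]] i])
      fix \<rho> assume "\<rho> \<in> space I01"
      then have \<rho>: "\<rho> \<in> {0..1}" by simp
      have "2 * norm (z \<rho>) * norm (z' \<rho>) \<le> s * (norm (z \<rho>))\<^sup>2 + (norm (z' \<rho>))\<^sup>2 / s"
      proof -
        have "0 \<le> (s * norm (z \<rho>) - norm (z' \<rho>))\<^sup>2 / s" using s by simp
        also have "\<dots> = s * (norm (z \<rho>))\<^sup>2 + (norm (z' \<rho>))\<^sup>2 / s - 2 * norm (z \<rho>) * norm (z' \<rho>)"
          using s by (simp add: power2_eq_square field_simps)
        finally show ?thesis by simp
      qed
      then have "\<bar>inner (z \<rho>) (z' \<rho>)\<bar> \<le> (s * (norm (z \<rho>))\<^sup>2 + (norm (z' \<rho>))\<^sup>2 / s) / 2"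
        by (rule half[OF Cauchy_Schwarz_ineq2])
      then have "\<bar>\<phi> \<rho> * inner (z \<rho>) (z' \<rho>)\<bar> \<le> K * ((s * (norm (z \<rho>))\<^sup>2 + (norm (z' \<rho>))\<^sup>2 / s) / 2)"
        using K[OF \<rho>] K0 unfolding abs_mult by (intro mult_mono) auto
      then show "\<bar>\<phi> \<rho> * inner (z \<rho>) (z' \<rho>)\<bar> \<le> K * (s * (norm (z \<rho>))\<^sup>2 + (norm (z' \<rho>))\<^sup>2 / s) / 2" by simp
    qed
    also have "\<dots> = (s * (K * L2_norm2 z) + (K * L2_norm2 z') / s) / 2"
      using z s by (simp add: L2_norm2_def L2_01_iff algebra_simps)
    finally show "\<bar>wip \<phi> z z'\<bar> \<le> (s * (K * L2_norm2 z) + (K * L2_norm2 z') / s) / 2" .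
  qed (use K0 in auto)
  also have "\<dots> = K * sqrt (L2_norm2 z) * sqrt (L2_norm2 z')"
    using K0 by (simp add: real_sqrt_mult)
  finally show ?thesis .
qed

lemma wip_mono:
  assumes z: "z \<in> L2_01" and \<phi>: "continuous_on {0..1} \<phi>" and \<psi>: "continuous_on {0..1} \<psi>"
    and le: "\<And>\<rho>. \<rho> \<in> {0..1} \<Longrightarrow> \<phi> \<rho> \<le> \<psi> \<rho>"
  shows "wip \<phi> z z \<le> wip \<psi> z z"
  unfolding wip_def
  by (intro integral_mono integrable_wip z \<phi> \<psi> mult_right_mono le) auto

lemma wip_weight_lin:
  assumes z: "z \<in> L2_01" "z' \<in> L2_01" and \<phi>: "continuous_on {0..1} \<phi>" and \<psi>: "continuous_on {0..1} \<psi>"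
  shows "wip (\<lambda>\<rho>. \<phi> \<rho> + c * \<psi> \<rho>) z z' = wip \<phi> z z' + c * wip \<psi> z z'"
proof -
  have "wip (\<lambda>\<rho>. \<phi> \<rho> + c * \<psi> \<rho>) z z'
      = (\<integral>\<rho>. \<phi> \<rho> * inner (z \<rho>) (z' \<rho>) + c * (\<psi> \<rho> * inner (z \<rho>) (z' \<rho>)) \<partial>I01)"
    by (simp add: wip_def algebra_simps)
  also have "\<dots> = wip \<phi> z z' + c * wip \<psi> z z'"
    using integrable_wip[OF z \<phi>] integrable_wip[OF z \<psi>] by (simp add: wip_def)
  finally show ?thesis .
qed

lemma wip_const_const: "continuous_on {0..1} \<phi> \<Longrightarrow> wip \<phi> (\<lambda>_. e) (\<lambda>_. e') = integral\<^sup>L I01 \<phi> * inner e e'"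
  by (simp add: wip_def)

section \<open>Density of simple functions and completeness\<close>

definition L2_dist2 :: "(real \<Rightarrow> 'a::real_normed_vector) \<Rightarrow> (real \<Rightarrow> 'a) \<Rightarrow> real" where
  "L2_dist2 z z' = L2_norm2 (\<lambda>\<rho>. z \<rho> - z' \<rho>)"

lemma L2_dist2_nonneg [simp]: "0 \<le> L2_dist2 z z'"
  by (simp add: L2_dist2_def)

lemma L2_dist2_commute: "L2_dist2 z z' = L2_dist2 z' z"
  by (simp add: L2_dist2_def L2_norm2_def norm_minus_commute)

lemma L2_dist2_triangle:
  assumes "x \<in> L2_01" "y \<in> L2_01" "z \<in> L2_01"
  shows "L2_dist2 x z \<le> 2 * L2_dist2 x y + 2 * L2_dist2 y z"
  using L2_norm2_add_le[OF L2_01_diff[OF assms(1,2)] L2_01_diff[OF assms(2,3)]] by (simp add: L2_dist2_def)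

lemma L2_01_simple_dense:
  fixes z :: "real \<Rightarrow> 'a::real_normed_vector"
  assumes z: "z \<in> L2_01" and e: "e > 0"
  shows "\<exists>s. simple_function I01 s \<and> L2_dist2 s z < e"
proof -
  obtain s where s: "\<And>n. simple_function I01 (s n)" and lim: "AE \<rho> in I01. (\<lambda>n. s n \<rho>) \<longlonglongrightarrow> z \<rho>"
    using z unfolding L2_01_iff strongly_meas01_def by blast
  \<comment> \<open>Convergence almost everywhere gives no integrable majorant. Cutting off where
    the approximation exceeds \<open>2 * norm (z \<rho>)\<close> supplies one: the squared error is
    at most (2 * 4 + 2) |z|^2, the 10 used below.\<close>
  define A where "A n = {\<rho>\<in>space I01. norm (s n \<rho>) \<le> 2 * norm (z \<rho>)}" for n
  define s' where "s' n \<rho> = (if \<rho> \<in> A n then s n \<rho> else 0)" for n \<rho>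
  have mz: "(\<lambda>\<rho>. norm (z \<rho>)) \<in> borel_measurable I01" using z by (simp add: L2_01_iff strongly_meas01_norm)
  have As: "A n \<in> sets I01" for n
    unfolding A_def
    by (intro borel_measurable_le strongly_meas01_norm[OF strongly_meas01_simple[OF s]]
        borel_measurable_times borel_measurable_const mz)
  have s': "simple_function I01 (s' n)" for n
    unfolding s'_def by (rule simple_function_If_set[OF s]) (auto intro: sets.Int As)
  have L2s: "s' n \<in> L2_01" for n by (rule L2_01_simple[OF s'])
  have "(\<lambda>n. \<integral>\<rho>. (norm (s' n \<rho> - z \<rho>))\<^sup>2 \<partial>I01) \<longlonglongrightarrow> (\<integral>\<rho>. 0 \<partial>I01)"
  proof (rule integral_dominated_convergence[where w="\<lambda>\<rho>. 10 * (norm (z \<rho>))\<^sup>2"])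
    show "integrable I01 (\<lambda>\<rho>. 10 * (norm (z \<rho>))\<^sup>2)" using z by (simp add: L2_01_iff)
    show "(\<lambda>\<rho>. (norm (s' n \<rho> - z \<rho>))\<^sup>2) \<in> borel_measurable I01" for n
      using L2_01_diff[OF L2s z] by (simp add: L2_01_iff borel_measurable_integrable)
    show "AE \<rho> in I01. (\<lambda>n. (norm (s' n \<rho> - z \<rho>))\<^sup>2) \<longlonglongrightarrow> 0"
      using lim AE_space
    proof eventually_elim
      case (elim \<rho>)
      have "(\<lambda>n. s' n \<rho>) \<longlonglongrightarrow> z \<rho>"
      \<comment> \<open>Where \<open>z\<close> vanishes the cut-off forces the value 0; elsewhere it
        is eventually inactive.\<close>
      proof (cases "z \<rho> = 0")
        case True
        then have "s' n \<rho> = 0" for n by (simp add: s'_def A_def)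
        then show ?thesis using True by simp
      next
        case False
        have "(\<lambda>n. norm (s n \<rho>)) \<longlonglongrightarrow> norm (z \<rho>)" using elim(1) by (rule tendsto_norm)
        then have "eventually (\<lambda>n. norm (s n \<rho>) < 2 * norm (z \<rho>)) sequentially"
          by (rule order_tendstoD) (use False in simp)
        then have "eventually (\<lambda>n. s n \<rho> = s' n \<rho>) sequentially"
          by eventually_elim (use elim(2) in \<open>auto simp: s'_def A_def\<close>)
        then show ?thesis using elim(1) by (rule Lim_transform_eventually[rotated])
      qed
      then have "(\<lambda>n. (norm (s' n \<rho> - z \<rho>))\<^sup>2) \<longlonglongrightarrow> (norm (z \<rho> - z \<rho>))\<^sup>2"
        by (intro tendsto_intros)
      then show ?case by simp
    qed
    show "AE \<rho> in I01. norm ((norm (s' n \<rho> - z \<rho>))\<^sup>2) \<le> 10 * (norm (z \<rho>))\<^sup>2" for n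
    proof (rule AE_I2)
      fix \<rho>
      have "norm (s' n \<rho>) \<le> 2 * norm (z \<rho>)" by (auto simp: s'_def A_def)
      then have "(norm (s' n \<rho>))\<^sup>2 \<le> 4 * (norm (z \<rho>))\<^sup>2"
        using power_mono[of "norm (s' n \<rho>)" "2 * norm (z \<rho>)" 2] by (simp add: power_mult_distrib)
      then show "norm ((norm (s' n \<rho> - z \<rho>))\<^sup>2) \<le> 10 * (norm (z \<rho>))\<^sup>2"
        using norm_add_sq_le[of "s' n \<rho>" "- z \<rho>"] by simp
    qed
  qed simp
  then have "(\<lambda>n. L2_dist2 (s' n) z) \<longlonglongrightarrow> 0" by (simp add: L2_dist2_def L2_norm2_def)
  from order_tendstoD(2)[OF this e] obtain n where "L2_dist2 (s' n) z < e"
    by (auto simp: eventually_sequentially)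
  then show ?thesis using s' by blast
qed

text \<open>The weights \<open>2\<^sup>j\<close> turn square summability of the increments into a Cauchy estimate.\<close>

lemma norm_telescope_weighted:
  fixes f :: "nat \<Rightarrow> 'a::real_normed_vector"
  assumes "k \<le> m"
  shows "(norm (f m - f k))\<^sup>2 \<le> 2 * (1/2) ^ k * (\<Sum>j=k..<m. 2 ^ j * (norm (f (Suc j) - f j))\<^sup>2)"
  using assms
proof (induction "m - k" arbitrary: k)
  case 0 then show ?case by simp
next
  case (Suc n)
  then have km: "k < m" by simp
  let ?d = "norm (f (Suc k) - f k)" and ?S = "\<Sum>j=Suc k..<m. 2 ^ j * (norm (f (Suc j) - f j))\<^sup>2"
  have IH: "(norm (f m - f (Suc k)))\<^sup>2 \<le> 2 * (1/2) ^ Suc k * ?S"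
    using Suc by (intro Suc.hyps) auto
  have "(norm (f m - f k))\<^sup>2 \<le> 2 * (norm (f m - f (Suc k)))\<^sup>2 + 2 * ?d\<^sup>2"
    using norm_add_sq_le[of "f m - f (Suc k)" "f (Suc k) - f k"] by simp
  also have "\<dots> \<le> 2 * (1/2) ^ k * ?S + 2 * ?d\<^sup>2" using IH by simp
  also have "\<dots> = 2 * (1/2) ^ k * (?S + 2 ^ k * ?d\<^sup>2)" by (simp add: field_simps power_divide)
  also have "?S + 2 ^ k * ?d\<^sup>2 = (\<Sum>j=k..<m. 2 ^ j * (norm (f (Suc j) - f j))\<^sup>2)"
    using km by (simp add: sum.atLeast_Suc_lessThan)
  finally show ?case .
qed

text \<open>Riesz-Fischer, run on simple approximations of a subsequence: their almost everywhere
  limit is strongly measurable by definition, and \<open>H\<close> is an integrable majorant of the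
  squared errors.\<close>

lemma L2_01_complete:
  fixes z :: "nat \<Rightarrow> real \<Rightarrow> 'a::banach"
  assumes z: "\<And>n. z n \<in> L2_01"
    and cau: "\<And>e. e > 0 \<Longrightarrow> \<exists>N. \<forall>m\<ge>N. \<forall>n\<ge>N. L2_dist2 (z m) (z n) < e"
  shows "\<exists>z'\<in>L2_01. (\<lambda>n. L2_dist2 (z n) z') \<longlonglongrightarrow> 0"
proof -
  \<comment> \<open>Powers of 1/4 against the weight \<open>2 ^ k\<close> in \<open>d\<close> leave
    the summable \<open>(1/2) ^ k\<close>.\<close>
  define \<epsilon> :: "nat \<Rightarrow> real" where "\<epsilon> k = (1/4) ^ k" for k
  have \<epsilon>: "\<epsilon> k > 0" for k by (simp add: \<epsilon>_def)
  obtain N where N: "\<And>k m n. m \<ge> N k \<Longrightarrow> n \<ge> N k \<Longrightarrow> L2_dist2 (z m) (z n) < \<epsilon> k"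
    using cau[OF \<epsilon>] by metis
  \<comment> \<open>Partial sums put \<open>r (Suc k)\<close> above \<open>N k\<close> as well,
    although \<open>N\<close> need not be increasing.\<close>
  define r where "r k = (\<Sum>i\<le>k. N i)" for k
  have rN: "N k \<le> r k" "N k \<le> r (Suc k)" for k
    unfolding r_def by (auto intro!: member_le_sum simp del: sum.atMost_Suc)
  have "\<forall>k. \<exists>s. simple_function I01 s \<and> L2_dist2 s (z (r k)) < \<epsilon> k"
    by (intro allI L2_01_simple_dense z \<epsilon>)
  from choice[OF this] obtain s where s: "\<And>k. simple_function I01 (s k)"
      "\<And>k. L2_dist2 (s k) (z (r k)) < \<epsilon> k"
    by auto
  have sL: "s k \<in> L2_01" for k by (rule L2_01_simple[OF s(1)])
  define d where "d k \<rho> = 2 ^ k * (norm (s (Suc k) \<rho> - s k \<rho>))\<^sup>2" for k \<rho>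
  have d0: "0 \<le> d k \<rho>" for k \<rho> by (simp add: d_def)
  have di: "integrable I01 (d k)" for k
    using L2_01_diff[OF sL[of "Suc k"] sL[of k]] by (simp add: L2_01_iff d_def[abs_def])
  have dle: "(\<integral>\<rho>. d k \<rho> \<partial>I01) \<le> 10 * (1/2) ^ k" for k
  proof -
    have "L2_dist2 (s (Suc k)) (s k) \<le> 2 * L2_dist2 (s (Suc k)) (z (r (Suc k)))
        + 2 * (2 * L2_dist2 (z (r (Suc k))) (z (r k)) + 2 * L2_dist2 (z (r k)) (s k))"
      using L2_dist2_triangle[OF sL[of "Suc k"] z[of "r (Suc k)"] sL[of k]] L2_dist2_triangle[OF z[of "r (Suc k)"] z[of "r k"] sL[of k]]
      by argo
    also have "\<dots> \<le> 2 * \<epsilon> (Suc k) + 2 * (2 * \<epsilon> k + 2 * \<epsilon> k)"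
      using s(2)[of "Suc k"] s(2)[of k] N[OF rN(2) rN(1), of k] L2_dist2_commute[of "z (r k)" "s k"] by argo
    also have "\<dots> \<le> 10 * \<epsilon> k" using \<epsilon>[of k] by (simp add: \<epsilon>_def)
    finally have "2 ^ k * L2_dist2 (s (Suc k)) (s k) \<le> 2 ^ k * (10 * \<epsilon> k)" by simp
    also have "2 ^ k * (10 * \<epsilon> k) = 10 * (1/2) ^ k"
      by (simp add: \<epsilon>_def power_divide power_mult_distrib[symmetric] field_simps)
    finally show ?thesis by (simp add: d_def L2_dist2_def L2_norm2_def)
  qed
  have sumI: "summable (\<lambda>k. \<integral>\<rho>. norm (d k \<rho>) \<partial>I01)"
    by (rule summable_comparison_test[OF _ summable_mult[OF summable_geometric[of "1/2"], of 10]])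
       (use dle d0 in \<open>auto intro!: exI[of _ 0] simp: Bochner_Integration.integral_nonneg\<close>)
  \<comment> \<open>Integration term by term of a nonnegative series: a finite integral of the sum
    forces the sum to be finite almost everywhere.\<close>
  have AEsum: "AE \<rho> in I01. summable (\<lambda>k. d k \<rho>)"
  proof -
    have "(\<integral>\<^sup>+\<rho>. (\<Sum>k. ennreal (d k \<rho>)) \<partial>I01) = (\<Sum>k. \<integral>\<^sup>+\<rho>. ennreal (d k \<rho>) \<partial>I01)"
      using di by (intro nn_integral_suminf) (auto dest: borel_measurable_integrable)
    also have "\<dots> = (\<Sum>k. ennreal (\<integral>\<rho>. d k \<rho> \<partial>I01))"
      using di d0 by (simp add: nn_integral_eq_integral)
    also have "\<dots> = ennreal (\<Sum>k. \<integral>\<rho>. d k \<rho> \<partial>I01)"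
      using sumI d0 by (intro suminf_ennreal2) (auto simp: Bochner_Integration.integral_nonneg)
    finally have "(\<integral>\<^sup>+\<rho>. (\<Sum>k. ennreal (d k \<rho>)) \<partial>I01) \<noteq> \<infinity>" by simp
    then have "AE \<rho> in I01. (\<Sum>k. ennreal (d k \<rho>)) \<noteq> \<infinity>"
      using di by (intro nn_integral_PInf_AE) (auto intro!: borel_measurable_suminf dest: borel_measurable_integrable)
    then show ?thesis
      by eventually_elim (use d0 in \<open>auto intro: summable_suminf_not_top\<close>)
  qed
  define H where "H \<rho> = (\<Sum>k. d k \<rho>)" for \<rho>
  have Hi: "integrable I01 H" unfolding H_def
    by (rule integrable_suminf[OF di _ sumI]) (use AEsum d0 in auto)
  define z' where "z' \<rho> = lim (\<lambda>k. s k \<rho>)" for \<rho>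
  have conv: "(\<lambda>k. s k \<rho>) \<longlonglongrightarrow> z' \<rho> \<and> (\<forall>k. (norm (z' \<rho> - s k \<rho>))\<^sup>2 \<le> 2 * (1/2) ^ k * H \<rho>)"
    if sm: "summable (\<lambda>k. d k \<rho>)" for \<rho>
  proof -
    have step: "(norm (s m \<rho> - s k \<rho>))\<^sup>2 \<le> 2 * (1/2) ^ k * H \<rho>" if "k \<le> m" for k m
    proof -
      have "(norm (s m \<rho> - s k \<rho>))\<^sup>2 \<le> 2 * (1/2) ^ k * (\<Sum>j=k..<m. d j \<rho>)"
        using norm_telescope_weighted[OF that, of "\<lambda>k. s k \<rho>"] by (simp add: d_def)
      also have "(\<Sum>j=k..<m. d j \<rho>) \<le> H \<rho>" unfolding H_def
        using sm d0 by (intro sum_le_suminf) auto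
      finally show ?thesis by simp
    qed
    have H0: "0 \<le> H \<rho>" unfolding H_def using sm d0 by (intro suminf_nonneg) auto
    have "Cauchy (\<lambda>k. s k \<rho>)"
    proof (rule metric_CauchyI)
      fix e :: real assume e: "e > 0"
      have "(\<lambda>k. 2 * (1/2) ^ k * H \<rho>) \<longlonglongrightarrow> 2 * 0 * H \<rho>"
        by (intro tendsto_intros LIMSEQ_power_zero) auto
      then have "eventually (\<lambda>k. 2 * (1/2) ^ k * H \<rho> < (e/2)\<^sup>2) sequentially"
        by (rule order_tendstoD) (use e in auto)
      then obtain k where k: "2 * (1/2) ^ k * H \<rho> < (e/2)\<^sup>2" by (auto simp: eventually_sequentially)
      have *: "norm (s m \<rho> - s k \<rho>) < e / 2" if "m \<ge> k" for m
        using step[OF that] k e by (intro power2_less_imp_less[of _ "e/2"]) auto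
      show "\<exists>M. \<forall>m\<ge>M. \<forall>n\<ge>M. dist (s m \<rho>) (s n \<rho>) < e"
        using * by (intro exI[of _ k] allI impI) (metis dist_norm dist_triangle_half_l)
    qed
    then have lim: "(\<lambda>k. s k \<rho>) \<longlonglongrightarrow> z' \<rho>"
      unfolding z'_def using Cauchy_convergent convergent_LIMSEQ_iff by blast
    have "(norm (z' \<rho> - s k \<rho>))\<^sup>2 \<le> 2 * (1/2) ^ k * H \<rho>" for k
    proof (rule LIMSEQ_le_const2)
      show "(\<lambda>m. (norm (s m \<rho> - s k \<rho>))\<^sup>2) \<longlonglongrightarrow> (norm (z' \<rho> - s k \<rho>))\<^sup>2"
        by (intro tendsto_intros lim)
      show "\<exists>N. \<forall>m\<ge>N. (norm (s m \<rho> - s k \<rho>))\<^sup>2 \<le> 2 * (1/2) ^ k * H \<rho>" using step by blast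
    qed
    with lim show ?thesis by blast
  qed
  have lim: "AE \<rho> in I01. (\<lambda>k. s k \<rho>) \<longlonglongrightarrow> z' \<rho>"
    using AEsum by eventually_elim (use conv in blast)
  have z'm: "strongly_meas01 z'" unfolding strongly_meas01_def using s(1) lim by blast
  have z'd: "integrable I01 (\<lambda>\<rho>. (norm (z' \<rho> - s k \<rho>))\<^sup>2)"
    and z'le: "L2_dist2 z' (s k) \<le> 2 * (1/2) ^ k * integral\<^sup>L I01 H" for k
  proof -
    have Hki: "integrable I01 (\<lambda>\<rho>. 2 * (1/2) ^ k * H \<rho>)" using Hi by simp
    have ae: "AE \<rho> in I01. (norm (z' \<rho> - s k \<rho>))\<^sup>2 \<le> 2 * (1/2) ^ k * H \<rho>"
      using AEsum by eventually_elim (use conv in blast)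
    have "strongly_meas01 (\<lambda>\<rho>. z' \<rho> - s k \<rho>)"
      using strongly_meas01_add[OF z'm strongly_meas01_scaleR[OF strongly_meas01_simple[OF s(1)], of "-1" k]] by simp
    then have m: "(\<lambda>\<rho>. (norm (z' \<rho> - s k \<rho>))\<^sup>2) \<in> borel_measurable I01"
      by (intro borel_measurable_power strongly_meas01_norm)
    show i: "integrable I01 (\<lambda>\<rho>. (norm (z' \<rho> - s k \<rho>))\<^sup>2)"
      by (rule Bochner_Integration.integrable_bound[OF Hki m]) (use ae in \<open>eventually_elim, auto\<close>)
    show "L2_dist2 z' (s k) \<le> 2 * (1/2) ^ k * integral\<^sup>L I01 H"
      using integral_mono_AE[OF i Hki ae] Hi by (simp add: L2_dist2_def L2_norm2_def)
  qed
  have dL: "(\<lambda>\<rho>. z' \<rho> - s 0 \<rho>) \<in> L2_01"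
    using z'd[of 0] strongly_meas01_add[OF z'm strongly_meas01_scaleR[OF strongly_meas01_simple[OF s(1)], of "-1" 0]]
    by (simp add: L2_01_iff)
  have z'L: "z' \<in> L2_01" using L2_01_add[OF dL sL[of 0]] by simp
  \<comment> \<open>The whole sequence follows through two intermediate points,
    \<open>z (r k)\<close> by the Cauchy bound and \<open>s k\<close> by approximation.\<close>
  have main: "L2_dist2 (z n) z' \<le> 2 * \<epsilon> k + 2 * (2 * \<epsilon> k + 2 * (2 * (1/2) ^ k * integral\<^sup>L I01 H))"
    if "n \<ge> N k" for n k
    using L2_dist2_triangle[OF z[of n] z[of "r k"] z'L] L2_dist2_triangle[OF z[of "r k"] sL[of k] z'L]
      N[OF that rN(1)] s(2)[of k] z'le[of k] L2_dist2_commute[of "z (r k)" "s k"] L2_dist2_commute[of "s k" z']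
    by argo
  have "(\<lambda>k. 2 * \<epsilon> k + 2 * (2 * \<epsilon> k + 2 * (2 * (1/2) ^ k * integral\<^sup>L I01 H)))
      \<longlonglongrightarrow> 2 * 0 + 2 * (2 * 0 + 2 * (2 * 0 * integral\<^sup>L I01 H))"
    unfolding \<epsilon>_def by (intro tendsto_intros LIMSEQ_power_zero) auto
  then have small: "\<exists>k. 2 * \<epsilon> k + 2 * (2 * \<epsilon> k + 2 * (2 * (1/2) ^ k * integral\<^sup>L I01 H)) < e" if "e > 0" for e
    using order_tendstoD(2)[of _ 0 sequentially e] that by (fastforce simp: eventually_sequentially)
  have "(\<lambda>n. L2_dist2 (z n) z') \<longlonglongrightarrow> 0"
  proof (rule LIMSEQ_I)
    fix e :: real assume "e > 0"
    from small[OF this] obtain k where "2 * \<epsilon> k + 2 * (2 * \<epsilon> k + 2 * (2 * (1/2) ^ k * integral\<^sup>L I01 H)) < e" ..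
    then show "\<exists>no. \<forall>n\<ge>no. norm (L2_dist2 (z n) z' - 0) < e"
      using main[of k] by (intro exI[of _ "N k"]) (auto simp: abs_of_nonneg intro: le_less_trans)
  qed
  with z'L show ?thesis by blast
qed

section \<open>Integration by parts against scalar weights\<close>

lemma is_H1_deriv_parts:
  fixes z g :: "real \<Rightarrow> 'a::{real_inner,banach}"
  assumes zL: "z \<in> L2_01" and g: "is_H1_deriv z g"
    and \<phi>: "\<And>\<rho>. \<rho> \<in> {0..1} \<Longrightarrow> (\<phi> has_real_derivative \<phi>' \<rho>) (at \<rho> within {0..1})"
    and \<phi>': "continuous_on {0..1} \<phi>'"
  shows "2 * wip \<phi> z g + wip \<phi>' z z = \<phi> 1 * (norm (z 1))\<^sup>2 - \<phi> 0 * (norm (z 0))\<^sup>2"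
    and "wip \<phi> g (\<lambda>_. e) + wip \<phi>' z (\<lambda>_. e) = \<phi> 1 * inner (z 1) e - \<phi> 0 * inner (z 0) e"
proof -
  have gL: "g \<in> L2_01" and gi: "\<And>\<rho>. \<rho> \<in> {0..1} \<Longrightarrow> (g has_integral (z \<rho> - z 0)) {0..\<rho>}"
    using g by (auto simp: is_H1_deriv_def)
  have c\<phi>: "continuous_on {0..1} \<phi>" using \<phi> DERIV_continuous_on by blast
  have toHK: "f integrable_on {0..c}" if "integrable I01 f" "c \<le> 1" for f :: "real \<Rightarrow> real" and c
    using integrable_subinterval_real[OF integrable_on_lebesgue_on[OF that(1)], of 0 c] that(2) by auto
  have "integrable I01 (\<lambda>\<rho>. norm (g \<rho>))"
  proof (rule integrable_I01_bound)
    show "integrable I01 (\<lambda>\<rho>. 1 + (norm (g \<rho>))\<^sup>2)" using gL by (simp add: L2_01_iff)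
    show "(\<lambda>\<rho>. norm (g \<rho>)) \<in> borel_measurable I01" using gL by (simp add: L2_01_iff strongly_meas01_norm)
    show "norm (norm (g \<rho>)) \<le> 1 + (norm (g \<rho>))\<^sup>2" for \<rho>
      using sum_squares_bound[of "norm (g \<rho>)" 1] norm_ge_zero[of "g \<rho>"] by (simp del: norm_ge_zero)
  qed
  note ng = toHK[OF this]
  have zg: "integrable I01 (\<lambda>\<rho>. inner (z \<rho>) (g \<rho>))"
    using integrable_wip[OF zL gL, of "\<lambda>_. 1"] by simp
  have dbl: "(\<lambda>\<rho>. inner (z \<rho>) (g \<rho>) + inner (g \<rho>) (z \<rho>)) = (\<lambda>\<rho>. 2 * inner (z \<rho>) (g \<rho>))"
    by (rule ext, subst inner_commute) simp
  \<comment> \<open>The product rule with both factors \<open>z\<close>, on every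
    \<open>{0..c}\<close>: it exhibits the squared norm as a primitive, the form of input that the
    scalar rule below takes.\<close>
  have sq: "((\<lambda>\<rho>. 2 * inner (z \<rho>) (g \<rho>)) has_integral (norm (z c))\<^sup>2 - (norm (z 0))\<^sup>2) {0..c}"
    if c: "c \<in> {0..1}" for c
  proof -
    have gi': "(g has_integral (z \<rho> - z 0)) {0..\<rho>}" if "\<rho> \<in> {0..c}" for \<rho>
      by (rule gi) (use that c in simp)
    have ngc: "(\<lambda>\<rho>. norm (g \<rho>)) integrable_on {0..c}" by (rule ng) (use c in simp)
    have r: "(\<lambda>\<sigma>. inner (z \<sigma>) (g \<sigma>) + inner (g \<sigma>) (z \<sigma>)) integrable_on {0..c}"
      unfolding dbl by (rule toHK) (use zg c in simp_all)
    have "((\<lambda>\<sigma>. inner (z \<sigma>) (g \<sigma>) + inner (g \<sigma>) (z \<sigma>)) has_integral (inner (z c) (z c) - inner (z 0) (z 0))) {0..c}"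
      by (rule integration_by_parts_inner[OF _ gi' gi' ngc ngc r]) (use c in simp_all)
    then show ?thesis unfolding dbl power2_norm_eq_inner .
  qed
  \<comment> \<open>A second product rule, now for scalars, brings in the weight. It serves both
    conclusions, with \<open>Q\<close> the squared norm or a component
    \<open>inner (z c) e\<close>.\<close>
  have real_parts: "(\<integral>\<rho>. \<phi> \<rho> * q \<rho> + \<phi>' \<rho> * Q \<rho> \<partial>I01) = \<phi> 1 * Q 1 - \<phi> 0 * Q 0"
    if q: "integrable I01 q" and i: "integrable I01 (\<lambda>\<rho>. \<phi> \<rho> * q \<rho> + \<phi>' \<rho> * Q \<rho>)"
      and Q: "\<And>c. c \<in> {0..1} \<Longrightarrow> (q has_integral Q c - Q 0) {0..c}" for q Q :: "real \<Rightarrow> real"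
  proof -
    have p: "(\<phi>' has_integral (\<phi> \<rho> - \<phi> 0)) {0..\<rho>}" if "\<rho> \<in> {0..1}" for \<rho>
    proof (rule fundamental_theorem_of_calculus)
      fix x assume x: "x \<in> {0..\<rho>}"
      have "(\<phi> has_real_derivative \<phi>' x) (at x within {0..\<rho>})"
        by (rule DERIV_subset[OF \<phi>]) (use x that in auto)
      then show "(\<phi> has_vector_derivative \<phi>' x) (at x within {0..\<rho>})"
        by (simp add: has_real_derivative_iff_has_vector_derivative)
    qed (use that in simp)
    have np: "(\<lambda>\<sigma>. norm (\<phi>' \<sigma>)) integrable_on {0..1}"
      by (intro integrable_continuous_real continuous_on_norm \<phi>')
    have nq: "(\<lambda>\<sigma>. norm (q \<sigma>)) integrable_on {0..1}" by (rule toHK[OF integrable_norm[OF q]]) simp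
    have r: "(\<lambda>\<sigma>. inner (\<phi> \<sigma>) (q \<sigma>) + inner (\<phi>' \<sigma>) (Q \<sigma>)) integrable_on {0..1}"
      using toHK[OF i, of 1] by simp
    have "((\<lambda>\<sigma>. inner (\<phi> \<sigma>) (q \<sigma>) + inner (\<phi>' \<sigma>) (Q \<sigma>)) has_integral (inner (\<phi> 1) (Q 1) - inner (\<phi> 0) (Q 0))) {0..1}"
      by (rule integration_by_parts_inner[OF _ p Q np nq r]) simp_all
    then have "((\<lambda>\<rho>. \<phi> \<rho> * q \<rho> + \<phi>' \<rho> * Q \<rho>) has_integral (\<phi> 1 * Q 1 - \<phi> 0 * Q 0)) {0..1}" by simp
    moreover have "((\<lambda>\<rho>. \<phi> \<rho> * q \<rho> + \<phi>' \<rho> * Q \<rho>) has_integral (\<integral>\<rho>. \<phi> \<rho> * q \<rho> + \<phi>' \<rho> * Q \<rho> \<partial>I01)) {0..1}"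
      by (rule has_integral_integral_lebesgue_on[OF i]) simp
    ultimately show ?thesis by (rule has_integral_unique[rotated])
  qed
  have i1: "integrable I01 (\<lambda>\<rho>. \<phi> \<rho> * (2 * inner (z \<rho>) (g \<rho>)))" "integrable I01 (\<lambda>\<rho>. \<phi>' \<rho> * (norm (z \<rho>))\<^sup>2)"
    using integrable_wip[OF zL gL c\<phi>] integrable_wip[OF zL zL \<phi>']
    by (simp_all add: power2_norm_eq_inner mult.left_commute[of _ 2])
  have "(\<integral>\<rho>. \<phi> \<rho> * (2 * inner (z \<rho>) (g \<rho>)) + \<phi>' \<rho> * (norm (z \<rho>))\<^sup>2 \<partial>I01)
      = \<phi> 1 * (norm (z 1))\<^sup>2 - \<phi> 0 * (norm (z 0))\<^sup>2"
  proof (rule real_parts)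
    show "integrable I01 (\<lambda>\<rho>. 2 * inner (z \<rho>) (g \<rho>))" using zg by simp
    show "integrable I01 (\<lambda>\<rho>. \<phi> \<rho> * (2 * inner (z \<rho>) (g \<rho>)) + \<phi>' \<rho> * (norm (z \<rho>))\<^sup>2)"
      using i1 by (rule Bochner_Integration.integrable_add)
  qed (rule sq)
  then show "2 * wip \<phi> z g + wip \<phi>' z z = \<phi> 1 * (norm (z 1))\<^sup>2 - \<phi> 0 * (norm (z 0))\<^sup>2"
    using i1 by (simp add: wip_def power2_norm_eq_inner mult.left_commute[of _ 2])
  have i2: "integrable I01 (\<lambda>\<rho>. \<phi> \<rho> * inner (g \<rho>) e)" "integrable I01 (\<lambda>\<rho>. \<phi>' \<rho> * inner (z \<rho>) e)"
    using integrable_wip[OF gL L2_01_const c\<phi>] integrable_wip[OF zL L2_01_const \<phi>'] by auto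
  have "(\<integral>\<rho>. \<phi> \<rho> * inner (g \<rho>) e + \<phi>' \<rho> * inner (z \<rho>) e \<partial>I01) = \<phi> 1 * inner (z 1) e - \<phi> 0 * inner (z 0) e"
  proof (rule real_parts)
    show "integrable I01 (\<lambda>\<rho>. inner (g \<rho>) e)"
      using integrable_wip[OF gL L2_01_const[of e], of "\<lambda>_. 1"] by simp
    show "((\<lambda>\<rho>. inner (g \<rho>) e) has_integral inner (z c) e - inner (z 0) e) {0..c}" if "c \<in> {0..1}" for c
      using has_integral_linear[OF gi[OF that] bounded_linear_inner_left[of e]] unfolding o_def inner_diff_left .
    show "integrable I01 (\<lambda>\<rho>. \<phi> \<rho> * inner (g \<rho>) e + \<phi>' \<rho> * inner (z \<rho>) e)"
      using i2 by (rule Bochner_Integration.integrable_add)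
  qed
  then show "wip \<phi> g (\<lambda>_. e) + wip \<phi>' z (\<lambda>_. e) = \<phi> 1 * inner (z 1) e - \<phi> 0 * inner (z 0) e"
    by (simp only: wip_def Bochner_Integration.integral_add[OF i2])
qed

section \<open>The state space modulo null functions\<close>

text \<open>Bounded functions with the supremum norm are the ambient Banach space for states modulo
  null functions.\<close>

instance bcontfun :: (metric_space, banach) banach ..

locale delayed_wave =
  fixes B :: "'h1::{real_inner,banach} \<Rightarrow> 'h::{real_inner,banach}"
    and DB :: "'h1 set" and C0 \<xi> :: real
  assumes B_lin: "lin_op_on DB B"
    and B_dense: "closure DB = UNIV"
    and C0_pos: "C0 > 0"
    and coercive: "\<And>v. v \<in> adj_dom DB B \<Longrightarrow> C0 * norm v \<le> norm (adj DB B v)"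
    and V_complete: "\<And>f. (\<And>n. f n \<in> adj_dom DB B) \<Longrightarrow> Cauchy (\<lambda>n. adj DB B (f n)) \<Longrightarrow>
                        \<exists>v\<in>adj_dom DB B. (\<lambda>n. adj DB B (f n)) \<longlonglongrightarrow> adj DB B v"
    and xi_pos: "\<xi> > 0"
begin

abbreviation "V \<equiv> adj_dom DB B"
abbreviation "Bs \<equiv> adj DB B"
abbreviation "X \<equiv> state_space DB B"
abbreviation "N \<equiv> state_norm DB B \<xi>"

section \<open>The adjoint of a densely defined operator\<close>

lemma orthogonal_DB: "(\<And>u. u \<in> DB \<Longrightarrow> inner u x = 0) \<Longrightarrow> x = 0"
proof -
  assume *: "\<And>u. u \<in> DB \<Longrightarrow> inner u x = 0"
  have "closure DB \<subseteq> {u. inner u x = 0}"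
    by (rule closure_minimal) (use * in \<open>auto intro!: closed_Collect_eq continuous_intros\<close>)
  then have "x \<in> {u. inner u x = 0}" using B_dense by blast
  then show "x = 0" by simp
qed

lemma adj_prop: "v \<in> V \<Longrightarrow> u \<in> DB \<Longrightarrow> inner (B u) v = inner u (Bs v)"
proof -
  assume "v \<in> V" "u \<in> DB"
  then have "\<exists>w. \<forall>u\<in>DB. inner (B u) v = inner u w" by (simp add: adj_dom_def)
  from someI_ex[OF this] show ?thesis using \<open>u \<in> DB\<close> by (simp add: adj_def)
qed

text \<open>Density of \<open>DB\<close> makes the choice in \<open>adj\<close> unique, so each
  algebraic rule for the adjoint reduces to its defining identity.\<close>

lemma adj_eqI: "(\<And>u. u \<in> DB \<Longrightarrow> inner (B u) v = inner u w) \<Longrightarrow> v \<in> V \<and> Bs v = w"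
proof -
  assume *: "\<And>u. u \<in> DB \<Longrightarrow> inner (B u) v = inner u w"
  then have v: "v \<in> V" by (auto simp: adj_dom_def)
  have "Bs v - w = 0"
    by (rule orthogonal_DB) (use * adj_prop[OF v] in \<open>simp add: inner_diff_right\<close>)
  then show ?thesis using v by simp
qed

lemma adj_add: "v \<in> V \<Longrightarrow> v' \<in> V \<Longrightarrow> v + v' \<in> V \<and> Bs (v + v') = Bs v + Bs v'"
  by (rule adj_eqI) (simp add: inner_add_right adj_prop)

lemma adj_scale: "v \<in> V \<Longrightarrow> c *\<^sub>R v \<in> V \<and> Bs (c *\<^sub>R v) = c *\<^sub>R Bs v"
  by (rule adj_eqI) (simp add: adj_prop)

lemma adj_diff: "v \<in> V \<Longrightarrow> v' \<in> V \<Longrightarrow> v - v' \<in> V \<and> Bs (v - v') = Bs v - Bs v'"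
  by (rule adj_eqI) (simp add: inner_diff_right adj_prop)

lemma adj_inj: "v \<in> V \<Longrightarrow> v' \<in> V \<Longrightarrow> Bs v = Bs v' \<Longrightarrow> v = v'"
  using adj_diff[of v v'] coercive[of "v - v'"] C0_pos by (simp add: mult_le_0_iff)

lemma in_X: "(u, v, z) \<in> X \<longleftrightarrow> u \<in> V \<and> z \<in> L2_01"
  by (simp add: state_space_def)

section \<open>Inner product on states and the embedding of classes\<close>

definition sip :: "('h, 'h1) state \<Rightarrow> ('h, 'h1) state \<Rightarrow> real" where
  "sip x y = (case x of (u,v,z) \<Rightarrow> case y of (u',v',z') \<Rightarrow>
     inner (Bs u) (Bs u') + inner v v' + \<xi> * wip (\<lambda>_. 1) z z')"

lemma state_norm_eq: "N (u, v, z) = sqrt ((norm (Bs u))\<^sup>2 + (norm v)\<^sup>2 + \<xi> * L2_norm2 z)"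
  by (simp add: state_norm_def)

lemma state_norm_sq: "(N (u, v, z))\<^sup>2 = (norm (Bs u))\<^sup>2 + (norm v)\<^sup>2 + \<xi> * L2_norm2 z"
  using xi_pos by (simp add: state_norm_eq)

lemma state_norm_nonneg [simp]: "0 \<le> N x"
  using xi_pos by (cases x) (simp add: state_norm_eq)

lemma component_bounds:
  shows "norm (Bs u) \<le> N (u, v, z)" "norm v \<le> N (u, v, z)" "sqrt \<xi> * sqrt (L2_norm2 z) \<le> N (u, v, z)"
  unfolding state_norm_eq real_sqrt_mult[symmetric]
  using xi_pos by (auto intro!: real_le_rsqrt)

lemma sip_same: "sip x x = (N x)\<^sup>2"
  by (cases x) (simp add: sip_def state_norm_sq wip_1_same power2_norm_eq_inner)

lemma sip_sym: "sip x y = sip y x"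
  by (cases x; cases y) (simp add: sip_def inner_commute wip_sym)

lemma X_add: "x \<in> X \<Longrightarrow> y \<in> X \<Longrightarrow> sadd x y \<in> X"
  by (cases x; cases y) (simp add: in_X sadd_def adj_add L2_01_add)

lemma X_scale: "x \<in> X \<Longrightarrow> sscale c x \<in> X"
  by (cases x) (simp add: in_X sscale_def adj_scale L2_01_scaleR)

lemma sip_add: "x \<in> X \<Longrightarrow> x' \<in> X \<Longrightarrow> y \<in> X \<Longrightarrow> sip (sadd x x') y = sip x y + sip x' y"
  by (cases x; cases x'; cases y)
    (simp add: in_X sadd_def sip_def adj_add inner_add_left wip_add_left algebra_simps)

lemma sip_scale: "x \<in> X \<Longrightarrow> sip (sscale c x) y = c * sip x y"
  by (cases x; cases y) (simp add: in_X sscale_def sip_def adj_scale wip_scaleR_left algebra_simps)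

lemma sip_bound:
  assumes "x \<in> X" "y \<in> X"
  shows "\<bar>sip x y\<bar> \<le> N x * N y"
proof -
  obtain u v z where x: "x = (u, v, z)" by (cases x)
  obtain u' v' z' where y: "y = (u', v', z')" by (cases y)
  have z: "z \<in> L2_01" "z' \<in> L2_01" using assms by (auto simp: x y in_X)
  have w: "\<bar>wip (\<lambda>_. 1) z z'\<bar> \<le> sqrt (L2_norm2 z) * sqrt (L2_norm2 z')"
    using wip_bound[OF z, of "\<lambda>_. 1" 1] by simp
  have "\<bar>\<xi> * wip (\<lambda>_. 1) z z'\<bar> \<le> \<xi> * (sqrt (L2_norm2 z) * sqrt (L2_norm2 z'))"
    unfolding abs_mult using w xi_pos by (intro mult_mono) auto
  then have "\<bar>sip x y\<bar> \<le> norm (Bs u) * norm (Bs u') + norm v * norm v' + \<xi> * (sqrt (L2_norm2 z) * sqrt (L2_norm2 z'))"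
    using Cauchy_Schwarz_ineq2[of "Bs u" "Bs u'"] Cauchy_Schwarz_ineq2[of v v']
    unfolding x y sip_def prod.case by linarith
  also have "\<xi> * (sqrt (L2_norm2 z) * sqrt (L2_norm2 z')) = sqrt (\<xi> * L2_norm2 z) * sqrt (\<xi> * L2_norm2 z')"
    using xi_pos by (simp add: real_sqrt_mult)
  \<comment> \<open>Cauchy-Schwarz in three real dimensions combines the component bounds.\<close>
  also have "norm (Bs u) * norm (Bs u') + norm v * norm v' + sqrt (\<xi> * L2_norm2 z) * sqrt (\<xi> * L2_norm2 z')
      = inner (norm (Bs u), norm v, sqrt (\<xi> * L2_norm2 z)) (norm (Bs u'), norm v', sqrt (\<xi> * L2_norm2 z'))"
    by (simp add: inner_prod_def)
  also have "\<dots> \<le> norm (norm (Bs u), norm v, sqrt (\<xi> * L2_norm2 z)) * norm (norm (Bs u'), norm v', sqrt (\<xi> * L2_norm2 z'))"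
    by (rule norm_cauchy_schwarz)
  also have "\<dots> = N x * N y"
    using xi_pos by (simp add: x y norm_prod_def state_norm_eq add.assoc)
  finally show ?thesis .
qed

text \<open>States are functions, known only up to null sets, so they form no normed space.  Sending a state to its
  inner products with the unit ball identifies the quotient isometrically with a closed subspace of a
  Banach space (the domain is made discrete only to have all functions continuous).\<close>

definition J :: "('h, 'h1) state \<Rightarrow> (('h, 'h1) state discrete \<Rightarrow>\<^sub>C real)" where
  "J x = Bcontfun (\<lambda>d. if of_discrete d \<in> X \<and> N (of_discrete d) \<le> 1 then sip x (of_discrete d) else 0)"

lemma J_apply:
  assumes x: "x \<in> X"
  shows "apply_bcontfun (J x) d = (if of_discrete d \<in> X \<and> N (of_discrete d) \<le> 1 then sip x (of_discrete d) else 0)"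
proof -
  let ?f = "\<lambda>d. if of_discrete d \<in> X \<and> N (of_discrete d) \<le> 1 then sip x (of_discrete d) else 0"
  have "?f \<in> bcontfun"
  proof (rule bcontfun_normI)
    show "continuous_on UNIV ?f" by (simp add: continuous_on_open_vimage open_discrete)
    fix d show "norm (?f d) \<le> N x"
    proof (cases "of_discrete d \<in> X \<and> N (of_discrete d) \<le> 1")
      case True
      then have "\<bar>sip x (of_discrete d)\<bar> \<le> N x * 1"
        using sip_bound[OF x, of "of_discrete d"] mult_left_mono[of "N (of_discrete d)" 1 "N x"] by simp
      then show ?thesis using True by simp
    next
      case False
      then have "?f d = 0" by (rule if_not_P)
      then show ?thesis by (simp only: norm_zero state_norm_nonneg)
    qed
  qed
  then show ?thesis unfolding J_def by (subst Bcontfun_inverse) auto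
qed

lemma J_add: "x \<in> X \<Longrightarrow> y \<in> X \<Longrightarrow> J (sadd x y) = J x + J y"
  by (rule bcontfun_eqI) (simp add: J_apply X_add sip_add)

lemma J_scale: "x \<in> X \<Longrightarrow> J (sscale c x) = c *\<^sub>R J x"
  by (rule bcontfun_eqI) (simp add: J_apply X_scale sip_scale)

lemma norm_J: assumes x: "x \<in> X" shows "norm (J x) = N x"
proof (rule antisym)
  show "norm (J x) \<le> N x"
  proof (rule norm_bound)
    fix d show "norm (apply_bcontfun (J x) d) \<le> N x"
      using sip_bound[OF x, of "of_discrete d"] mult_left_mono[of "N (of_discrete d)" 1 "N x"]
      by (auto simp: J_apply[OF x])
  qed
  show "N x \<le> norm (J x)"
  proof (cases "N x = 0")
    case False
    \<comment> \<open>The normalized state is a test element at which the supremum is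
      attained.\<close>
    define y where "y = sscale (1 / N x) x"
    have yX: "y \<in> X" using x by (simp add: y_def X_scale)
    have yx: "sip y x = N x" unfolding y_def sip_scale[OF x] using False by (simp add: sip_same power2_eq_square)
    have "(N y)\<^sup>2 = sip y y" by (simp add: sip_same)
    also have "\<dots> = 1 / N x * sip x y" by (subst y_def, rule sip_scale[OF x])
    also have "\<dots> = 1" using yx False by (simp add: sip_sym)
    finally have N1: "N y = 1" using state_norm_nonneg[of y] by (metis abs_of_nonneg power2_eq_1_iff abs_1 abs_minus_cancel)
    have "sip x y = N x" using yx by (simp add: sip_sym)
    then show ?thesis using norm_bounded[of "J x" "discrete y"] yX N1
      by (simp add: J_apply[OF x] discrete_inverse)
  qed simp
qed

lemma X_diff: "x \<in> X \<Longrightarrow> y \<in> X \<Longrightarrow> sadd x (sscale (-1) y) \<in> X"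
  and J_diff: "x \<in> X \<Longrightarrow> y \<in> X \<Longrightarrow> J (sadd x (sscale (-1) y)) = J x - J y"
  and N_diff: "x \<in> X \<Longrightarrow> y \<in> X \<Longrightarrow> N (sadd x (sscale (-1) y)) = norm (J x - J y)"
  using norm_J[of "sadd x (sscale (-1) y)"] by (simp_all add: X_add X_scale J_add J_scale)

lemma state_diff: "sadd (u, v, z) (sscale (-1) (u', v', z')) = (u - u', v - v', \<lambda>\<rho>. z \<rho> - z' \<rho>)"
  by (simp add: sadd_def sscale_def)

text \<open>Coercivity makes the adjoint injective, so a class determines the first two components
  as true values; only the delay component is known up to a null set.\<close>

lemma J_eq_iff:
  assumes "(u, v, z) \<in> X" "(u', v', z') \<in> X"
  shows "J (u, v, z) = J (u', v', z') \<longleftrightarrow> u = u' \<and> v = v' \<and> L2_norm2 (\<lambda>\<rho>. z \<rho> - z' \<rho>) = 0"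
proof -
  have V: "u \<in> V" "u' \<in> V" using assms by (auto simp: in_X)
  have Bd: "Bs (u - u') = Bs u - Bs u'" using adj_diff[OF V] by simp
  have "J (u, v, z) = J (u', v', z') \<longleftrightarrow> (N (sadd (u, v, z) (sscale (-1) (u', v', z'))))\<^sup>2 = 0"
    using N_diff[OF assms] by simp
  also have "\<dots> \<longleftrightarrow> (norm (Bs u - Bs u'))\<^sup>2 + (norm (v - v'))\<^sup>2 + \<xi> * L2_norm2 (\<lambda>\<rho>. z \<rho> - z' \<rho>) = 0"
    by (simp only: state_diff state_norm_sq Bd)
  also have "\<dots> \<longleftrightarrow> Bs u = Bs u' \<and> v = v' \<and> L2_norm2 (\<lambda>\<rho>. z \<rho> - z' \<rho>) = 0"
    using xi_pos by (simp add: add_nonneg_eq_0_iff)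
  also have "Bs u = Bs u' \<longleftrightarrow> u = u'" using adj_inj[OF V] by auto
  finally show ?thesis .
qed

lemma subspace_JX: "subspace (J ` X)"
proof (rule subspaceI)
  let ?o = "(0, 0, \<lambda>_. 0) :: ('h, 'h1) state"
  have o: "?o \<in> X" using adj_eqI[of 0 0] by (simp add: in_X L2_01_const)
  have "0 = J (sscale 0 ?o)" by (simp only: J_scale[OF o] scaleR_zero_left)
  then show "0 \<in> J ` X" using X_scale[OF o] by blast
  show "x + y \<in> J ` X" if "x \<in> J ` X" "y \<in> J ` X" for x y
    using that by (auto simp: J_add[symmetric] intro!: imageI X_add)
  show "c *\<^sub>R x \<in> J ` X" if "x \<in> J ` X" for c x
    using that by (auto simp: J_scale[symmetric] intro!: imageI X_scale)
qed

text \<open>A Cauchy sequence of classes is Cauchy in each component; completeness of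
  \<open>V\<close> under the norm of \<open>Bs\<close> and \<open>L2_01_complete\<close> provide the
  limits.\<close>

lemma closed_JX: "closed (J ` X)"
  unfolding closed_sequential_limits
proof (intro allI impI)
  fix f l assume fl: "(\<forall>n. f n \<in> J ` X) \<and> f \<longlonglongrightarrow> l"
  then have "\<forall>n. \<exists>x. x \<in> X \<and> f n = J x" by blast
  from choice[OF this] obtain x where x: "\<And>n. x n \<in> X" "\<And>n. f n = J (x n)" by blast
  define u v z where "u n = fst (x n)" and "v n = fst (snd (x n))" and "z n = snd (snd (x n))" for n
  have xe: "x n = (u n, v n, z n)" for n by (simp add: u_def v_def z_def)
  have uV: "u n \<in> V" and zL: "z n \<in> L2_01" for n using x(1)[of n] by (auto simp: xe in_X)
  have Bd: "Bs (u m - u n) = Bs (u m) - Bs (u n)" for m n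
    using adj_diff[OF uV uV] by simp
  have df: "norm (f m - f n) = N (u m - u n, v m - v n, \<lambda>\<rho>. z m \<rho> - z n \<rho>)" for m n
    using N_diff[OF x(1) x(1), of m n] by (simp only: x(2) xe state_diff)
  have bu: "norm (Bs (u m) - Bs (u n)) \<le> norm (f m - f n)" for m n
    unfolding df using component_bounds(1)[of "u m - u n"] by (simp only: Bd)
  have bv: "norm (v m - v n) \<le> norm (f m - f n)" for m n
    unfolding df by (rule component_bounds(2))
  have bz: "\<xi> * L2_dist2 (z m) (z n) \<le> (norm (f m - f n))\<^sup>2" for m n
    unfolding df state_norm_sq by (simp add: L2_dist2_def)
  have cau: "Cauchy f" using fl LIMSEQ_imp_Cauchy by blast
  have "Cauchy (\<lambda>n. Bs (u n))"
    using cau unfolding Cauchy_iff by (meson bu le_less_trans)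
  then obtain u' where u': "u' \<in> V" "(\<lambda>n. Bs (u n)) \<longlonglongrightarrow> Bs u'" using V_complete[of u] uV by blast
  have "Cauchy v" using cau unfolding Cauchy_iff by (meson bv le_less_trans)
  then obtain v' where v': "v \<longlonglongrightarrow> v'" using Cauchy_convergent convergent_def by blast
  have "\<exists>z'\<in>L2_01. (\<lambda>n. L2_dist2 (z n) z') \<longlonglongrightarrow> 0"
  proof (rule L2_01_complete[OF zL])
    fix e :: real assume e: "e > 0"
    then have "sqrt (\<xi> * e) > 0" using xi_pos by simp
    then obtain M where M: "\<And>m n. m \<ge> M \<Longrightarrow> n \<ge> M \<Longrightarrow> norm (f m - f n) < sqrt (\<xi> * e)"
      using cau unfolding Cauchy_iff by blast
    have "L2_dist2 (z m) (z n) < e" if "m \<ge> M" "n \<ge> M" for m n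
    proof -
      have "(norm (f m - f n))\<^sup>2 < (sqrt (\<xi> * e))\<^sup>2"
        using M[OF that] by (intro power_strict_mono) auto
      also have "\<dots> = \<xi> * e" using xi_pos e by simp
      finally have "\<xi> * L2_dist2 (z m) (z n) < \<xi> * e" by (rule le_less_trans[OF bz])
      then show ?thesis by (simp only: mult_less_cancel_left_pos[OF xi_pos])
    qed
    then show "\<exists>N. \<forall>m\<ge>N. \<forall>n\<ge>N. L2_dist2 (z m) (z n) < e" by blast
  qed
  then obtain z' where z': "z' \<in> L2_01" "(\<lambda>n. L2_dist2 (z n) z') \<longlonglongrightarrow> 0" by blast
  have X': "(u', v', z') \<in> X" using u' z' by (simp add: in_X)
  have "(\<lambda>n. norm (f n - J (u', v', z'))) \<longlonglongrightarrow> 0"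
  proof -
    have Bd': "Bs (u n - u') = Bs (u n) - Bs u'" for n
      using adj_diff[OF uV u'(1)] by simp
    have "norm (f n - J (u', v', z'))
        = sqrt ((norm (Bs (u n) - Bs u'))\<^sup>2 + (norm (v n - v'))\<^sup>2 + \<xi> * L2_dist2 (z n) z')" for n
      using N_diff[OF x(1)[of n] X'] by (simp only: x(2) xe state_diff state_norm_eq Bd' L2_dist2_def)
    moreover have "(\<lambda>n. sqrt ((norm (Bs (u n) - Bs u'))\<^sup>2 + (norm (v n - v'))\<^sup>2 + \<xi> * L2_dist2 (z n) z'))
        \<longlonglongrightarrow> sqrt ((norm (Bs u' - Bs u'))\<^sup>2 + (norm (v' - v'))\<^sup>2 + \<xi> * 0)"
      by (intro tendsto_intros u' v' z')
    ultimately show ?thesis by simp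
  qed
  then have "f \<longlonglongrightarrow> J (u', v', z')" by (simp add: tendsto_norm_zero_iff LIM_zero_iff)
  then have "l = J (u', v', z')" using fl LIMSEQ_unique by blast
  then show "l \<in> J ` X" using X' by blast
qed

end

section \<open>Bounded forms along orbits\<close>

context delayed_wave
begin

text \<open>The bound by \<open>N\<close> makes a form independent of the representatives of its
  arguments. Linearity in the second argument comes from symmetry.\<close>

definition bform :: "(('h, 'h1) state \<Rightarrow> ('h, 'h1) state \<Rightarrow> real) \<Rightarrow> bool" where
  "bform b \<longleftrightarrow> (\<forall>x\<in>X. \<forall>x'\<in>X. \<forall>y\<in>X. b (sadd x x') y = b x y + b x' y) \<and>
     (\<forall>x\<in>X. \<forall>y\<in>X. \<forall>c. b (sscale c x) y = c * b x y) \<and>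
     (\<forall>x\<in>X. \<forall>y\<in>X. b x y = b y x) \<and>
     (\<exists>C. \<forall>x\<in>X. \<forall>y\<in>X. \<bar>b x y\<bar> \<le> C * (N x * N y))"

text \<open>The representatives \<open>p s\<close> may be chosen wildly at each time; only their
  classes are differentiable. The bound of \<open>b\<close> by \<open>N\<close> lets the difference
  quotient of classes control that of numbers.\<close>

lemma bform_deriv:
  assumes b: "bform b" and p: "\<And>s. 0 \<le> s \<Longrightarrow> p s \<in> X" and q: "q \<in> X" and t: "0 \<le> t"
    and d: "((\<lambda>s. J (p s)) has_vector_derivative J q) (at t within {0..})"
  shows "((\<lambda>s. b (p s) (p s)) has_real_derivative 2 * b (p t) q) (at t within {0..})"
proof -
  have add: "\<And>x x' y. x \<in> X \<Longrightarrow> x' \<in> X \<Longrightarrow> y \<in> X \<Longrightarrow> b (sadd x x') y = b x y + b x' y"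
    and scl: "\<And>x y c. x \<in> X \<Longrightarrow> y \<in> X \<Longrightarrow> b (sscale c x) y = c * b x y"
    and sym: "\<And>x y. x \<in> X \<Longrightarrow> y \<in> X \<Longrightarrow> b x y = b y x"
    using b unfolding bform_def by blast+
  obtain C where C: "\<And>x y. x \<in> X \<Longrightarrow> y \<in> X \<Longrightarrow> \<bar>b x y\<bar> \<le> C * (N x * N y)"
    using b unfolding bform_def by blast
  let ?F = "at t within {0..}"
  let ?\<Delta> = "\<lambda>s. sadd (p s) (sscale (-1) (p t))"
  let ?E = "\<lambda>s. sadd (sscale (1 / (s - t)) (?\<Delta> s)) (sscale (-1) q)"
  have pt: "p t \<in> X" using p t by simp
  have quot: "((\<lambda>s. (1 / (s - t)) *\<^sub>R (J (p s) - J (p t))) \<longlongrightarrow> J q) ?F"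
    using d by (simp add: has_vector_derivative_iff_quotient)
  have cont: "((\<lambda>s. J (p s)) \<longlongrightarrow> J (p t)) ?F"
    using has_vector_derivative_continuous[OF d] by (simp add: continuous_within)
  \<comment> \<open>Expansion around \<open>p t\<close>: twice the error of the difference quotient
    paired with \<open>p t\<close>, plus a quadratic term that vanishes because the increment tends
    to 0.\<close>
  have eq: "(1 / (s - t)) *\<^sub>R (b (p s) (p s) - b (p t) (p t)) - 2 * b (p t) q
      = 2 * b (?E s) (p t) + (1 / (s - t)) * b (?\<Delta> s) (?\<Delta> s)" if s: "0 \<le> s" for s
  proof -
    have ps: "p s \<in> X" using p s by simp
    have D: "?\<Delta> s \<in> X" using ps pt by (rule X_diff)
    have 1: "b (?\<Delta> s) y = b (p s) y - b (p t) y" if "y \<in> X" for y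
      using add[OF ps X_scale[OF pt] that, of "-1"] scl[OF pt that, of "-1"] by simp
    have 2: "b (?\<Delta> s) (?\<Delta> s) = b (p s) (p s) - 2 * b (p s) (p t) + b (p t) (p t)"
      using 1[OF D] 1[OF ps] 1[OF pt] sym[OF ps D] sym[OF pt D] sym[OF pt ps] by simp
    have 3: "b (?E s) (p t) = 1 / (s - t) * b (?\<Delta> s) (p t) - b (p t) q"
      using add[OF X_scale[OF D] X_scale[OF q] pt, of "1 / (s - t)" "-1"] scl[OF D pt] scl[OF q pt, of "-1"]
        sym[OF q pt] by simp
    show ?thesis unfolding 3 2 1[OF pt] by (simp add: algebra_simps)
  qed
  have lim: "((\<lambda>s. (1 / (s - t)) *\<^sub>R (b (p s) (p s) - b (p t) (p t)) - 2 * b (p t) q) \<longlongrightarrow> 0) ?F"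
  proof (rule Lim_null_comparison)
    show "eventually (\<lambda>s. norm ((1 / (s - t)) *\<^sub>R (b (p s) (p s) - b (p t) (p t)) - 2 * b (p t) q)
        \<le> 2 * (C * (norm ((1 / (s - t)) *\<^sub>R (J (p s) - J (p t)) - J q) * N (p t)))
          + C * (norm ((1 / (s - t)) *\<^sub>R (J (p s) - J (p t))) * norm (J (p s) - J (p t)))) ?F"
      unfolding eventually_at_filter
    proof (rule always_eventually, intro allI impI)
      fix s assume "s \<noteq> t" "s \<in> {0..}"
      then have s: "0 \<le> s" by simp
      have ps: "p s \<in> X" using p s by simp
      have D: "?\<Delta> s \<in> X" using ps pt by (rule X_diff)
      have E: "?E s \<in> X" by (rule X_diff[OF X_scale[OF D] q])
      have NE: "N (?E s) = norm ((1 / (s - t)) *\<^sub>R (J (p s) - J (p t)) - J q)"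
        unfolding N_diff[OF X_scale[OF D] q] J_scale[OF D] J_diff[OF ps pt] ..
      have ND: "N (?\<Delta> s) = norm (J (p s) - J (p t))" by (rule N_diff[OF ps pt])
      have "N (sscale (1 / (s - t)) (?\<Delta> s)) = norm ((1 / (s - t)) *\<^sub>R (J (p s) - J (p t)))"
        unfolding norm_J[OF X_scale[OF D], symmetric] J_scale[OF D] J_diff[OF ps pt] ..
      then have "\<bar>(1 / (s - t)) * b (?\<Delta> s) (?\<Delta> s)\<bar>
          \<le> C * (norm ((1 / (s - t)) *\<^sub>R (J (p s) - J (p t))) * norm (J (p s) - J (p t)))"
        using C[OF X_scale[OF D] D, of "1 / (s - t)"] scl[OF D D, of "1 / (s - t)"] ND by simp
      moreover have "\<bar>b (?E s) (p t)\<bar> \<le> C * (norm ((1 / (s - t)) *\<^sub>R (J (p s) - J (p t)) - J q) * N (p t))"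
        using C[OF E pt] unfolding NE .
      ultimately show "norm ((1 / (s - t)) *\<^sub>R (b (p s) (p s) - b (p t) (p t)) - 2 * b (p t) q)
        \<le> 2 * (C * (norm ((1 / (s - t)) *\<^sub>R (J (p s) - J (p t)) - J q) * N (p t)))
          + C * (norm ((1 / (s - t)) *\<^sub>R (J (p s) - J (p t))) * norm (J (p s) - J (p t)))"
        unfolding eq[OF s] real_norm_def by linarith
    qed
    have "((\<lambda>s. 2 * (C * (norm ((1 / (s - t)) *\<^sub>R (J (p s) - J (p t)) - J q) * N (p t)))
          + C * (norm ((1 / (s - t)) *\<^sub>R (J (p s) - J (p t))) * norm (J (p s) - J (p t))))
        \<longlongrightarrow> 2 * (C * (norm (J q - J q) * N (p t))) + C * (norm (J q) * norm (J (p t) - J (p t)))) ?F"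
      by (rule tendsto_intros quot cont)+
    then show "((\<lambda>s. 2 * (C * (norm ((1 / (s - t)) *\<^sub>R (J (p s) - J (p t)) - J q) * N (p t)))
          + C * (norm ((1 / (s - t)) *\<^sub>R (J (p s) - J (p t))) * norm (J (p s) - J (p t)))) \<longlongrightarrow> 0) ?F" by simp
  qed
  show ?thesis
    unfolding has_real_derivative_iff_has_vector_derivative has_vector_derivative_iff_quotient
    by (rule LIM_zero_cancel[OF lim])
qed

lemma sqrt_L2_norm2_le: "sqrt (L2_norm2 z) \<le> N (u, v, z) / sqrt \<xi>"
  using component_bounds(3)[of z u v] xi_pos by (simp add: field_simps)

lemma norm_le_norm_adj: "u \<in> V \<Longrightarrow> norm u \<le> norm (Bs u) / C0"
  using coercive[of u] C0_pos by (simp add: field_simps)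

section \<open>The forms that make up the energies\<close>

lemma bform_velocity: "bform (\<lambda>x y. inner (fst (snd x)) (fst (snd y)))"
proof -
  have "\<bar>inner v v'\<bar> \<le> 1 * (N (u, v, z) * N (u', v', z'))" for u u' v v' z z'
    using Cauchy_Schwarz_ineq2[of v v'] mult_mono[OF component_bounds(2)[of v u z] component_bounds(2)[of v' u' z']]
    by simp
  then have "\<exists>C. \<forall>x\<in>X. \<forall>y\<in>X. \<bar>inner (fst (snd x)) (fst (snd y))\<bar> \<le> C * (N x * N y)"
    by (intro exI[of _ 1] ballI) (auto simp: in_X)
  then show ?thesis
    unfolding bform_def by (auto simp: in_X sadd_def sscale_def inner_add_left inner_add_right inner_commute)
qed

lemma bform_displacement: "bform (\<lambda>x y. inner (Bs (fst x)) (Bs (fst y)))"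
proof -
  have "\<bar>inner (Bs u) (Bs u')\<bar> \<le> 1 * (N (u, v, z) * N (u', v', z'))" for u u' v v' z z'
    using Cauchy_Schwarz_ineq2[of "Bs u" "Bs u'"] mult_mono[OF component_bounds(1)[of u v z] component_bounds(1)[of u' v' z']]
    by simp
  then have "\<exists>C. \<forall>x\<in>X. \<forall>y\<in>X. \<bar>inner (Bs (fst x)) (Bs (fst y))\<bar> \<le> C * (N x * N y)"
    by (intro exI[of _ 1] ballI) (auto simp: in_X)
  then show ?thesis
    unfolding bform_def by (auto simp: in_X sadd_def sscale_def adj_add adj_scale inner_add_left inner_add_right inner_commute)
qed

lemma bform_delay:
  assumes \<phi>: "continuous_on {0..1} \<phi>"
  shows "bform (\<lambda>x y. wip \<phi> (snd (snd x)) (snd (snd y)))"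
proof -
  obtain K where K: "K > 0" "\<And>\<rho>. \<rho> \<in> {0..1} \<Longrightarrow> \<bar>\<phi> \<rho>\<bar> \<le> K" using weight_bound[OF \<phi>] by blast
  have "\<bar>wip \<phi> z z'\<bar> \<le> K / \<xi> * (N (u, v, z) * N (u', v', z'))" if "z \<in> L2_01" "z' \<in> L2_01" for u u' v v' z z'
  proof -
    have "\<bar>wip \<phi> z z'\<bar> \<le> K * sqrt (L2_norm2 z) * sqrt (L2_norm2 z')" by (rule wip_bound[OF that \<phi> K(2)])
    also have "\<dots> \<le> K * (N (u, v, z) / sqrt \<xi>) * (N (u', v', z') / sqrt \<xi>)"
      using K(1) xi_pos by (intro mult_mono sqrt_L2_norm2_le) auto
    also have "\<dots> = K / (sqrt \<xi> * sqrt \<xi>) * (N (u, v, z) * N (u', v', z'))" by simp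
    finally show ?thesis using xi_pos by simp
  qed
  then have "\<exists>C. \<forall>x\<in>X. \<forall>y\<in>X. \<bar>wip \<phi> (snd (snd x)) (snd (snd y))\<bar> \<le> C * (N x * N y)"
    by (intro exI[of _ "K / \<xi>"] ballI) (auto simp: in_X)
  then show ?thesis
    unfolding bform_def by (auto simp: in_X sadd_def sscale_def wip_add_left wip_scaleR_left wip_add_right wip_scaleR_right \<phi> wip_sym)
qed

text \<open>Symmetrized to be a \<open>bform\<close>, hence twice (u, v) on the diagonal. The norm
  \<open>N\<close> contains \<open>Bs u\<close> and not \<open>u\<close>, so the bound passes
  through coercivity.\<close>

lemma bform_cross:
  "bform (\<lambda>x y. inner (fst x) (fst (snd y)) + inner (fst y) (fst (snd x)))"
proof -
  have one: "\<bar>inner u v'\<bar> \<le> 1 / C0 * (N (u, v, z) * N (u', v', z'))" if "u \<in> V" for u u' v v' z z'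
  proof -
    have "\<bar>inner u v'\<bar> \<le> norm u * norm v'" by (rule Cauchy_Schwarz_ineq2)
    also have "\<dots> \<le> (N (u, v, z) / C0) * N (u', v', z')"
    proof (intro mult_mono component_bounds(2))
      have "norm u \<le> norm (Bs u) / C0" by (rule norm_le_norm_adj[OF that])
      also have "\<dots> \<le> N (u, v, z) / C0" using C0_pos by (intro divide_right_mono component_bounds(1)) auto
      finally show "norm u \<le> N (u, v, z) / C0" .
    qed (use C0_pos in auto)
    finally show ?thesis by simp
  qed
  have "\<bar>inner u v' + inner u' v\<bar> \<le> 2 / C0 * (N (u, v, z) * N (u', v', z'))" if "u \<in> V" "u' \<in> V" for u u' v v' z z'
    using one[OF that(1), of v' v z u' z'] one[OF that(2), of v v' z' u z] by (simp add: mult.commute)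
  then have "\<exists>C. \<forall>x\<in>X. \<forall>y\<in>X. \<bar>inner (fst x) (fst (snd y)) + inner (fst y) (fst (snd x))\<bar> \<le> C * (N x * N y)"
    by (intro exI[of _ "2 / C0"] ballI) (auto simp: in_X)
  then show ?thesis
    unfolding bform_def by (auto simp: in_X sadd_def sscale_def inner_add_left inner_add_right algebra_simps)
qed

text \<open>Pairs the delay component with a constant function; on the diagonal this is twice (int
  z, w), the part of (h, w) that involves z.\<close>

lemma bform_delay_cross:
  "bform (\<lambda>x y. wip (\<lambda>_. 1) (snd (snd x)) (\<lambda>_. Bs (fst y)) + wip (\<lambda>_. 1) (snd (snd y)) (\<lambda>_. Bs (fst x)))"
proof -
  have one: "\<bar>wip (\<lambda>_. 1) z (\<lambda>_. Bs u')\<bar> \<le> 1 / sqrt \<xi> * (N (u, v, z) * N (u', v', z'))" if "z \<in> L2_01" for u u' v v' z z'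
  proof -
    have "\<bar>wip (\<lambda>_. 1) z (\<lambda>_. Bs u')\<bar> \<le> 1 * sqrt (L2_norm2 z) * sqrt (L2_norm2 (\<lambda>_. Bs u'))"
      by (rule wip_bound[OF that L2_01_const]) auto
    also have "sqrt (L2_norm2 (\<lambda>_. Bs u')) = norm (Bs u')" by (simp add: L2_norm2_const)
    also have "1 * sqrt (L2_norm2 z) * norm (Bs u') \<le> (N (u, v, z) / sqrt \<xi>) * N (u', v', z')"
      using xi_pos unfolding mult_1 by (intro mult_mono sqrt_L2_norm2_le component_bounds(1)) auto
    finally show ?thesis by simp
  qed
  have "\<bar>wip (\<lambda>_. 1) z (\<lambda>_. Bs u') + wip (\<lambda>_. 1) z' (\<lambda>_. Bs u)\<bar> \<le> 2 / sqrt \<xi> * (N (u, v, z) * N (u', v', z'))"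
    if "z \<in> L2_01" "z' \<in> L2_01" for u u' v v' z z'
    using one[OF that(1), of u' u v v' z'] one[OF that(2), of u u' v' v z] by (simp add: mult.commute)
  then have "\<exists>C. \<forall>x\<in>X. \<forall>y\<in>X. \<bar>wip (\<lambda>_. 1) (snd (snd x)) (\<lambda>_. Bs (fst y)) + wip (\<lambda>_. 1) (snd (snd y)) (\<lambda>_. Bs (fst x))\<bar>
      \<le> C * (N x * N y)"
    by (intro exI[of _ "2 / sqrt \<xi>"] ballI) (auto simp: in_X)
  then show ?thesis
    unfolding bform_def
    by (auto simp: in_X sadd_def sscale_def wip_add_left wip_scaleR_left wip_add_right wip_scaleR_right
        adj_add adj_scale L2_01_const algebra_simps)
qed

end

locale delayed_wave_semigroup = delayed_wave B DB C0 \<xi>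
  for B :: "'h1::{real_inner,banach} \<Rightarrow> 'h::{real_inner,banach}" and DB C0 \<xi> +
  fixes a \<tau> :: real and T :: "real \<Rightarrow> ('h, 'h1) state \<Rightarrow> ('h, 'h1) state"
  assumes a_pos: "a > 0" and tau_pos: "\<tau> > 0" and tau_le: "\<tau> \<le> a"
    and T_gen: "C0_semigroup_generated_by (state_space DB B) (state_norm DB B \<xi>) sadd sscale T
                  (opA DB B a \<tau>) (opA_dom DB B a)"
begin

abbreviation "A \<equiv> opA DB B a \<tau>"
abbreviation "D \<equiv> opA_dom DB B a"

section \<open>The semigroup acting on classes of states\<close>

lemma T_X: "0 \<le> t \<Longrightarrow> x \<in> X \<Longrightarrow> T t x \<in> X"
  and D_X: "x \<in> D \<Longrightarrow> x \<in> X" and A_X: "x \<in> D \<Longrightarrow> A x \<in> X"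
  using T_gen unfolding C0_semigroup_generated_by_def C0_semigroup_def by blast+

lemma J_T_lin: "0 \<le> t \<Longrightarrow> x \<in> X \<Longrightarrow> y \<in> X \<Longrightarrow> J (T t (sadd x (sscale c y))) = J (T t x) + c *\<^sub>R J (T t y)"
proof -
  assume *: "0 \<le> t" "x \<in> X" "y \<in> X"
  then have "N (sadd (T t (sadd x (sscale c y))) (sscale (-1) (sadd (T t x) (sscale c (T t y))))) = 0"
    using T_gen unfolding C0_semigroup_generated_by_def C0_semigroup_def by blast
  moreover have "T t (sadd x (sscale c y)) \<in> X" "sadd (T t x) (sscale c (T t y)) \<in> X"
    using * by (auto intro!: T_X X_add X_scale)
  ultimately have "J (T t (sadd x (sscale c y))) = J (sadd (T t x) (sscale c (T t y)))"
    by (simp only: N_diff norm_eq_zero right_minus_eq)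
  then show ?thesis using * by (simp add: J_add J_scale X_scale T_X)
qed

lemma T_bounded: "0 \<le> t \<Longrightarrow> \<exists>M. \<forall>x\<in>X. N (T t x) \<le> M * N x"
  using T_gen unfolding C0_semigroup_generated_by_def C0_semigroup_def by blast

text \<open>\<open>T\<close> acts on representatives and might separate members of one class; its
  boundedness sends a difference of norm 0 to one of norm 0.\<close>

lemma J_T_cong: "0 \<le> t \<Longrightarrow> x \<in> X \<Longrightarrow> y \<in> X \<Longrightarrow> J x = J y \<Longrightarrow> J (T t x) = J (T t y)"
proof -
  assume *: "0 \<le> t" "x \<in> X" "y \<in> X" "J x = J y"
  obtain M where M: "\<And>x. x \<in> X \<Longrightarrow> N (T t x) \<le> M * N x" using T_bounded *(1) by blast
  have d: "sadd x (sscale (-1) y) \<in> X" using * by (intro X_diff)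
  have "norm (J (T t (sadd x (sscale (-1) y)))) \<le> M * norm (J (sadd x (sscale (-1) y)))"
    using M[OF d] by (simp only: norm_J d T_X[OF *(1) d])
  then have "J (T t (sadd x (sscale (-1) y))) = 0" using * by (simp add: J_diff)
  then show ?thesis using J_T_lin[OF *(1-3), of "-1"] by simp
qed

definition U :: "real \<Rightarrow> (('h, 'h1) state discrete \<Rightarrow>\<^sub>C real) \<Rightarrow> (('h, 'h1) state discrete \<Rightarrow>\<^sub>C real)" where
  "U t y = J (T t (inv_into X J y))"

lemma U_J: "0 \<le> t \<Longrightarrow> x \<in> X \<Longrightarrow> U t (J x) = J (T t x)"
  unfolding U_def by (rule J_T_cong) (auto intro: inv_into_into f_inv_into_f)

lemma gen_tendsto_iff:
  assumes "x \<in> X" "y \<in> X"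
  shows "((\<lambda>h. N (sadd (sscale (1 / h) (sadd (T h x) (sscale (-1) x))) (sscale (-1) y))) \<longlongrightarrow> 0) (at_right 0)
    \<longleftrightarrow> ((\<lambda>h. (1 / h) *\<^sub>R (U h (J x) - J x)) \<longlongrightarrow> J y) (at_right 0)"
proof -
  have "N (sadd (sscale (1 / h) (sadd (T h x) (sscale (-1) x))) (sscale (-1) y))
      = norm ((1 / h) *\<^sub>R (U h (J x) - J x) - J y)" if h: "h > 0" for h
  proof -
    have Th: "T h x \<in> X" using T_X h assms by simp
    have d: "sadd (T h x) (sscale (-1) x) \<in> X" using Th assms(1) by (rule X_diff)
    show ?thesis using h assms
      by (simp only: N_diff[OF X_scale[OF d] assms(2)] J_scale[OF d] J_diff[OF Th assms(1)] U_J less_imp_le)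
  qed
  then have "((\<lambda>h. N (sadd (sscale (1 / h) (sadd (T h x) (sscale (-1) x))) (sscale (-1) y))) \<longlongrightarrow> 0) (at_right 0)
    \<longleftrightarrow> ((\<lambda>h. norm ((1 / h) *\<^sub>R (U h (J x) - J x) - J y)) \<longlongrightarrow> 0) (at_right 0)"
    by (intro filterlim_cong refl) (auto simp: eventually_at_filter)
  then show ?thesis by (simp only: tendsto_norm_zero_iff LIM_zero_iff)
qed

text \<open>The laws of \<open>T\<close> hold modulo \<open>N\<close>; under \<open>J\<close> they
  turn into the equations that the abstract setting asks for.\<close>

sublocale sg: C0_semigroup_on "J ` X" U
proof
  show "subspace (J ` X)" "closed (J ` X)" by (rule subspace_JX, rule closed_JX)
  show "U t x \<in> J ` X" if "0 \<le> t" "x \<in> J ` X" for t x using that by (auto simp: U_J T_X)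
  show "U t (x + c *\<^sub>R y) = U t x + c *\<^sub>R U t y" if t: "0 \<le> t" and S: "x \<in> J ` X" "y \<in> J ` X" for t x y c
  proof -
    obtain x' y' where xy: "x = J x'" "y = J y'" "x' \<in> X" "y' \<in> X" using S by blast
    have "x + c *\<^sub>R y = J (sadd x' (sscale c y'))" using xy by (simp add: J_add J_scale X_scale)
    then show ?thesis using t xy by (simp add: U_J X_add X_scale J_T_lin)
  qed
  show "\<exists>M. \<forall>x\<in>J ` X. norm (U t x) \<le> M * norm x" if "0 \<le> t" for t
    using T_bounded[OF that] that by (auto simp: U_J norm_J T_X)
  show "U 0 x = x" if S: "x \<in> J ` X" for x
  proof -
    obtain x' where x: "x = J x'" "x' \<in> X" using S by blast
    have "N (sadd (T 0 x') (sscale (-1) x')) = 0"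
      using T_gen x unfolding C0_semigroup_generated_by_def C0_semigroup_def by blast
    then show ?thesis using x by (simp add: N_diff T_X U_J)
  qed
  show "U (t + s) x = U t (U s x)" if t: "0 \<le> t" "0 \<le> s" and S: "x \<in> J ` X" for t s x
  proof -
    obtain x' where x: "x = J x'" "x' \<in> X" using S by blast
    have "N (sadd (T (t + s) x') (sscale (-1) (T t (T s x')))) = 0"
      using T_gen x t unfolding C0_semigroup_generated_by_def C0_semigroup_def by blast
    then show ?thesis using x t by (simp add: N_diff T_X U_J)
  qed
  show "((\<lambda>h. U h x) \<longlongrightarrow> x) (at_right 0)" if S: "x \<in> J ` X" for x
  proof -
    obtain x' where x: "x = J x'" "x' \<in> X" using S by blast
    have "((\<lambda>h. N (sadd (T h x') (sscale (-1) x'))) \<longlongrightarrow> 0) (at_right 0)"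
      using T_gen x unfolding C0_semigroup_generated_by_def C0_semigroup_def by blast
    moreover have "eventually (\<lambda>h. N (sadd (T h x') (sscale (-1) x')) = norm (U h x - x)) (at_right 0)"
      unfolding eventually_at_filter using x by (auto simp: N_diff T_X U_J)
    ultimately have "((\<lambda>h. norm (U h x - x)) \<longlongrightarrow> 0) (at_right 0)" by (rule Lim_transform_eventually)
    then show ?thesis by (simp only: tendsto_norm_zero_iff LIM_zero_iff)
  qed
qed

text \<open>This is the maximality clause of generation: a class with a right derivative at 0
  contains a state whose delay component lies in \<open>H1_01\<close> and has the prescribed value
  at 0.\<close>

lemma gen_representative:
  assumes "sg.gen x y"
  shows "\<exists>p\<in>D. J p = x \<and> J (A p) = y"
proof -
  obtain x' y' where xy: "x = J x'" "y = J y'" "x' \<in> X" "y' \<in> X"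
    using assms unfolding sg.gen_def by blast
  have "((\<lambda>h. N (sadd (sscale (1 / h) (sadd (T h x') (sscale (-1) x'))) (sscale (-1) y'))) \<longlongrightarrow> 0) (at_right 0)"
    using assms xy unfolding gen_tendsto_iff[OF xy(3,4)] sg.gen_def by simp
  then obtain p where p: "p \<in> D" "N (sadd x' (sscale (-1) p)) = 0" "N (sadd (A p) (sscale (-1) y')) = 0"
    using T_gen xy(3,4) unfolding C0_semigroup_generated_by_def by blast
  then show ?thesis using xy N_diff[OF xy(3) D_X[OF p(1)]] N_diff[OF A_X[OF p(1)] xy(4)] by auto
qed

text \<open>\<open>A (p t)\<close> contains the arbitrarily chosen \<open>H1_deriv\<close>, whose
  value at 0 means nothing. \<open>q t\<close> represents the same class but is taken from the
  domain, so its delay component has the traces that integration by parts needs.\<close>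

definition smooth_orbit :: "(real \<Rightarrow> ('h, 'h1) state) \<Rightarrow> (real \<Rightarrow> ('h, 'h1) state) \<Rightarrow> bool" where
  "smooth_orbit p q \<longleftrightarrow> (\<forall>t\<ge>0. p t \<in> D \<and> q t \<in> D \<and> J (A (p t)) = J (q t) \<and>
     ((\<lambda>s. J (p s)) has_vector_derivative J (A (p t))) (at t within {0..}) \<and>
     ((\<lambda>s. J (q s)) has_vector_derivative J (A (q t))) (at t within {0..}))"

lemma smooth_orbit_dense:
  assumes x: "x \<in> X" and e: "e > 0"
  shows "\<exists>p q. smooth_orbit p q \<and> norm (J (p 0) - J x) < e \<and> (\<forall>t\<ge>0. J (p t) = J (T t (p 0)))"
proof -
  obtain x' y z where g: "sg.gen x' y" "sg.gen y z" "norm (x' - J x) < e"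
    using sg.gen2_dense[OF _ e, of "J x"] x by blast
  \<comment> \<open>Representatives are chosen for each time separately; regularity in time belongs
    to the classes alone.\<close>
  have "\<exists>p\<in>D. J p = U t x' \<and> J (A p) = U t y" if "t \<ge> 0" for t
    using gen_representative[OF sg.gen_U[OF g(1) that]] .
  then obtain p where p: "\<And>t. t \<ge> 0 \<Longrightarrow> p t \<in> D" "\<And>t. t \<ge> 0 \<Longrightarrow> J (p t) = U t x'"
    "\<And>t. t \<ge> 0 \<Longrightarrow> J (A (p t)) = U t y" by metis
  have "\<exists>p\<in>D. J p = U t y \<and> J (A p) = U t z" if "t \<ge> 0" for t
    using gen_representative[OF sg.gen_U[OF g(2) that]] .
  then obtain q where q: "\<And>t. t \<ge> 0 \<Longrightarrow> q t \<in> D" "\<And>t. t \<ge> 0 \<Longrightarrow> J (q t) = U t y"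
    "\<And>t. t \<ge> 0 \<Longrightarrow> J (A (q t)) = U t z" by metis
  have dp: "((\<lambda>s. J (p s)) has_vector_derivative J (A (p t))) (at t within {0..})" if "t \<ge> 0" for t
    unfolding p(3)[OF that]
    by (rule has_vector_derivative_transform[OF _ _ sg.gen_deriv[OF g(1) that]]) (use that p(2) in auto)
  have dq: "((\<lambda>s. J (q s)) has_vector_derivative J (A (q t))) (at t within {0..})" if "t \<ge> 0" for t
    unfolding q(3)[OF that]
    by (rule has_vector_derivative_transform[OF _ _ sg.gen_deriv[OF g(2) that]]) (use that q(2) in auto)
  have "smooth_orbit p q" unfolding smooth_orbit_def using p q dp dq by simp
  moreover have p0: "J (p 0) = x'" using p(2)[of 0] sg.U_0 g(1) by (simp add: sg.gen_def)
  moreover have "J (p t) = J (T t (p 0))" if "t \<ge> 0" for t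
    using p(2)[OF that] U_J[OF that D_X[OF p(1)[of 0]]] p0 by simp
  ultimately show ?thesis using g(3) by blast
qed

end

section \<open>Moving weights and differential inequalities\<close>

text \<open>Gronwall's inequality for either sign of \<open>c\<close>: decay comes from
  \<open>c = - rate\<close>, bounded growth from \<open>c = 4 / a\<close>. The derivative is
  one-sided at time 0.\<close>

lemma differential_inequality:
  fixes f f' :: "real \<Rightarrow> real"
  assumes d: "\<And>s. t0 \<le> s \<Longrightarrow> s \<le> t1 \<Longrightarrow> (f has_real_derivative f' s) (at s within {0..})"
    and le: "\<And>s. t0 \<le> s \<Longrightarrow> s \<le> t1 \<Longrightarrow> f' s \<le> c * f s"
    and t: "0 \<le> t0" "t0 \<le> t1"
  shows "f t1 \<le> exp (c * (t1 - t0)) * f t0"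
proof -
  define g where "g s = exp (- c * s) * f s" for s
  have dg: "(g has_real_derivative exp (- c * s) * (f' s - c * f s)) (at s within {0..})"
    if "t0 \<le> s" "s \<le> t1" for s
    unfolding g_def by (rule derivative_eq_intros d that refl | simp add: algebra_simps)+
  have "g t1 \<le> g t0"
  proof (rule DERIV_nonpos_imp_decreasing_open[OF t(2)])
    fix x assume x: "t0 < x" "x < t1"
    have "at x within {0..} = at x" using x t by (intro at_within_interior) (simp add: interior_real_atLeast)
    then have "DERIV g x :> exp (- c * x) * (f' x - c * f x)" using dg[of x] x by simp
    moreover have "exp (- c * x) * (f' x - c * f x) \<le> 0"
      using le[of x] x by (intro mult_nonneg_nonpos) auto
    ultimately show "\<exists>y. DERIV g x :> y \<and> y \<le> 0" by blast
  next
    show "continuous_on {t0..t1} g"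
      unfolding continuous_on_eq_continuous_within
    proof
      fix x assume x: "x \<in> {t0..t1}"
      have "(g has_real_derivative exp (- c * x) * (f' x - c * f x)) (at x within {t0..t1})"
        by (rule DERIV_subset[OF dg]) (use x t in auto)
      then show "continuous (at x within {t0..t1}) g" by (rule DERIV_continuous)
    qed
  qed
  then have "exp (c * t1) * (exp (- c * t1) * f t1) \<le> exp (c * t1) * (exp (- c * t0) * f t0)"
    unfolding g_def by (intro mult_left_mono) auto
  moreover have "exp (c * t1) * exp (- c * t1) = 1" by (simp add: exp_minus_inverse)
  moreover have "exp (c * t1) * exp (- c * t0) = exp (c * (t1 - t0))"
    by (simp add: exp_add[symmetric] algebra_simps)
  ultimately show ?thesis by (simp only: mult.assoc[symmetric] mult_1)
qed

text \<open>The squared positive part has a Lipschitz derivative across its kink, so the Taylor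
  error is quadratic with a constant independent of \<open>x\<close>; this uniformity allows
  differentiation under the integral.\<close>

lemma max0_sq_increment: "\<bar>(max 0 (x + k))\<^sup>2 - (max 0 x)\<^sup>2 - 2 * k * max 0 x\<bar> \<le> k\<^sup>2" for x k :: real
proof (cases "x \<ge> 0")
  case x: True
  show ?thesis
  proof (cases "x + k \<ge> 0")
    case True
    then show ?thesis using x by (simp add: power2_sum max_def)
  next
    case False
    then have k: "x < - k" by simp
    have "0 \<le> x * (- k - x)" using x k by (intro mult_nonneg_nonneg) auto
    moreover have "0 \<le> (x + k)\<^sup>2" by simp
    moreover have "x\<^sup>2 + 2 * k * x \<le> k\<^sup>2" "- k\<^sup>2 \<le> x\<^sup>2 + 2 * k * x"
      using calculation x k mult_nonneg_nonpos[of x k] zero_le_square[of k]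
      by (auto simp: power2_eq_square algebra_simps)
    ultimately show ?thesis using x False by (simp add: max_def)
  qed
next
  case x: False
  show ?thesis
  proof (cases "x + k \<ge> 0")
    case True
    then have "(x + k)\<^sup>2 \<le> k\<^sup>2" using x by (intro power_mono) auto
    then show ?thesis using x True by (simp add: max_def)
  qed (use x in \<open>simp add: max_def\<close>)
qed

text \<open>Expands the square of \<open>sqrt B - 4 * k * sqrt A\<close>. The share of
  \<open>B\<close> is 1/8 for every \<open>k\<close>: three such errors will be charged to |w|^2,
  while \<open>A\<close> takes whatever constant results.\<close>

lemma amgm_weighted:
  fixes x A B k :: real
  assumes "\<bar>x\<bar> \<le> sqrt A * sqrt B" "A \<ge> 0" "B \<ge> 0" "k \<ge> 0"
  shows "k * \<bar>x\<bar> \<le> B / 8 + 2 * k\<^sup>2 * A"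
proof -
  have "0 \<le> (sqrt B - 4 * k * sqrt A)\<^sup>2 / 8" by simp
  also have "\<dots> = ((sqrt B)\<^sup>2 + 16 * k\<^sup>2 * (sqrt A)\<^sup>2) / 8 - k * (sqrt A * sqrt B)"
    by (simp add: power2_diff power_mult_distrib field_simps)
  also have "\<dots> = B / 8 + 2 * k\<^sup>2 * A - k * (sqrt A * sqrt B)" using assms by (simp add: field_simps)
  finally show ?thesis using mult_left_mono[OF assms(1,4)] by linarith
qed

context delayed_wave
begin

text \<open>Weight and state both move. Expanding the weight at time \<open>t\<close> leaves a
  frozen weight, which gives a \<open>bform\<close>, a term linear in \<open>s - t\<close>, and a
  remainder that is quadratic uniformly in \<open>\<rho>\<close>.\<close>

lemma moving_weight_deriv:
  assumes q: "\<And>s. 0 \<le> s \<Longrightarrow> q s \<in> X" and x: "x \<in> X" and t: "0 \<le> t" and \<tau>: "\<tau> > 0"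
    and d: "((\<lambda>s. J (q s)) has_vector_derivative J x) (at t within {0..})"
  shows "((\<lambda>s. wip (\<lambda>\<rho>. (max 0 (s / \<tau> - \<rho>))\<^sup>2) (snd (snd (q s))) (snd (snd (q s)))) has_real_derivative
      2 * wip (\<lambda>\<rho>. (max 0 (t / \<tau> - \<rho>))\<^sup>2) (snd (snd (q t))) (snd (snd x))
       + wip (\<lambda>\<rho>. 2 / \<tau> * max 0 (t / \<tau> - \<rho>)) (snd (snd (q t))) (snd (snd (q t)))) (at t within {0..})"
proof -
  let ?F = "at t within {0..}"
  define \<phi> where "\<phi> s \<rho> = (max 0 (s / \<tau> - \<rho>))\<^sup>2" for s \<rho> :: real
  \<comment> \<open>The time derivative of the weight at \<open>t\<close>.\<close>
  define \<eta> where "\<eta> \<rho> = 2 / \<tau> * max 0 (t / \<tau> - \<rho>)" for \<rho> :: real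
  define r where "r s \<rho> = \<phi> s \<rho> - \<phi> t \<rho> - (s - t) * \<eta> \<rho>" for s \<rho>
  define \<zeta> where "\<zeta> s = snd (snd (q s))" for s
  have c\<phi>: "continuous_on {0..1} (\<phi> s)" for s unfolding \<phi>_def by (intro continuous_intros)
  have c\<eta>: "continuous_on {0..1} \<eta>" unfolding \<eta>_def by (intro continuous_intros)
  have cr: "continuous_on {0..1} (r s)" for s unfolding r_def by (intro continuous_intros c\<phi> c\<eta>)
  have \<zeta>L: "\<zeta> s \<in> L2_01" if "0 \<le> s" for s
    using q[OF that] unfolding \<zeta>_def by (cases "q s") (simp add: in_X)
  have split: "wip (\<phi> s) (\<zeta> s) (\<zeta> s) = wip (\<phi> t) (\<zeta> s) (\<zeta> s) + (s - t) * wip \<eta> (\<zeta> s) (\<zeta> s) + wip (r s) (\<zeta> s) (\<zeta> s)"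
    if s: "0 \<le> s" for s
  proof -
    have "\<phi> s = (\<lambda>\<rho>. (\<phi> t \<rho> + (s - t) * \<eta> \<rho>) + 1 * r s \<rho>)" by (rule ext) (simp add: r_def)
    then have "wip (\<phi> s) (\<zeta> s) (\<zeta> s) = wip (\<lambda>\<rho>. (\<phi> t \<rho> + (s - t) * \<eta> \<rho>) + 1 * r s \<rho>) (\<zeta> s) (\<zeta> s)" by simp
    also have "\<dots> = wip (\<lambda>\<rho>. \<phi> t \<rho> + (s - t) * \<eta> \<rho>) (\<zeta> s) (\<zeta> s) + 1 * wip (r s) (\<zeta> s) (\<zeta> s)"
      by (rule wip_weight_lin[OF \<zeta>L[OF s] \<zeta>L[OF s]]) (intro continuous_intros c\<phi> c\<eta> cr)+
    also have "wip (\<lambda>\<rho>. \<phi> t \<rho> + (s - t) * \<eta> \<rho>) (\<zeta> s) (\<zeta> s) = wip (\<phi> t) (\<zeta> s) (\<zeta> s) + (s - t) * wip \<eta> (\<zeta> s) (\<zeta> s)"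
      by (rule wip_weight_lin[OF \<zeta>L[OF s] \<zeta>L[OF s] c\<phi> c\<eta>])
    finally show ?thesis by simp
  qed
  have dv: "((\<lambda>s. wip \<psi> (\<zeta> s) (\<zeta> s)) has_real_derivative 2 * wip \<psi> (\<zeta> t) (snd (snd x))) ?F"
    if "continuous_on {0..1} \<psi>" for \<psi>
    using bform_deriv[OF bform_delay[OF that] q x t d] by (simp add: \<zeta>_def)
  \<comment> \<open>The factor \<open>s - t\<close> vanishes at \<open>t\<close>, so the motion of
    \<open>\<zeta>\<close> does not contribute here.\<close>
  have d2: "((\<lambda>s. (s - t) * wip \<eta> (\<zeta> s) (\<zeta> s)) has_real_derivative wip \<eta> (\<zeta> t) (\<zeta> t)) ?F"
    by (rule derivative_eq_intros dv[OF c\<eta>] refl | simp)+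
  have rb: "\<bar>r s \<rho>\<bar> \<le> (s - t)\<^sup>2 / \<tau>\<^sup>2" for s \<rho>
    using max0_sq_increment[of "t / \<tau> - \<rho>" "(s - t) / \<tau>"] \<tau>
    by (simp add: r_def \<phi>_def \<eta>_def power_divide[symmetric] diff_divide_distrib algebra_simps)
  have d3: "((\<lambda>s. wip (r s) (\<zeta> s) (\<zeta> s)) has_real_derivative 0) ?F"
  proof -
    have cn: "((\<lambda>s. wip (\<lambda>_. 1) (\<zeta> s) (\<zeta> s)) \<longlongrightarrow> wip (\<lambda>_. 1) (\<zeta> t) (\<zeta> t)) ?F"
      using DERIV_continuous[OF dv[of "\<lambda>_. 1"]] by (simp add: continuous_within)
    have r0: "wip (r t) (\<zeta> t) (\<zeta> t) = 0" by (simp add: r_def wip_def)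
    have "((\<lambda>s. (1 / (s - t)) *\<^sub>R (wip (r s) (\<zeta> s) (\<zeta> s) - wip (r t) (\<zeta> t) (\<zeta> t))) \<longlongrightarrow> 0) ?F"
    proof (rule Lim_null_comparison)
      show "eventually (\<lambda>s. norm ((1 / (s - t)) *\<^sub>R (wip (r s) (\<zeta> s) (\<zeta> s) - wip (r t) (\<zeta> t) (\<zeta> t)))
          \<le> \<bar>s - t\<bar> / \<tau>\<^sup>2 * wip (\<lambda>_. 1) (\<zeta> s) (\<zeta> s)) ?F"
        unfolding eventually_at_filter
      proof (rule always_eventually, intro allI impI)
        fix s assume s: "s \<noteq> t" "s \<in> {0..}"
        have "\<bar>wip (r s) (\<zeta> s) (\<zeta> s)\<bar> \<le> (s - t)\<^sup>2 / \<tau>\<^sup>2 * sqrt (L2_norm2 (\<zeta> s)) * sqrt (L2_norm2 (\<zeta> s))"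
          using s by (intro wip_bound \<zeta>L cr rb) auto
        also have "\<dots> = (s - t)\<^sup>2 / \<tau>\<^sup>2 * wip (\<lambda>_. 1) (\<zeta> s) (\<zeta> s)" by (simp add: wip_1_same)
        finally have "\<bar>wip (r s) (\<zeta> s) (\<zeta> s)\<bar> / \<bar>s - t\<bar> \<le> (s - t)\<^sup>2 / \<tau>\<^sup>2 * wip (\<lambda>_. 1) (\<zeta> s) (\<zeta> s) / \<bar>s - t\<bar>"
          by (rule divide_right_mono) simp
        also have "(s - t)\<^sup>2 / \<tau>\<^sup>2 * wip (\<lambda>_. 1) (\<zeta> s) (\<zeta> s) / \<bar>s - t\<bar> = \<bar>s - t\<bar> / \<tau>\<^sup>2 * wip (\<lambda>_. 1) (\<zeta> s) (\<zeta> s)"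
        proof -
          define k where "k = \<bar>s - t\<bar>"
          have k: "k \<noteq> 0" "(s - t)\<^sup>2 = k * k" using s by (simp_all add: k_def power2_eq_square)
          show ?thesis unfolding k(2) k_def[symmetric] using k(1) by simp
        qed
        finally show "norm ((1 / (s - t)) *\<^sub>R (wip (r s) (\<zeta> s) (\<zeta> s) - wip (r t) (\<zeta> t) (\<zeta> t)))
          \<le> \<bar>s - t\<bar> / \<tau>\<^sup>2 * wip (\<lambda>_. 1) (\<zeta> s) (\<zeta> s)" by (simp add: r0)
      qed
      have "((\<lambda>s. \<bar>s - t\<bar> / \<tau>\<^sup>2 * wip (\<lambda>_. 1) (\<zeta> s) (\<zeta> s)) \<longlongrightarrow> \<bar>t - t\<bar> / \<tau>\<^sup>2 * wip (\<lambda>_. 1) (\<zeta> t) (\<zeta> t)) ?F"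
        using \<tau> by (intro tendsto_intros cn) auto
      then show "((\<lambda>s. \<bar>s - t\<bar> / \<tau>\<^sup>2 * wip (\<lambda>_. 1) (\<zeta> s) (\<zeta> s)) \<longlongrightarrow> 0) ?F" by simp
    qed
    then show ?thesis
      unfolding has_real_derivative_iff_has_vector_derivative has_vector_derivative_iff_quotient .
  qed
  have "((\<lambda>s. wip (\<phi> t) (\<zeta> s) (\<zeta> s) + (s - t) * wip \<eta> (\<zeta> s) (\<zeta> s) + wip (r s) (\<zeta> s) (\<zeta> s)) has_real_derivative
      2 * wip (\<phi> t) (\<zeta> t) (snd (snd x)) + wip \<eta> (\<zeta> t) (\<zeta> t) + 0) ?F"
    by (intro DERIV_add dv c\<phi> d2 d3)
  then have "((\<lambda>s. wip (\<phi> s) (\<zeta> s) (\<zeta> s)) has_real_derivative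
      2 * wip (\<phi> t) (\<zeta> t) (snd (snd x)) + wip \<eta> (\<zeta> t) (\<zeta> t)) ?F"
    unfolding add_0_right
    by (rule has_field_derivative_transform_within[where d=1]) (use t split in auto)
  then show ?thesis by (simp add: \<phi>_def[abs_def] \<eta>_def[abs_def] \<zeta>_def)
qed

end

section \<open>Weights in the delay variable\<close>

definition weight :: "(real \<Rightarrow> real) \<Rightarrow> (real \<Rightarrow> real) \<Rightarrow> bool" where
  "weight \<phi> \<phi>' \<longleftrightarrow> (\<forall>\<rho>\<in>{0..1}. (\<phi> has_real_derivative \<phi>' \<rho>) (at \<rho> within {0..1})) \<and> continuous_on {0..1} \<phi>'"

lemma weight_continuous: "weight \<phi> \<phi>' \<Longrightarrow> continuous_on {0..1} \<phi>"
  unfolding weight_def using DERIV_continuous_on by blast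

lemma weight_one: "weight (\<lambda>_. 1) (\<lambda>_. 0)"
  unfolding weight_def by (auto intro!: derivative_eq_intros)

lemma weight_linear: "weight (\<lambda>\<rho>. c - \<rho>) (\<lambda>_. - 1)"
  unfolding weight_def by (auto intro!: derivative_eq_intros)

text \<open>Squaring makes the positive part continuously differentiable at its kink, as
  \<open>weight\<close> demands.\<close>

lemma weight_max0_sq: "weight (\<lambda>\<rho>. (max 0 (c - \<rho>))\<^sup>2) (\<lambda>\<rho>. - 2 * max 0 (c - \<rho>))"
  unfolding weight_def
proof (intro conjI ballI)
  show "continuous_on {0..1} (\<lambda>\<rho>. - 2 * max 0 (c - \<rho>))" by (intro continuous_intros)
  fix \<rho> :: real
  show "((\<lambda>\<rho>. (max 0 (c - \<rho>))\<^sup>2) has_real_derivative - 2 * max 0 (c - \<rho>)) (at \<rho> within {0..1})"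
    unfolding has_real_derivative_iff_has_vector_derivative has_vector_derivative_iff_quotient
  proof (rule LIM_zero_cancel, rule Lim_null_comparison)
    show "eventually (\<lambda>s. norm ((1 / (s - \<rho>)) *\<^sub>R ((max 0 (c - s))\<^sup>2 - (max 0 (c - \<rho>))\<^sup>2) - - 2 * max 0 (c - \<rho>))
        \<le> \<bar>s - \<rho>\<bar>) (at \<rho> within {0..1})"
      unfolding eventually_at_filter
    proof (rule always_eventually, intro allI impI)
      fix s :: real assume s: "s \<noteq> \<rho>"
      have "\<bar>(max 0 (c - s))\<^sup>2 - (max 0 (c - \<rho>))\<^sup>2 + 2 * (s - \<rho>) * max 0 (c - \<rho>)\<bar> \<le> \<bar>s - \<rho>\<bar> * \<bar>s - \<rho>\<bar>"
        using max0_sq_increment[of "c - \<rho>" "\<rho> - s"] by (simp add: power2_eq_square algebra_simps)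
      then have "\<bar>(max 0 (c - s))\<^sup>2 - (max 0 (c - \<rho>))\<^sup>2 + 2 * (s - \<rho>) * max 0 (c - \<rho>)\<bar> / \<bar>s - \<rho>\<bar> \<le> \<bar>s - \<rho>\<bar>"
        using s by (simp add: divide_le_eq)
      moreover have "(1 / (s - \<rho>)) *\<^sub>R ((max 0 (c - s))\<^sup>2 - (max 0 (c - \<rho>))\<^sup>2) - - 2 * max 0 (c - \<rho>)
          = ((max 0 (c - s))\<^sup>2 - (max 0 (c - \<rho>))\<^sup>2 + 2 * (s - \<rho>) * max 0 (c - \<rho>)) / (s - \<rho>)"
        using s by (simp add: field_simps)
      ultimately show "norm ((1 / (s - \<rho>)) *\<^sub>R ((max 0 (c - s))\<^sup>2 - (max 0 (c - \<rho>))\<^sup>2) - - 2 * max 0 (c - \<rho>))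
        \<le> \<bar>s - \<rho>\<bar>" by (simp only: real_norm_def abs_divide)
    qed
    have "((\<lambda>s. \<bar>s - \<rho>\<bar>) \<longlongrightarrow> \<bar>\<rho> - \<rho>\<bar>) (at \<rho> within {0..1})" by (intro tendsto_intros)
    then show "((\<lambda>s. \<bar>s - \<rho>\<bar>) \<longlongrightarrow> 0) (at \<rho> within {0..1})" by simp
  qed
qed

section \<open>Derivatives along smooth orbits\<close>

context delayed_wave_semigroup
begin

text \<open>\<open>LM\<close> and \<open>LK\<close> are the coefficients of \<open>- (h, w)\<close> and of \<open>E + F\<close> in the Lyapunov functional: \<open>LM\<close> makes
  the \<open>y\<close> terms negative, and then \<open>LK\<close> absorbs the fluctuations \<open>\<delta>\<close> and makes the functional coercive.\<close>

definition \<theta> :: real where "\<theta> = 1 / C0\<^sup>2"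
definition LM :: real where "LM = 4 * (\<theta> + 2 * a\<^sup>2 + 2) / \<tau>"
definition LK :: real where
  "LK = 2 / \<tau> * (2 * \<tau>\<^sup>2 + 2 * LM\<^sup>2 + LM * \<tau> + 1) + (\<theta> + 2 + LM * \<tau> + LM / \<tau>)"

lemma constants_pos: "\<theta> > 0" "LM > 0" "LK > 0"
proof -
  show th: "\<theta> > 0" using C0_pos by (simp add: \<theta>_def)
  show M: "LM > 0" 
  proof -
    have "0 < \<theta> + 2 * a\<^sup>2 + 2" using th zero_le_power2[of a] by linarith
    then show ?thesis unfolding LM_def using tau_pos by (intro divide_pos_pos mult_pos_pos) auto
  qed
  show "LK > 0" unfolding LK_def using th M tau_pos
    by (intro add_pos_pos mult_pos_pos divide_pos_pos add_nonneg_pos add_nonneg_nonneg) auto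
qed

text \<open>\<open>LK\<close> adds up its requirements. The first bound lets the fluctuations absorb
  what is charged to them: \<open>2 * \<tau>\<^sup>2\<close> and \<open>2 * LM\<^sup>2\<close> from
  two Young errors, \<open>LM * \<tau>\<close> from the derivative of (h, w), and 1 to spare. The
  other two make the functional coercive in |w|^2 and F; \<open>\<theta>\<close> is the constant in
  |u|^2 \<le> \<theta> |w|^2.\<close>

lemma LK_bounds:
  "LK * \<tau> / 2 \<ge> 2 * \<tau>\<^sup>2 + 2 * LM\<^sup>2 + LM * \<tau> + 1" "LK \<ge> \<theta> + 2 + LM * \<tau>" "LK * \<tau>\<^sup>2 \<ge> LM * \<tau>"
proof -
  note pos = constants_pos tau_pos
  have r: "\<theta> + 2 + LM * \<tau> + LM / \<tau> \<ge> 0" using pos by (intro add_nonneg_nonneg) auto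
  have l: "2 / \<tau> * (2 * \<tau>\<^sup>2 + 2 * LM\<^sup>2 + LM * \<tau> + 1) \<ge> 0" using pos by (intro mult_nonneg_nonneg add_nonneg_nonneg) auto
  have "2 * \<tau>\<^sup>2 + 2 * LM\<^sup>2 + LM * \<tau> + 1 = 2 / \<tau> * (2 * \<tau>\<^sup>2 + 2 * LM\<^sup>2 + LM * \<tau> + 1) * (\<tau> / 2)"
    using pos by simp
  also have "\<dots> \<le> LK * (\<tau> / 2)" unfolding LK_def using r pos by (intro mult_right_mono) auto
  finally show "LK * \<tau> / 2 \<ge> 2 * \<tau>\<^sup>2 + 2 * LM\<^sup>2 + LM * \<tau> + 1" by simp
  have MT: "LM / \<tau> \<ge> 0" using pos by simp
  then show "LK \<ge> \<theta> + 2 + LM * \<tau>" unfolding LK_def using l by linarith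
  have "LM / \<tau> \<le> LK" unfolding LK_def using l pos by (smt (verit) divide_nonneg_pos mult_nonneg_nonneg)
  then have "LM / \<tau> * \<tau>\<^sup>2 \<le> LK * \<tau>\<^sup>2" by (intro mult_right_mono) auto
  then show "LK * \<tau>\<^sup>2 \<ge> LM * \<tau>" using pos by (simp add: power2_eq_square)
qed

text \<open>The letters \<open>Y\<close>, \<open>W\<close>, \<open>Vv\<close>, \<open>n\<close>,
  \<open>nz\<close>, \<open>Z1\<close> are the squared norms of y, w, v, zeta, z, z(1);
  \<open>c\<close> is (w, y); \<open>S1\<close> and \<open>S2\<close> pair zeta with y and w, and
  \<open>R1\<close> pairs it with y under the weight 1 - rho. Budget: \<open>LM * \<tau> / 4\<close>
  equals \<open>\<theta> + 2 * a\<^sup>2 + 2\<close>, which covers \<open>Vv\<close>, the Young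
  error of \<open>c\<close>, and a surplus of 2 in \<open>Y\<close>. \<open>W\<close> is lost with
  factor 1 and regained with 1/4 from the delay term and 3 * 1/8 from Young. The surplus in
  \<open>Y\<close> and \<open>\<delta>\<close> pays for \<open>n\<close>.\<close>

lemma lyapunov_dissipation:
  fixes Y W Vv n nz Z1 c S1 S2 R1 \<delta> :: real
  assumes \<delta>: "\<delta> = n - 2 * S1 + Y" and n: "n \<le> 2 * \<delta> + 2 * Y"
    and pos: "Y \<ge> 0" "\<delta> \<ge> 0" "Z1 \<ge> 0" "W \<ge> 0" "nz \<ge> 0"
    and Vv: "Vv \<le> \<theta> * Y" and c: "a * \<bar>c\<bar> \<le> W / 8 + 2 * a\<^sup>2 * Y"
    and S2: "\<tau> * \<bar>S2 - c\<bar> \<le> W / 8 + 2 * \<tau>\<^sup>2 * \<delta>" "LM * \<bar>S2 - c\<bar> \<le> W / 8 + 2 * LM\<^sup>2 * \<delta>"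
    and R1: "\<bar>R1 - Y / 2\<bar> \<le> Y / 4 + \<delta>"
  shows "LK * (- a * Y - (c - \<tau> * S1) + c + \<tau> / 2 * (Y - n)) + (Vv - a * c - (W - \<tau> * S2))
      - LM * (c + \<tau> * R1 - S2) + 1 / 8 * (2 * W - Z1 - nz) \<le> - (1 / 8) * (Y + n + W + nz)"
proof -
  note cpos = constants_pos tau_pos
  \<comment> \<open>The square is completed here: the product \<open>\<tau> * S1\<close>, the loss
    of \<open>n\<close> and half of \<open>\<tau> * Y\<close> combine to
    \<open>\<delta>\<close>.\<close>
  have 1: "LK * (- a * Y - (c - \<tau> * S1) + c + \<tau> / 2 * (Y - n)) = - (LK * ((a - \<tau>) * Y)) - LK * \<tau> / 2 * \<delta>"
    unfolding \<delta> by (simp add: field_simps)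
  have 2: "LK * ((a - \<tau>) * Y) \<ge> 0" using cpos tau_le pos by (intro mult_nonneg_nonneg) auto
  have 3: "LK * \<tau> / 2 * \<delta> \<ge> 2 * \<tau>\<^sup>2 * \<delta> + 2 * LM\<^sup>2 * \<delta> + LM * \<tau> * \<delta> + \<delta>"
    using mult_right_mono[OF LK_bounds(1) pos(2)] by (simp add: distrib_right)
  \<comment> \<open>Once \<open>S2\<close> is replaced by \<open>c\<close> up to fluctuation,
    \<open>c\<close> survives with the factor \<open>a - \<tau>\<close>, which lies between 0 and
    \<open>a\<close>.\<close>
  have "(a - \<tau>) * \<bar>c\<bar> \<le> a * \<bar>c\<bar>" using tau_pos by (intro mult_right_mono) auto
  then have "\<bar>(a - \<tau>) * c\<bar> \<le> W / 8 + 2 * a\<^sup>2 * Y" using c tau_le by (simp add: abs_mult)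
  then have 4: "- ((a - \<tau>) * c) \<le> W / 8 + 2 * a\<^sup>2 * Y" by linarith
  have "\<bar>\<tau> * (S2 - c)\<bar> \<le> W / 8 + 2 * \<tau>\<^sup>2 * \<delta>" using S2(1) tau_pos by (simp add: abs_mult)
  then have 5: "\<tau> * (S2 - c) \<le> W / 8 + 2 * \<tau>\<^sup>2 * \<delta>" by linarith
  have "\<bar>LM * (S2 - c)\<bar> \<le> W / 8 + 2 * LM\<^sup>2 * \<delta>" using S2(2) cpos by (simp add: abs_mult)
  then have 6: "LM * (S2 - c) \<le> W / 8 + 2 * LM\<^sup>2 * \<delta>" by linarith
  have "Y / 4 - \<delta> \<le> R1" using R1 by linarith
  then have "LM * \<tau> * (Y / 4 - \<delta>) \<le> LM * \<tau> * R1" using cpos by (intro mult_left_mono) auto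
  moreover have "LM * \<tau> = 4 * (\<theta> + 2 * a\<^sup>2 + 2)" using tau_pos by (simp add: LM_def)
  then have "LM * \<tau> * (Y / 4 - \<delta>) = \<theta> * Y + 2 * a\<^sup>2 * Y + 2 * Y - LM * \<tau> * \<delta>"
    by (simp add: algebra_simps)
  ultimately have 7: "\<theta> * Y + 2 * a\<^sup>2 * Y + 2 * Y - LM * \<tau> * \<delta> \<le> LM * \<tau> * R1" by simp
  have 8: "Vv - a * c - (W - \<tau> * S2) = Vv - W + - ((a - \<tau>) * c) + \<tau> * (S2 - c)" by (simp add: algebra_simps)
  have 9: "LM * (c + \<tau> * R1 - S2) = LM * \<tau> * R1 - LM * (S2 - c)" by (simp add: algebra_simps)
  have 10: "1 / 8 * (2 * W - Z1 - nz) = W / 4 - Z1 / 8 - nz / 8" by simp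
  have 11: "- (1 / 8) * (Y + n + W + nz) = - Y / 8 - n / 8 - W / 8 - nz / 8" by argo
  have "LK * (- a * Y - (c - \<tau> * S1) + c + \<tau> / 2 * (Y - n)) + (Vv - a * c - (W - \<tau> * S2))
      - LM * (c + \<tau> * R1 - S2) + 1 / 8 * (2 * W - Z1 - nz) \<le> - 2 * Y - \<delta> - 3 / 8 * W - 1 / 8 * nz"
    unfolding 1 8 9 10 using 2 3 4 5 6 7 Vv pos by linarith
  moreover note n
  ultimately show ?thesis unfolding 11 using pos by linarith
qed

section \<open>The operator on its domain\<close>

lemma A_apply: "A (u, v, z) = (v, - B (a *\<^sub>R Bs v + z 1), \<lambda>\<rho>. (- 1 / \<tau>) *\<^sub>R H1_deriv z \<rho>)"
  by (simp add: opA_def)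

lemma in_D: "(u, v, z) \<in> D \<longleftrightarrow> u \<in> V \<and> v \<in> V \<and> z \<in> H1_01 \<and> a *\<^sub>R Bs v + z 1 \<in> DB \<and> Bs u = z 0"
  by (simp add: opA_dom_def)

lemma H1_01_deriv: "z \<in> H1_01 \<Longrightarrow> is_H1_deriv z (H1_deriv z)"
  by (auto simp: H1_01_def H1_deriv_def intro: someI[of "is_H1_deriv z"])

lemma H1_01_L2: "z \<in> H1_01 \<Longrightarrow> z \<in> L2_01" "z \<in> H1_01 \<Longrightarrow> H1_deriv z \<in> L2_01"
  using H1_01_deriv[of z] by (auto simp: H1_01_def is_H1_deriv_def)

text \<open>In the energy estimates the derivative in the delay variable occurs only inside these
  pairings, where it is traded for traces and for the derivative of the weight.\<close>

lemma A_parts: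
  assumes x: "(u, v, z) \<in> D" and \<phi>: "weight \<phi> \<phi>'"
  shows "2 * wip \<phi> z (snd (snd (A (u, v, z)))) =
      - (1 / \<tau>) * (\<phi> 1 * (norm (z 1))\<^sup>2 - \<phi> 0 * (norm (z 0))\<^sup>2 - wip \<phi>' z z)"
    and "wip \<phi> (snd (snd (A (u, v, z)))) (\<lambda>_. e) =
      - (1 / \<tau>) * (\<phi> 1 * inner (z 1) e - \<phi> 0 * inner (z 0) e - wip \<phi>' z (\<lambda>_. e))"
proof -
  have z: "z \<in> H1_01" using x by (simp add: in_D)
  have w: "\<And>\<rho>. \<rho> \<in> {0..1} \<Longrightarrow> (\<phi> has_real_derivative \<phi>' \<rho>) (at \<rho> within {0..1})" "continuous_on {0..1} \<phi>'"
    using \<phi> by (auto simp: weight_def)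
  note parts = is_H1_deriv_parts[OF H1_01_L2(1)[OF z] H1_01_deriv[OF z] w]
  have 1: "wip \<phi> z (snd (snd (A (u, v, z)))) = - (1 / \<tau>) * wip \<phi> z (H1_deriv z)"
    unfolding A_apply snd_conv by (subst wip_scaleR_right) simp
  show "2 * wip \<phi> z (snd (snd (A (u, v, z)))) =
      - (1 / \<tau>) * (\<phi> 1 * (norm (z 1))\<^sup>2 - \<phi> 0 * (norm (z 0))\<^sup>2 - wip \<phi>' z z)"
  proof -
    have "\<phi> 1 * (norm (z 1))\<^sup>2 - \<phi> 0 * (norm (z 0))\<^sup>2 - wip \<phi>' z z = 2 * wip \<phi> z (H1_deriv z)"
      using parts(1) by linarith
    then show ?thesis unfolding 1 by simp
  qed
  have 2: "wip \<phi> (snd (snd (A (u, v, z)))) (\<lambda>_. e) = - (1 / \<tau>) * wip \<phi> (H1_deriv z) (\<lambda>_. e)"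
    unfolding A_apply snd_conv by (subst wip_scaleR_left) simp
  show "wip \<phi> (snd (snd (A (u, v, z)))) (\<lambda>_. e) =
      - (1 / \<tau>) * (\<phi> 1 * inner (z 1) e - \<phi> 0 * inner (z 0) e - wip \<phi>' z (\<lambda>_. e))"
  proof -
    have "\<phi> 1 * inner (z 1) e - \<phi> 0 * inner (z 0) e - wip \<phi>' z (\<lambda>_. e) = wip \<phi> (H1_deriv z) (\<lambda>_. e)"
      using parts(2)[of e] by linarith
    then show ?thesis unfolding 2 by simp
  qed
qed

lemma A_velocity:
  assumes x: "(u, v, z) \<in> D" and e: "e \<in> V"
  shows "inner e (fst (snd (A (u, v, z)))) = - inner (a *\<^sub>R Bs v + z 1) (Bs e)"
  using adj_prop[OF e, of "a *\<^sub>R Bs v + z 1"] x by (simp add: A_apply in_D inner_commute)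

text \<open>Equality of classes is exact in the first component, so the boundary condition of the
  domain transfers to \<open>\<zeta>\<close>; in the delay component it holds almost everywhere,
  which pairings do not notice.\<close>

lemma orbit_link:
  assumes x: "(u, v, z) \<in> D" and y: "(u', v', \<zeta>) \<in> D" and J: "J (A (u, v, z)) = J (u', v', \<zeta>)"
  shows "\<zeta> 0 = Bs v" and "continuous_on {0..1} \<phi> \<Longrightarrow> wip \<phi> \<zeta> (\<lambda>_. e) = wip \<phi> (snd (snd (A (u, v, z)))) (\<lambda>_. e)"
proof -
  let ?g = "\<lambda>\<rho>. (- 1 / \<tau>) *\<^sub>R H1_deriv z \<rho>"
  have eq: "v = u'" "L2_norm2 (\<lambda>\<rho>. ?g \<rho> - \<zeta> \<rho>) = 0"
    using J_eq_iff[of v "- B (a *\<^sub>R Bs v + z 1)" ?g u' v' \<zeta>] A_X[OF x] D_X[OF y] J by (simp_all add: A_apply)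
  then show "\<zeta> 0 = Bs v" using y by (simp add: in_D)
  assume \<phi>: "continuous_on {0..1} \<phi>"
  have zH: "z \<in> H1_01" using x by (simp add: in_D)
  have gL: "?g \<in> L2_01" by (rule L2_01_scaleR[OF H1_01_L2(2)[OF zH]])
  have \<zeta>H: "\<zeta> \<in> H1_01" using y by (simp add: in_D)
  have \<zeta>L: "\<zeta> \<in> L2_01" by (rule H1_01_L2(1)[OF \<zeta>H])
  obtain K where "K > 0" and K: "\<And>\<rho>. \<rho> \<in> {0..1} \<Longrightarrow> \<bar>\<phi> \<rho>\<bar> \<le> K" using weight_bound[OF \<phi>] by blast
  have "\<bar>wip \<phi> (\<lambda>\<rho>. ?g \<rho> - \<zeta> \<rho>) (\<lambda>_. e)\<bar> \<le> K * sqrt (L2_norm2 (\<lambda>\<rho>. ?g \<rho> - \<zeta> \<rho>)) * sqrt (L2_norm2 (\<lambda>_. e))"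
    by (rule wip_bound[OF L2_01_diff[OF gL \<zeta>L] L2_01_const \<phi> K])
  then have "wip \<phi> (\<lambda>\<rho>. ?g \<rho> - \<zeta> \<rho>) (\<lambda>_. e) = 0" using eq(2) by simp
  then show "wip \<phi> \<zeta> (\<lambda>_. e) = wip \<phi> (snd (snd (A (u, v, z)))) (\<lambda>_. e)"
    using wip_diff_left[OF gL \<zeta>L L2_01_const \<phi>, of e] by (simp add: A_apply)
qed

end

locale delayed_wave_orbit = delayed_wave_semigroup B DB C0 \<xi> a \<tau> T
  for B :: "'h1::{real_inner,banach} \<Rightarrow> 'h::{real_inner,banach}" and DB C0 \<xi> a \<tau> T +
  fixes p q :: "real \<Rightarrow> ('h, 'h1) state"
  assumes orb: "smooth_orbit p q"
begin


section \<open>Components of a smooth orbit\<close>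

definition pu where "pu t = fst (p t)"
definition pv where "pv t = fst (snd (p t))"
definition pz where "pz t = snd (snd (p t))"
definition \<zeta> where "\<zeta> t = snd (snd (q t))"

lemma p_eq: "p t = (pu t, pv t, pz t)"
  by (simp add: pu_def pv_def pz_def)

lemma q_eq: "q t = (fst (q t), fst (snd (q t)), \<zeta> t)"
  by (simp add: \<zeta>_def)

lemma orbit_D: "0 \<le> t \<Longrightarrow> p t \<in> D" "0 \<le> t \<Longrightarrow> q t \<in> D"
  using orb by (auto simp: smooth_orbit_def)

lemma orbit_dom:
  assumes t: "0 \<le> t"
  shows "pu t \<in> V" "pv t \<in> V" "pz t \<in> L2_01" "\<zeta> t \<in> L2_01" "pz t 0 = Bs (pu t)" "\<zeta> t 0 = Bs (pv t)"
proof -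
  have p: "(pu t, pv t, pz t) \<in> D" using orbit_D(1)[OF t] by (simp only: p_eq)
  have q: "(fst (q t), fst (snd (q t)), \<zeta> t) \<in> D" using orbit_D(2)[OF t] by (simp only: q_eq[symmetric])
  show "pu t \<in> V" "pv t \<in> V" "pz t \<in> L2_01" "\<zeta> t \<in> L2_01" "pz t 0 = Bs (pu t)"
    using p q H1_01_L2(1) by (auto simp: in_D)
  have "J (A (p t)) = J (q t)" using orb t by (auto simp: smooth_orbit_def)
  then show "\<zeta> t 0 = Bs (pv t)" using orbit_link(1)[OF p q] by (simp only: p_eq q_eq[symmetric])
qed

lemma fst_A: "0 \<le> t \<Longrightarrow> fst (A (p t)) = pv t"
  by (subst p_eq) (simp only: A_apply fst_conv)

lemma p_deriv:
  assumes t: "0 \<le> t" and b: "bform b"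
  shows "((\<lambda>s. b (p s) (p s)) has_real_derivative 2 * b (p t) (A (p t))) (at t within {0..})"
  by (rule bform_deriv[OF b]) (use t orb in \<open>auto simp: smooth_orbit_def intro: D_X A_X\<close>)

lemma q_deriv:
  assumes t: "0 \<le> t" and b: "bform b"
  shows "((\<lambda>s. b (q s) (q s)) has_real_derivative 2 * b (q t) (A (q t))) (at t within {0..})"
  by (rule bform_deriv[OF b]) (use t orb in \<open>auto simp: smooth_orbit_def intro: D_X A_X\<close>)

text \<open>Weight 1 keeps both traces and so expresses z(1) through zeta; the weight
  \<open>1 - \<rho>\<close> removes the trace at 1 and leaves the mean of z.\<close>

lemma \<zeta>_mean:
  assumes t: "0 \<le> t"
  shows "\<tau> * wip (\<lambda>_. 1) (\<zeta> t) (\<lambda>_. e) = inner (Bs (pu t)) e - inner (pz t 1) e"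
    and "\<tau> * wip (\<lambda>\<rho>. 1 - \<rho>) (\<zeta> t) (\<lambda>_. e) = inner (Bs (pu t)) e - wip (\<lambda>_. 1) (pz t) (\<lambda>_. e)"
proof -
  have p: "(pu t, pv t, pz t) \<in> D" using orbit_D(1)[OF t] by (simp only: p_eq)
  have q: "(fst (q t), fst (snd (q t)), \<zeta> t) \<in> D" using orbit_D(2)[OF t] by (simp only: q_eq[symmetric])
  have J: "J (A (pu t, pv t, pz t)) = J (fst (q t), fst (snd (q t)), \<zeta> t)"
    using orb t unfolding p_eq[symmetric] q_eq[symmetric] by (auto simp: smooth_orbit_def)
  have w0: "wip (\<lambda>_. 0) (pz t) (\<lambda>_. e) = 0" by (simp add: wip_def)
  have w1: "wip (\<lambda>_. - 1) (pz t) (\<lambda>_. e) = - wip (\<lambda>_. 1) (pz t) (\<lambda>_. e)" by (simp add: wip_def)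
  show "\<tau> * wip (\<lambda>_. 1) (\<zeta> t) (\<lambda>_. e) = inner (Bs (pu t)) e - inner (pz t 1) e"
    using tau_pos orbit_dom(5)[OF t] w0
    by (simp add: orbit_link(2)[OF p q J weight_continuous[OF weight_one]] A_parts(2)[OF p weight_one])
  show "\<tau> * wip (\<lambda>\<rho>. 1 - \<rho>) (\<zeta> t) (\<lambda>_. e) = inner (Bs (pu t)) e - wip (\<lambda>_. 1) (pz t) (\<lambda>_. e)"
    using tau_pos orbit_dom(5)[OF t] w1
    by (simp add: orbit_link(2)[OF p q J weight_continuous[OF weight_linear]] A_parts(2)[OF p weight_linear])
qed

section \<open>Derivatives of the single terms\<close>

lemma deriv_velocity:
  assumes t: "0 \<le> t"
  shows "((\<lambda>s. (norm (pv s))\<^sup>2) has_real_derivative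
      2 * (- a * (norm (Bs (pv t)))\<^sup>2 - inner (pz t 1) (Bs (pv t)))) (at t within {0..})"
proof -
  have p: "(pu t, pv t, pz t) \<in> D" using orbit_D(1)[OF t] by (simp only: p_eq)
  have "inner (pv t) (fst (snd (A (p t)))) = - inner (a *\<^sub>R Bs (pv t) + pz t 1) (Bs (pv t))"
    using A_velocity[OF p orbit_dom(2)[OF t]] by (simp only: p_eq[symmetric])
  also have "\<dots> = - a * (norm (Bs (pv t)))\<^sup>2 - inner (pz t 1) (Bs (pv t))"
    unfolding power2_norm_eq_inner inner_add_left inner_scaleR_left by simp
  finally have "2 * inner (fst (snd (p t))) (fst (snd (A (p t))))
      = 2 * (- a * (norm (Bs (pv t)))\<^sup>2 - inner (pz t 1) (Bs (pv t)))" by (simp only: pv_def)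
  then show ?thesis using p_deriv[OF t bform_velocity] unfolding power2_norm_eq_inner by (simp only: pv_def)
qed

lemma deriv_displacement:
  assumes t: "0 \<le> t"
  shows "((\<lambda>s. (norm (Bs (pu s)))\<^sup>2) has_real_derivative 2 * inner (Bs (pu t)) (Bs (pv t))) (at t within {0..})"
proof -
  show ?thesis using p_deriv[OF t bform_displacement]
    unfolding power2_norm_eq_inner fst_A[OF t] by (simp only: pu_def)
qed

lemma deriv_cross:
  assumes t: "0 \<le> t"
  shows "((\<lambda>s. inner (pu s) (pv s)) has_real_derivative
      (norm (pv t))\<^sup>2 - a * inner (Bs (pu t)) (Bs (pv t)) - inner (pz t 1) (Bs (pu t))) (at t within {0..})"
proof -
  have p: "(pu t, pv t, pz t) \<in> D" using orbit_D(1)[OF t] by (simp only: p_eq)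
  have "((\<lambda>s. 2 * inner (pu s) (pv s)) has_real_derivative
      2 * (inner (pu t) (fst (snd (A (p t)))) + inner (fst (A (p t))) (pv t))) (at t within {0..})"
    using p_deriv[OF t bform_cross] unfolding pu_def pv_def by simp
  moreover have "inner (pu t) (fst (snd (A (p t)))) + inner (fst (A (p t))) (pv t)
      = (norm (pv t))\<^sup>2 - a * inner (Bs (pu t)) (Bs (pv t)) - inner (pz t 1) (Bs (pu t))"
  proof -
    have "inner (pu t) (fst (snd (A (p t)))) = - inner (a *\<^sub>R Bs (pv t) + pz t 1) (Bs (pu t))"
      using A_velocity[OF p orbit_dom(1)[OF t]] by (simp only: p_eq[symmetric])
    then show ?thesis
      unfolding fst_A[OF t] power2_norm_eq_inner inner_add_left inner_scaleR_left inner_commute[of "Bs (pu t)"] by simp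
  qed
  ultimately have "((\<lambda>s. 2 * inner (pu s) (pv s)) has_real_derivative
      2 * ((norm (pv t))\<^sup>2 - a * inner (Bs (pu t)) (Bs (pv t)) - inner (pz t 1) (Bs (pu t)))) (at t within {0..})"
    by (simp only:)
  \<comment> \<open>Undoes the doubling by the symmetrized form.\<close>
  then have "((\<lambda>s. 1 / 2 * (2 * inner (pu s) (pv s))) has_real_derivative
      1 / 2 * (2 * ((norm (pv t))\<^sup>2 - a * inner (Bs (pu t)) (Bs (pv t)) - inner (pz t 1) (Bs (pu t))))) (at t within {0..})"
    by (rule DERIV_cmult)
  moreover have "1 / 2 * (2 * r) = r" for r :: real by simp
  ultimately show ?thesis by (simp only:)
qed

lemma deriv_delay:
  assumes t: "0 \<le> t" and \<phi>: "weight \<phi> \<phi>'"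
  shows "((\<lambda>s. wip \<phi> (pz s) (pz s)) has_real_derivative
      - (1 / \<tau>) * (\<phi> 1 * (norm (pz t 1))\<^sup>2 - \<phi> 0 * (norm (Bs (pu t)))\<^sup>2 - wip \<phi>' (pz t) (pz t))) (at t within {0..})"
proof -
  have p: "(pu t, pv t, pz t) \<in> D" using orbit_D(1)[OF t] by (simp only: p_eq)
  have "2 * wip \<phi> (pz t) (snd (snd (A (p t)))) =
      - (1 / \<tau>) * (\<phi> 1 * (norm (pz t 1))\<^sup>2 - \<phi> 0 * (norm (Bs (pu t)))\<^sup>2 - wip \<phi>' (pz t) (pz t))"
    using A_parts(1)[OF p \<phi>] by (simp only: p_eq[symmetric] orbit_dom(5)[OF t])
  then show ?thesis
    using p_deriv[OF t bform_delay[OF weight_continuous[OF \<phi>]]] by (simp only: pz_def)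
qed

lemma deriv_delay_cross:
  assumes t: "0 \<le> t"
  shows "((\<lambda>s. wip (\<lambda>_. 1) (pz s) (\<lambda>_. Bs (pu s))) has_real_derivative
      wip (\<lambda>_. 1) (pz t) (\<lambda>_. Bs (pv t)) + wip (\<lambda>_. 1) (\<zeta> t) (\<lambda>_. Bs (pu t))) (at t within {0..})"
proof -
  have p: "(pu t, pv t, pz t) \<in> D" using orbit_D(1)[OF t] by (simp only: p_eq)
  have q: "(fst (q t), fst (snd (q t)), \<zeta> t) \<in> D" using orbit_D(2)[OF t] by (simp only: q_eq[symmetric])
  have J: "J (A (pu t, pv t, pz t)) = J (fst (q t), fst (snd (q t)), \<zeta> t)"
    using orb t unfolding p_eq[symmetric] q_eq[symmetric] by (auto simp: smooth_orbit_def)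
  \<comment> \<open>Exchanges the delay component of \<open>A (p t)\<close> for the representative
    with traces.\<close>
  have l: "wip (\<lambda>_. 1) (snd (snd (A (p t)))) (\<lambda>_. Bs (pu t)) = wip (\<lambda>_. 1) (\<zeta> t) (\<lambda>_. Bs (pu t))"
    using orbit_link(2)[OF p q J weight_continuous[OF weight_one]] by (simp only: p_eq[symmetric])
  have "((\<lambda>s. 1 / 2 * (wip (\<lambda>_. 1) (snd (snd (p s))) (\<lambda>_. Bs (fst (p s))) + wip (\<lambda>_. 1) (snd (snd (p s))) (\<lambda>_. Bs (fst (p s)))))
      has_real_derivative 1 / 2 * (2 * (wip (\<lambda>_. 1) (snd (snd (p t))) (\<lambda>_. Bs (fst (A (p t))))
        + wip (\<lambda>_. 1) (snd (snd (A (p t)))) (\<lambda>_. Bs (fst (p t)))))) (at t within {0..})"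
    by (rule DERIV_cmult[OF p_deriv[OF t bform_delay_cross]])
  then have "((\<lambda>s. 1 / 2 * (wip (\<lambda>_. 1) (pz s) (\<lambda>_. Bs (pu s)) + wip (\<lambda>_. 1) (pz s) (\<lambda>_. Bs (pu s))))
      has_real_derivative 1 / 2 * (2 * (wip (\<lambda>_. 1) (pz t) (\<lambda>_. Bs (pv t)) + wip (\<lambda>_. 1) (\<zeta> t) (\<lambda>_. Bs (pu t)))))
      (at t within {0..})"
    unfolding fst_A[OF t] pz_def[symmetric] pu_def[symmetric] l .
  moreover have "1 / 2 * (2 * r) = r" "1 / 2 * (r + r) = r" for r :: real by simp_all
  ultimately show ?thesis by (simp only:)
qed

lemma deriv_rate:
  assumes t: "0 \<le> t" and \<phi>: "weight \<phi> \<phi>'"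
  shows "((\<lambda>s. wip \<phi> (\<zeta> s) (\<zeta> s)) has_real_derivative
      - (1 / \<tau>) * (\<phi> 1 * (norm (\<zeta> t 1))\<^sup>2 - \<phi> 0 * (norm (Bs (pv t)))\<^sup>2 - wip \<phi>' (\<zeta> t) (\<zeta> t))) (at t within {0..})"
proof -
  have q: "(fst (q t), fst (snd (q t)), \<zeta> t) \<in> D" using orbit_D(2)[OF t] by (simp only: q_eq[symmetric])
  have "2 * wip \<phi> (\<zeta> t) (snd (snd (A (q t)))) =
      - (1 / \<tau>) * (\<phi> 1 * (norm (\<zeta> t 1))\<^sup>2 - \<phi> 0 * (norm (Bs (pv t)))\<^sup>2 - wip \<phi>' (\<zeta> t) (\<zeta> t))"
    using A_parts(1)[OF q \<phi>] by (simp only: q_eq[symmetric] orbit_dom(6)[OF t])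
  then show ?thesis
    using q_deriv[OF t bform_delay[OF weight_continuous[OF \<phi>]]] by (simp only: \<zeta>_def)
qed

text \<open>The weight is constant along the characteristics of the transport equation, so its time
  derivative cancels the interior term exactly and only inflow and outflow at the two ends
  remain.\<close>

lemma deriv_moving_rate:
  assumes t: "0 \<le> t"
  shows "((\<lambda>s. wip (\<lambda>\<rho>. (max 0 (s / \<tau> - \<rho>))\<^sup>2) (\<zeta> s) (\<zeta> s)) has_real_derivative
      (1 / \<tau>) * ((t / \<tau>)\<^sup>2 * (norm (Bs (pv t)))\<^sup>2 - (max 0 (t / \<tau> - 1))\<^sup>2 * (norm (\<zeta> t 1))\<^sup>2)) (at t within {0..})"
proof -
  let ?c = "t / \<tau>"
  have q: "(fst (q t), fst (snd (q t)), \<zeta> t) \<in> D" using orbit_D(2)[OF t] by (simp only: q_eq[symmetric])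
  have d: "((\<lambda>s. wip (\<lambda>\<rho>. (max 0 (s / \<tau> - \<rho>))\<^sup>2) (\<zeta> s) (\<zeta> s)) has_real_derivative
      2 * wip (\<lambda>\<rho>. (max 0 (?c - \<rho>))\<^sup>2) (\<zeta> t) (snd (snd (A (q t))))
       + wip (\<lambda>\<rho>. 2 / \<tau> * max 0 (?c - \<rho>)) (\<zeta> t) (\<zeta> t)) (at t within {0..})"
    unfolding \<zeta>_def by (rule moving_weight_deriv) (use t tau_pos orb in \<open>auto simp: smooth_orbit_def intro: D_X A_X\<close>)
  have e: "wip (\<lambda>\<rho>. 2 / \<tau> * max 0 (?c - \<rho>)) (\<zeta> t) (\<zeta> t) = - (1 / \<tau>) * wip (\<lambda>\<rho>. - 2 * max 0 (?c - \<rho>)) (\<zeta> t) (\<zeta> t)"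
  proof -
    have "wip (\<lambda>\<rho>. 2 / \<tau> * max 0 (?c - \<rho>)) (\<zeta> t) (\<zeta> t)
        = (\<integral>\<rho>. - (1 / \<tau>) * (- 2 * max 0 (?c - \<rho>) * inner (\<zeta> t \<rho>) (\<zeta> t \<rho>)) \<partial>I01)"
      unfolding wip_def by (intro Bochner_Integration.integral_cong refl) simp
    also have "\<dots> = - (1 / \<tau>) * wip (\<lambda>\<rho>. - 2 * max 0 (?c - \<rho>)) (\<zeta> t) (\<zeta> t)"
      unfolding wip_def by (rule Bochner_Integration.integral_mult_right_zero)
    finally show ?thesis .
  qed
  have "2 * wip (\<lambda>\<rho>. (max 0 (?c - \<rho>))\<^sup>2) (\<zeta> t) (snd (snd (A (q t))))
       + wip (\<lambda>\<rho>. 2 / \<tau> * max 0 (?c - \<rho>)) (\<zeta> t) (\<zeta> t)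
      = (1 / \<tau>) * (?c\<^sup>2 * (norm (Bs (pv t)))\<^sup>2 - (max 0 (?c - 1))\<^sup>2 * (norm (\<zeta> t 1))\<^sup>2)"
    using A_parts(1)[OF q weight_max0_sq[of ?c]] t tau_pos
    unfolding e orbit_dom(6)[OF t] q_eq[symmetric] by (simp add: algebra_simps max_def)
  then show ?thesis using d by simp
qed

end

section \<open>The Lyapunov functional\<close>

context delayed_wave_orbit
begin

lemma bounds_at:
  assumes t: "0 \<le> t"
  defines "Y \<equiv> (norm (Bs (pv t)))\<^sup>2" and "W \<equiv> (norm (Bs (pu t)))\<^sup>2" and "Vv \<equiv> (norm (pv t))\<^sup>2"
    and "n \<equiv> L2_norm2 (\<zeta> t)" and "nz \<equiv> L2_norm2 (pz t)" and "F \<equiv> wip (\<lambda>\<rho>. 1 - \<rho>) (\<zeta> t) (\<zeta> t)"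
  shows "Vv \<le> \<theta> * Y" "\<bar>inner (pu t) (pv t)\<bar> \<le> \<theta> * W / 2 + Vv / 2"
    "0 \<le> F" "F \<le> n" "\<bar>wip (\<lambda>\<rho>. 1 - \<rho>) (\<zeta> t) (\<lambda>_. Bs (pu t))\<bar> \<le> F / 2 + W / 2"
    "nz \<le> wip (\<lambda>\<rho>. 2 - \<rho>) (pz t) (pz t)" "wip (\<lambda>\<rho>. 2 - \<rho>) (pz t) (pz t) \<le> 2 * nz"
    "(N (p t))\<^sup>2 = W + Vv + \<xi> * nz"
proof -
  note dom = orbit_dom[OF t]
  have sq: "(norm u)\<^sup>2 \<le> \<theta> * (norm (Bs u))\<^sup>2" if "u \<in> V" for u
    using power_mono[OF norm_le_norm_adj[OF that], of 2] by (simp add: \<theta>_def power_divide)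
  show "Vv \<le> \<theta> * Y" unfolding Vv_def Y_def by (rule sq[OF dom(2)])
  have "\<bar>inner (pu t) (pv t)\<bar> \<le> (norm (pu t))\<^sup>2 / 2 + (norm (pv t))\<^sup>2 / 2"
    using Cauchy_Schwarz_ineq2[of "pu t" "pv t"] sum_squares_bound[of "norm (pu t)" "norm (pv t)"] by linarith
  then show "\<bar>inner (pu t) (pv t)\<bar> \<le> \<theta> * W / 2 + Vv / 2"
    using sq[OF dom(1)] unfolding Vv_def W_def by linarith
  have c: "continuous_on {0..1} (\<lambda>\<rho>::real. 1 - \<rho>)" "continuous_on {0..1} (\<lambda>\<rho>::real. 2 - \<rho>)"
    "continuous_on {0..1} (\<lambda>\<rho>::real. 0::real)" "continuous_on {0..1} (\<lambda>\<rho>::real. 1::real)" by (intro continuous_intros)+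
  have nonneg: "0 \<le> wip (\<lambda>\<rho>. 1 - \<rho>) z z" if "z \<in> L2_01" for z :: "real \<Rightarrow> 'h1"
    using wip_mono[OF that c(3) c(1)] by (simp add: wip_def)
  show "0 \<le> F" unfolding F_def by (rule nonneg[OF dom(4)])
  show "F \<le> n" unfolding F_def n_def using wip_mono[OF dom(4) c(1) c(4)] by (simp add: wip_1_same)
  show "nz \<le> wip (\<lambda>\<rho>. 2 - \<rho>) (pz t) (pz t)"
    unfolding nz_def using wip_mono[OF dom(3) c(4) c(2)] by (simp add: wip_1_same)
  have "wip (\<lambda>\<rho>. 2 - \<rho>) (pz t) (pz t) \<le> wip (\<lambda>_. 2) (pz t) (pz t)" by (rule wip_mono[OF dom(3) c(2)]) auto
  also have "\<dots> = 2 * nz" by (simp add: wip_def nz_def L2_norm2_def power2_norm_eq_inner)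
  finally show "wip (\<lambda>\<rho>. 2 - \<rho>) (pz t) (pz t) \<le> 2 * nz" .
  \<comment> \<open>Positivity of the form with weight \<open>1 - \<rho>\<close> will be used at
    \<open>\<zeta> t\<close> plus and minus the constant w. This keeps \<open>F\<close> on the right
    of the cross estimate, where the unweighted bound would give \<open>n\<close>, which the
    functional does not control.\<close>
  have exp2: "wip (\<lambda>\<rho>. 1 - \<rho>) (\<lambda>\<rho>. \<zeta> t \<rho> + s *\<^sub>R Bs (pu t)) (\<lambda>\<rho>. \<zeta> t \<rho> + s *\<^sub>R Bs (pu t))
      = F + 2 * s * wip (\<lambda>\<rho>. 1 - \<rho>) (\<zeta> t) (\<lambda>_. Bs (pu t)) + s * s * wip (\<lambda>\<rho>. 1 - \<rho>) (\<lambda>_. Bs (pu t)) (\<lambda>_. Bs (pu t))" for s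
  proof -
    have k: "(\<lambda>_. s *\<^sub>R Bs (pu t)) \<in> L2_01" by (rule L2_01_const)
    show ?thesis
      using wip_scaleR_right[of "\<lambda>\<rho>. 1 - \<rho>" "\<zeta> t" s "\<lambda>_. Bs (pu t)"]
        wip_scaleR_left[of "\<lambda>\<rho>. 1 - \<rho>" s "\<lambda>_. Bs (pu t)" "\<lambda>_. s *\<^sub>R Bs (pu t)"]
        wip_scaleR_right[of "\<lambda>\<rho>. 1 - \<rho>" "\<lambda>_. Bs (pu t)" s "\<lambda>_. Bs (pu t)"]
        wip_sym[of "\<lambda>\<rho>. 1 - \<rho>" "\<lambda>_. s *\<^sub>R Bs (pu t)" "\<zeta> t"]
      by (simp add: wip_add_left[OF dom(4) k L2_01_add[OF dom(4) k] c(1)] wip_add_right[OF dom(4) k dom(4) c(1)]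
          wip_add_right[OF dom(4) k k c(1)] F_def)
  qed
  have "wip (\<lambda>\<rho>. 1 - \<rho>) (\<lambda>_. Bs (pu t)) (\<lambda>_. Bs (pu t)) \<le> wip (\<lambda>_. 1) (\<lambda>_. Bs (pu t)) (\<lambda>_. Bs (pu t))"
    by (rule wip_mono[OF L2_01_const c(1) c(4)]) auto
  also have "\<dots> = W" unfolding wip_1_same L2_norm2_const W_def ..
  finally have "wip (\<lambda>\<rho>. 1 - \<rho>) (\<lambda>_. Bs (pu t)) (\<lambda>_. Bs (pu t)) \<le> W" .
  then show "\<bar>wip (\<lambda>\<rho>. 1 - \<rho>) (\<zeta> t) (\<lambda>_. Bs (pu t))\<bar> \<le> F / 2 + W / 2"
    using exp2[of 1] exp2[of "-1"] nonneg[OF L2_01_add[OF dom(4) L2_01_const[of "1 *\<^sub>R Bs (pu t)"]]]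
      nonneg[OF L2_01_add[OF dom(4) L2_01_const[of "-1 *\<^sub>R Bs (pu t)"]]] by linarith
  show "(N (p t))\<^sup>2 = W + Vv + \<xi> * nz"
    using state_norm_sq[of "pu t" "pv t" "pz t"] by (simp only: p_eq[symmetric] W_def Vv_def nz_def)
qed

lemma fluctuation:
  assumes t: "0 \<le> t"
  defines "y \<equiv> Bs (pv t)" and "w \<equiv> Bs (pu t)" and "n \<equiv> L2_norm2 (\<zeta> t)"
  defines "\<delta> \<equiv> L2_norm2 (\<lambda>\<rho>. \<zeta> t \<rho> - y)"
  shows "\<delta> = n - 2 * wip (\<lambda>_. 1) (\<zeta> t) (\<lambda>_. y) + (norm y)\<^sup>2" "n \<le> 2 * \<delta> + 2 * (norm y)\<^sup>2"
    "\<bar>wip (\<lambda>_. 1) (\<zeta> t) (\<lambda>_. w) - inner w y\<bar> \<le> sqrt \<delta> * sqrt ((norm w)\<^sup>2)"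
    "\<bar>wip (\<lambda>\<rho>. 1 - \<rho>) (\<zeta> t) (\<lambda>_. y) - (norm y)\<^sup>2 / 2\<bar> \<le> (norm y)\<^sup>2 / 4 + \<delta>"
proof -
  note dom = orbit_dom[OF t]
  have yL: "(\<lambda>_. e) \<in> L2_01" for e :: 'h1 by (rule L2_01_const)
  have dL: "(\<lambda>\<rho>. \<zeta> t \<rho> - y) \<in> L2_01" by (rule L2_01_diff[OF dom(4) yL])
  have c1: "continuous_on {0..1} (\<lambda>\<rho>::real. 1::real)" and c2: "continuous_on {0..1} (\<lambda>\<rho>::real. 1 - \<rho>)"
    by (intro continuous_intros)+
  have yy: "wip (\<lambda>_. 1) (\<lambda>_. y) (\<lambda>_. e) = inner y e" for e
    unfolding wip_def mult_1 by (rule integral_I01_const)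
  have "\<delta> = wip (\<lambda>_. 1) (\<zeta> t) (\<lambda>\<rho>. \<zeta> t \<rho> - y) - wip (\<lambda>_. 1) (\<lambda>_. y) (\<lambda>\<rho>. \<zeta> t \<rho> - y)"
    unfolding \<delta>_def wip_1_same[symmetric] by (rule wip_diff_left[OF dom(4) yL dL c1])
  also have "wip (\<lambda>_. 1) (\<zeta> t) (\<lambda>\<rho>. \<zeta> t \<rho> - y) = n - wip (\<lambda>_. 1) (\<zeta> t) (\<lambda>_. y)"
    unfolding wip_sym[of _ "\<zeta> t" "\<lambda>\<rho>. \<zeta> t \<rho> - y"] wip_diff_left[OF dom(4) yL dom(4) c1] n_def wip_1_same
    by (simp add: wip_sym)
  also have "wip (\<lambda>_. 1) (\<lambda>_. y) (\<lambda>\<rho>. \<zeta> t \<rho> - y) = wip (\<lambda>_. 1) (\<zeta> t) (\<lambda>_. y) - (norm y)\<^sup>2"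
    unfolding wip_sym[of _ "\<lambda>_. y" "\<lambda>\<rho>. \<zeta> t \<rho> - y"] wip_diff_left[OF dom(4) yL yL c1] yy power2_norm_eq_inner ..
  finally show "\<delta> = n - 2 * wip (\<lambda>_. 1) (\<zeta> t) (\<lambda>_. y) + (norm y)\<^sup>2" by linarith
  show "n \<le> 2 * \<delta> + 2 * (norm y)\<^sup>2"
    using L2_norm2_add_le[OF dL yL[of y]] by (simp add: n_def \<delta>_def L2_norm2_const)
  have "wip (\<lambda>_. 1) (\<zeta> t) (\<lambda>_. w) - inner w y = wip (\<lambda>_. 1) (\<lambda>\<rho>. \<zeta> t \<rho> - y) (\<lambda>_. w)"
    unfolding wip_diff_left[OF dom(4) yL yL c1] yy by (simp add: inner_commute)
  then show "\<bar>wip (\<lambda>_. 1) (\<zeta> t) (\<lambda>_. w) - inner w y\<bar> \<le> sqrt \<delta> * sqrt ((norm w)\<^sup>2)"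
    using wip_bound[OF dL yL[of w] c1, of 1] by (simp add: \<delta>_def L2_norm2_const)
  \<comment> \<open>The mean of the weight, source of the factor one half in the last claim.\<close>
  have half: "integral\<^sup>L I01 (\<lambda>\<rho>. 1 - \<rho>) = 1 / 2"
  proof -
    have "((\<lambda>\<rho>::real. 1 - \<rho>) has_integral ((1 - 1\<^sup>2 / 2) - (0 - 0\<^sup>2 / 2))) {0..1}"
      by (rule fundamental_theorem_of_calculus)
        (auto intro!: derivative_eq_intros simp: has_real_derivative_iff_has_vector_derivative[symmetric])
    moreover have "integrable I01 (\<lambda>\<rho>::real. 1 - \<rho>)"
      using integrable_wip[OF L2_01_const[of "1::real"] L2_01_const[of "1::real"] c2] by simp
    ultimately show ?thesis
      using lebesgue_integral_eq_integral[of "{0..1}" "\<lambda>\<rho>::real. 1 - \<rho>"] by (simp add: integral_unique)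
  qed
  have "wip (\<lambda>\<rho>. 1 - \<rho>) (\<lambda>_. y) (\<lambda>_. y) = (norm y)\<^sup>2 / 2"
    unfolding wip_const_const[OF c2] half power2_norm_eq_inner by simp
  then have "wip (\<lambda>\<rho>. 1 - \<rho>) (\<zeta> t) (\<lambda>_. y) - (norm y)\<^sup>2 / 2 = wip (\<lambda>\<rho>. 1 - \<rho>) (\<lambda>\<rho>. \<zeta> t \<rho> - y) (\<lambda>_. y)"
    unfolding wip_diff_left[OF dom(4) yL yL c2] by simp
  also have "\<bar>\<dots>\<bar> \<le> 1 * sqrt \<delta> * sqrt ((norm y)\<^sup>2)"
    using wip_bound[OF dL yL[of y] c2, of 1] by (simp add: \<delta>_def L2_norm2_const)
  also have "\<dots> \<le> (norm y)\<^sup>2 / 4 + \<delta>"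
  proof -
    have "0 \<le> (norm y / 2 - sqrt \<delta>)\<^sup>2" by simp
    also have "\<dots> = (norm y)\<^sup>2 / 4 + (sqrt \<delta>)\<^sup>2 - sqrt \<delta> * norm y" by (simp add: power2_diff power_divide)
    finally show ?thesis by (simp add: \<delta>_def)
  qed
  finally show "\<bar>wip (\<lambda>\<rho>. 1 - \<rho>) (\<zeta> t) (\<lambda>_. y) - (norm y)\<^sup>2 / 2\<bar> \<le> (norm y)\<^sup>2 / 4 + \<delta>" .
qed


text \<open>The weight \<open>2 - \<rho>\<close> stays at least 1, so the last term controls the
  full delay norm; the factor \<open>\<tau> / 8\<close> limits its inflow to |w|^2 / 4, which the -
  |w|^2 from the derivative of (u, v) can afford.\<close>

definition lyapunov :: "real \<Rightarrow> real" where
  "lyapunov t = LK * (1 / 2 * (norm (pv t))\<^sup>2 + 1 / 2 * (norm (Bs (pu t)))\<^sup>2 + \<tau>\<^sup>2 / 2 * wip (\<lambda>\<rho>. 1 - \<rho>) (\<zeta> t) (\<zeta> t))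
     + inner (pu t) (pv t)
     - LM * ((norm (Bs (pu t)))\<^sup>2 - wip (\<lambda>_. 1) (pz t) (\<lambda>_. Bs (pu t)))
     + \<tau> / 8 * wip (\<lambda>\<rho>. 2 - \<rho>) (pz t) (pz t)"

lemma lyapunov_deriv:
  assumes t: "0 \<le> t"
  shows "\<exists>l. (lyapunov has_real_derivative l) (at t within {0..}) \<and>
    l \<le> - (1 / 8) * ((norm (Bs (pv t)))\<^sup>2 + L2_norm2 (\<zeta> t) + (norm (Bs (pu t)))\<^sup>2 + L2_norm2 (pz t))"
proof -
  let ?F = "at t within {0..}"
  let ?y = "Bs (pv t)" and ?w = "Bs (pu t)"
  define Y W Vv n nz Z1 c where "Y = (norm ?y)\<^sup>2" and "W = (norm ?w)\<^sup>2" and "Vv = (norm (pv t))\<^sup>2"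
    and "n = L2_norm2 (\<zeta> t)" and "nz = L2_norm2 (pz t)" and "Z1 = (norm (pz t 1))\<^sup>2" and "c = inner ?w ?y"
  define S1 S2 R1 \<delta> where "S1 = wip (\<lambda>_. 1) (\<zeta> t) (\<lambda>_. ?y)" and "S2 = wip (\<lambda>_. 1) (\<zeta> t) (\<lambda>_. ?w)"
    and "R1 = wip (\<lambda>\<rho>. 1 - \<rho>) (\<zeta> t) (\<lambda>_. ?y)" and "\<delta> = L2_norm2 (\<lambda>\<rho>. \<zeta> t \<rho> - ?y)"
  \<comment> \<open>From here on z(1) enters through pairings with zeta alone, apart from the
    favourable \<open>Z1\<close>.\<close>
  have z1y: "inner (pz t 1) ?y = c - \<tau> * S1" using \<zeta>_mean(1)[OF t, of ?y] by (simp add: c_def S1_def)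
  have z1w: "inner (pz t 1) ?w = W - \<tau> * S2"
    using \<zeta>_mean(1)[OF t, of ?w] by (simp add: W_def S2_def power2_norm_eq_inner)
  have zy: "wip (\<lambda>_. 1) (pz t) (\<lambda>_. ?y) = c - \<tau> * R1" using \<zeta>_mean(2)[OF t, of ?y] by (simp add: c_def R1_def)
  have d1: "((\<lambda>s. 1 / 2 * (norm (pv s))\<^sup>2) has_real_derivative 1 / 2 * (2 * (- a * Y - (c - \<tau> * S1)))) ?F"
    using DERIV_cmult[OF deriv_velocity[OF t], of "1 / 2"] by (simp only: Y_def z1y)
  have d2: "((\<lambda>s. 1 / 2 * (norm (Bs (pu s)))\<^sup>2) has_real_derivative 1 / 2 * (2 * c)) ?F"
    using DERIV_cmult[OF deriv_displacement[OF t], of "1 / 2"] by (simp only: c_def)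
  have m1: "wip (\<lambda>_. - 1) z z = - L2_norm2 z" for z :: "real \<Rightarrow> 'h1" unfolding wip_1_same[symmetric] by (simp add: wip_def)
  have d3: "((\<lambda>s. \<tau>\<^sup>2 / 2 * wip (\<lambda>\<rho>. 1 - \<rho>) (\<zeta> s) (\<zeta> s)) has_real_derivative \<tau>\<^sup>2 / 2 * (- (1 / \<tau>) * (n - Y))) ?F"
    using DERIV_cmult[OF deriv_rate[OF t weight_linear[of 1]], of "\<tau>\<^sup>2 / 2"] by (simp add: m1 n_def Y_def)
  have d4: "((\<lambda>s. inner (pu s) (pv s)) has_real_derivative Vv - a * c - (W - \<tau> * S2)) ?F"
    using deriv_cross[OF t] by (simp only: Vv_def c_def[symmetric] z1w)
  have d5: "((\<lambda>s. (norm (Bs (pu s)))\<^sup>2 - wip (\<lambda>_. 1) (pz s) (\<lambda>_. Bs (pu s))) has_real_derivative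
      2 * c - ((c - \<tau> * R1) + S2)) ?F"
    using DERIV_diff[OF deriv_displacement[OF t] deriv_delay_cross[OF t]] by (simp only: c_def[symmetric] zy S2_def[symmetric])
  have d6: "((\<lambda>s. \<tau> / 8 * wip (\<lambda>\<rho>. 2 - \<rho>) (pz s) (pz s)) has_real_derivative \<tau> / 8 * (- (1 / \<tau>) * (Z1 - 2 * W + nz))) ?F"
    using DERIV_cmult[OF deriv_delay[OF t weight_linear[of 2]], of "\<tau> / 8"] by (simp add: m1 nz_def W_def Z1_def)
  let ?l = "LK * (1 / 2 * (2 * (- a * Y - (c - \<tau> * S1))) + 1 / 2 * (2 * c) + \<tau>\<^sup>2 / 2 * (- (1 / \<tau>) * (n - Y)))
      + (Vv - a * c - (W - \<tau> * S2)) - LM * (2 * c - ((c - \<tau> * R1) + S2)) + \<tau> / 8 * (- (1 / \<tau>) * (Z1 - 2 * W + nz))"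
  have "(lyapunov has_real_derivative ?l) ?F"
    unfolding lyapunov_def[abs_def]
    by (rule DERIV_add DERIV_diff DERIV_cmult d1 d2 d3 d4 d5 d6)+
  moreover have "?l = LK * (- a * Y - (c - \<tau> * S1) + c + \<tau> / 2 * (Y - n)) + (Vv - a * c - (W - \<tau> * S2))
      - LM * (c + \<tau> * R1 - S2) + 1 / 8 * (2 * W - Z1 - nz)"
  proof -
    have "\<tau>\<^sup>2 / 2 * (- (1 / \<tau>) * (n - Y)) = \<tau> / 2 * (Y - n)" "\<tau> / 8 * (- (1 / \<tau>) * (Z1 - 2 * W + nz)) = 1 / 8 * (2 * W - Z1 - nz)"
      using tau_pos by (simp_all add: power2_eq_square field_simps)
    moreover have "2 * c - ((c - \<tau> * R1) + S2) = c + \<tau> * R1 - S2" "1 / 2 * (2 * c) = c"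
      "1 / 2 * (2 * (- a * Y - (c - \<tau> * S1))) = - a * Y - (c - \<tau> * S1)" by simp_all
    ultimately show ?thesis by (simp only:)
  qed
  moreover have "\<dots> \<le> - (1 / 8) * (Y + n + W + nz)"
  proof (rule lyapunov_dissipation)
    show "\<delta> = n - 2 * S1 + Y" unfolding \<delta>_def n_def S1_def Y_def by (rule fluctuation(1)[OF t])
    show "n \<le> 2 * \<delta> + 2 * Y" unfolding \<delta>_def n_def Y_def by (rule fluctuation(2)[OF t])
    have s: "\<bar>S2 - c\<bar> \<le> sqrt \<delta> * sqrt W" unfolding S2_def c_def \<delta>_def W_def by (rule fluctuation(3)[OF t])
    have pos: "0 \<le> \<delta>" "0 \<le> W" "0 \<le> Y" by (simp_all add: \<delta>_def W_def Y_def)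
    show "\<tau> * \<bar>S2 - c\<bar> \<le> W / 8 + 2 * \<tau>\<^sup>2 * \<delta>" by (rule amgm_weighted[OF s pos(1,2)]) (use tau_pos in simp)
    show "LM * \<bar>S2 - c\<bar> \<le> W / 8 + 2 * LM\<^sup>2 * \<delta>" by (rule amgm_weighted[OF s pos(1,2)]) (use constants_pos in simp)
    have "\<bar>c\<bar> \<le> sqrt Y * sqrt W"
      using Cauchy_Schwarz_ineq2[of ?w ?y] by (simp add: c_def Y_def W_def mult.commute)
    then show "a * \<bar>c\<bar> \<le> W / 8 + 2 * a\<^sup>2 * Y" by (rule amgm_weighted[OF _ pos(3,2)]) (use a_pos in simp)
    show "\<bar>R1 - Y / 2\<bar> \<le> Y / 4 + \<delta>" unfolding R1_def Y_def \<delta>_def by (rule fluctuation(4)[OF t])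
    show "Vv \<le> \<theta> * Y" unfolding Vv_def Y_def by (rule bounds_at(1)[OF t])
  qed (simp_all add: Y_def \<delta>_def Z1_def W_def nz_def)
  ultimately show ?thesis unfolding Y_def n_def W_def nz_def by auto
qed

text \<open>The product (u, v) is split between \<open>W\<close> and \<open>Vv\<close>, the
  \<open>LM\<close> term between \<open>F\<close> and \<open>W\<close>. All of \<open>F\<close> is
  offered against the \<open>LM\<close> term, so it is absent from the result.\<close>

lemma lyapunov_lower:
  assumes t: "0 \<le> t"
  shows "1 / 2 * (norm (pv t))\<^sup>2 + 1 / 2 * (norm (Bs (pu t)))\<^sup>2 + \<tau> / 8 * L2_norm2 (pz t) \<le> lyapunov t"
proof -
  define W Vv nz F R2 f where "W = (norm (Bs (pu t)))\<^sup>2" and "Vv = (norm (pv t))\<^sup>2" and "nz = L2_norm2 (pz t)"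
    and "F = wip (\<lambda>\<rho>. 1 - \<rho>) (\<zeta> t) (\<zeta> t)" and "R2 = wip (\<lambda>\<rho>. 1 - \<rho>) (\<zeta> t) (\<lambda>_. Bs (pu t))"
    and "f = wip (\<lambda>\<rho>. 2 - \<rho>) (pz t) (pz t)"
  note b = bounds_at[OF t, folded W_def Vv_def nz_def F_def R2_def f_def]
  have pos: "0 \<le> W" "0 \<le> Vv" "0 \<le> nz" by (simp_all add: W_def Vv_def nz_def)
  have h: "W - wip (\<lambda>_. 1) (pz t) (\<lambda>_. Bs (pu t)) = \<tau> * R2"
    using \<zeta>_mean(2)[OF t, of "Bs (pu t)"] by (simp add: W_def R2_def power2_norm_eq_inner)
  have L: "lyapunov t = LK * (1 / 2 * Vv + 1 / 2 * W + \<tau>\<^sup>2 / 2 * F) + inner (pu t) (pv t) - LM * (\<tau> * R2) + \<tau> / 8 * f"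
    unfolding lyapunov_def W_def[symmetric] h Vv_def F_def f_def ..
  have "LM * \<tau> * R2 \<le> LM * \<tau> * (F / 2 + W / 2)" using b(5) constants_pos tau_pos by (intro mult_left_mono) auto
  then have 1: "LM * (\<tau> * R2) \<le> LM * \<tau> * F / 2 + LM * \<tau> * W / 2" by (simp add: algebra_simps)
  have 2: "LM * \<tau> * F / 2 \<le> LK * (\<tau>\<^sup>2 / 2 * F)" using mult_right_mono[OF LK_bounds(3) b(3)] by simp
  have 3: "(\<theta> + 2 + LM * \<tau>) * (W / 2) \<le> LK * (W / 2)" by (rule mult_right_mono[OF LK_bounds(2)]) (use pos in simp)
  have "2 \<le> LK" using LK_bounds(2) constants_pos tau_pos mult_pos_pos[of LM \<tau>] by linarith
  then have 4: "2 * (Vv / 2) \<le> LK * (Vv / 2)" by (rule mult_right_mono) (use pos in simp)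
  have 5: "\<tau> / 8 * nz \<le> \<tau> / 8 * f" using b(6) tau_pos by (intro mult_left_mono) auto
  have 6: "(\<theta> + 2 + LM * \<tau>) * (W / 2) = \<theta> * W / 2 + W + LM * \<tau> * W / 2"
    "LK * (1 / 2 * Vv + 1 / 2 * W + \<tau>\<^sup>2 / 2 * F) = LK * (Vv / 2) + LK * (W / 2) + LK * (\<tau>\<^sup>2 / 2 * F)"
    by (simp_all add: algebra_simps)
  show ?thesis
    unfolding L 6(2) W_def[symmetric] Vv_def[symmetric] nz_def[symmetric]
    using 1 2 3[unfolded 6(1)] 4 5 b(2) pos by linarith
qed

end

section \<open>Exponential decay\<close>

context delayed_wave_semigroup
begin

definition LC :: real where "LC = LK * (1 + \<tau>\<^sup>2) + \<theta> + 1 + LM * \<tau> + \<tau>"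
text \<open>The loss is 1/8 of a sum containing |y|^2, while the functional is at most
  \<open>LC\<close> times a sum containing |v|^2; passing from one sum to the other costs
  \<open>\<theta> + 1\<close>.\<close>

definition rate :: real where "rate = 1 / (8 * (LC * (\<theta> + 1)))"
text \<open>The Gronwall factor over two delays, times a bound for \<open>early 0\<close> relative
  to the squared initial norm.\<close>

definition growth :: real where "growth = exp (4 / a * (2 * \<tau>)) * (1 / 2 + \<tau> / (a * \<xi>))"

lemma LC_pos: "LC > 0"
proof -
  have "LK * (1 + \<tau>\<^sup>2) \<ge> 0" "LM * \<tau> \<ge> 0" using constants_pos tau_pos by simp_all
  then show ?thesis unfolding LC_def using constants_pos tau_pos by linarith
qed

lemma rate_pos: "rate > 0"
  unfolding rate_def using LC_pos constants_pos by simp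

end

context delayed_wave_orbit
begin

text \<open>The right side contains \<open>L2_norm2 (\<zeta> t)\<close> besides the energy; the
  decay is therefore started at time \<open>2 * \<tau>\<close>, where that term has a bound.\<close>

lemma lyapunov_upper:
  assumes t: "0 \<le> t"
  shows "lyapunov t \<le> LC * ((norm (pv t))\<^sup>2 + L2_norm2 (\<zeta> t) + (norm (Bs (pu t)))\<^sup>2 + L2_norm2 (pz t))"
proof -
  define W Vv nz n F R2 f where "W = (norm (Bs (pu t)))\<^sup>2" and "Vv = (norm (pv t))\<^sup>2" and "nz = L2_norm2 (pz t)"
    and "n = L2_norm2 (\<zeta> t)"
    and "F = wip (\<lambda>\<rho>. 1 - \<rho>) (\<zeta> t) (\<zeta> t)" and "R2 = wip (\<lambda>\<rho>. 1 - \<rho>) (\<zeta> t) (\<lambda>_. Bs (pu t))"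
    and "f = wip (\<lambda>\<rho>. 2 - \<rho>) (pz t) (pz t)"
  note b = bounds_at[OF t, folded W_def Vv_def nz_def n_def F_def R2_def f_def]
  let ?S = "Vv + n + W + nz"
  have pos: "0 \<le> W" "0 \<le> Vv" "0 \<le> nz" "0 \<le> n" by (simp_all add: W_def Vv_def nz_def n_def)
  have h: "W - wip (\<lambda>_. 1) (pz t) (\<lambda>_. Bs (pu t)) = \<tau> * R2"
    using \<zeta>_mean(2)[OF t, of "Bs (pu t)"] by (simp add: W_def R2_def power2_norm_eq_inner)
  have L: "lyapunov t = LK * (1 / 2 * Vv + 1 / 2 * W + \<tau>\<^sup>2 / 2 * F) + inner (pu t) (pv t) - LM * \<tau> * R2 + \<tau> / 8 * f"
    unfolding lyapunov_def W_def[symmetric] h Vv_def F_def f_def by simp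
  have "1 / 2 * Vv + 1 / 2 * W + \<tau>\<^sup>2 / 2 * F \<le> ?S + \<tau>\<^sup>2 * ?S"
  proof (rule add_mono)
    show "1 / 2 * Vv + 1 / 2 * W \<le> ?S" using pos by linarith
    have "F / 2 \<le> ?S" using b(3,4) pos by linarith
    then show "\<tau>\<^sup>2 / 2 * F \<le> \<tau>\<^sup>2 * ?S" using mult_left_mono[of "F / 2" ?S "\<tau>\<^sup>2"] by simp
  qed
  then have 1: "LK * (1 / 2 * Vv + 1 / 2 * W + \<tau>\<^sup>2 / 2 * F) \<le> LK * (?S + \<tau>\<^sup>2 * ?S)"
    using constants_pos by (intro mult_left_mono) auto
  have 2: "inner (pu t) (pv t) \<le> \<theta> * ?S + ?S"
  proof -
    have "\<theta> * (W / 2) \<le> \<theta> * ?S" using constants_pos pos by (intro mult_left_mono) auto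
    then show ?thesis using b(2) pos by simp
  qed
  have 3: "- (LM * \<tau> * R2) \<le> LM * \<tau> * ?S"
  proof -
    have "- R2 \<le> ?S" using b(3,4,5) pos by linarith
    then have "LM * \<tau> * (- R2) \<le> LM * \<tau> * ?S" using constants_pos tau_pos by (intro mult_left_mono) auto
    then show ?thesis by simp
  qed
  have 4: "\<tau> / 8 * f \<le> \<tau> * ?S"
  proof -
    have "f / 8 \<le> ?S" using b(7) pos by linarith
    then show ?thesis using mult_left_mono[of "f / 8" ?S \<tau>] tau_pos by simp
  qed
  have "lyapunov t \<le> LK * (?S + \<tau>\<^sup>2 * ?S) + (\<theta> * ?S + ?S) + LM * \<tau> * ?S + \<tau> * ?S"
    unfolding L using 1 2 3 4 by linarith
  also have "\<dots> = LC * ?S" by (simp add: LC_def algebra_simps)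
  finally show ?thesis unfolding W_def Vv_def n_def nz_def .
qed

lemma lyapunov_decay:
  assumes t: "0 \<le> t0" "t0 \<le> t1"
  shows "lyapunov t1 \<le> exp (- rate * (t1 - t0)) * lyapunov t0"
proof -
  have "\<exists>l. (lyapunov has_real_derivative l) (at s within {0..}) \<and> l \<le> - rate * lyapunov s" if s: "0 \<le> s" for s
  proof -
    let ?S = "(norm (Bs (pv s)))\<^sup>2 + L2_norm2 (\<zeta> s) + (norm (Bs (pu s)))\<^sup>2 + L2_norm2 (pz s)"
    obtain l where l: "(lyapunov has_real_derivative l) (at s within {0..})" "l \<le> - (1 / 8) * ?S"
      using lyapunov_deriv[OF s] by blast
    have "(norm (pv s))\<^sup>2 + L2_norm2 (\<zeta> s) + (norm (Bs (pu s)))\<^sup>2 + L2_norm2 (pz s) \<le> (\<theta> + 1) * ?S"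
    proof -
      have "\<theta> * (norm (Bs (pv s)))\<^sup>2 \<le> \<theta> * ?S" using constants_pos by (intro mult_left_mono) auto
      then have "(norm (pv s))\<^sup>2 \<le> \<theta> * ?S" using bounds_at(1)[OF s] by linarith
      moreover have "(\<theta> + 1) * ?S = \<theta> * ?S + ?S" by (simp add: algebra_simps)
      moreover have "L2_norm2 (\<zeta> s) + (norm (Bs (pu s)))\<^sup>2 + L2_norm2 (pz s) \<le> ?S" by simp
      ultimately show ?thesis by linarith
    qed
    then have "LC * ((norm (pv s))\<^sup>2 + L2_norm2 (\<zeta> s) + (norm (Bs (pu s)))\<^sup>2 + L2_norm2 (pz s)) \<le> LC * ((\<theta> + 1) * ?S)"
      using LC_pos by (intro mult_left_mono) auto
    then have "lyapunov s \<le> LC * (\<theta> + 1) * ?S" using lyapunov_upper[OF s] by simp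
    then have "rate * lyapunov s \<le> rate * (LC * (\<theta> + 1) * ?S)" using rate_pos by (intro mult_left_mono) auto
    also have "\<dots> = 1 / 8 * ?S" unfolding rate_def using LC_pos constants_pos by simp
    finally have "rate * lyapunov s \<le> 1 / 8 * ?S" .
    then have "l \<le> - rate * lyapunov s" using l(2) by argo
    with l(1) show ?thesis by blast
  qed
  then have "\<forall>s\<in>{0..}. \<exists>l. (lyapunov has_real_derivative l) (at s within {0..}) \<and> l \<le> - rate * lyapunov s" by simp
  then obtain l where "\<forall>s\<in>{0..}. (lyapunov has_real_derivative l s) (at s within {0..}) \<and> l s \<le> - rate * lyapunov s"
    by (rule bchoice[THEN exE])
  then show ?thesis using t by (intro differential_inequality[where f' = l]) auto
qed

text \<open>At time 0 the travelling weight vanishes on \<open>[0, 1]\<close>, at time \<open>2\<tau>\<close> it is at least 1 there.\<close>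

definition early :: "real \<Rightarrow> real" where
  "early t = a * \<tau> / 16 * wip (\<lambda>\<rho>. (max 0 (t / \<tau> - \<rho>))\<^sup>2) (\<zeta> t) (\<zeta> t)
     + 1 / 2 * (norm (pv t))\<^sup>2 + 1 / 2 * (norm (Bs (pu t)))\<^sup>2 + \<tau> / a * wip (\<lambda>_. 1) (pz t) (pz t)"

section \<open>Smoothing on the first two delay intervals\<close>

lemma early_nonneg_weight:
  assumes t: "0 \<le> t" shows "0 \<le> wip (\<lambda>\<rho>. (max 0 (t / \<tau> - \<rho>))\<^sup>2) (\<zeta> t) (\<zeta> t)"
proof -
  have "wip (\<lambda>_. 0) (\<zeta> t) (\<zeta> t) \<le> wip (\<lambda>\<rho>. (max 0 (t / \<tau> - \<rho>))\<^sup>2) (\<zeta> t) (\<zeta> t)"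
    by (rule wip_mono[OF orbit_dom(4)[OF t]]) (auto intro!: continuous_intros)
  then show ?thesis by (simp add: wip_def)
qed

text \<open>Up to time \<open>2 * \<tau>\<close> the weight at rho = 0 is at most 4, so the factor
  \<open>a * \<tau> / 16\<close> makes the inflow at most a |y|^2 / 4. Young charges another a |y|^2
  / 4 to each of (w, y) and (z(1), y), and the viscous term covers the sum. The |z(1)|^2 / a left by
  Young is cancelled by the outflow of the last term; the remaining 2 |w|^2 / a is at most
  \<open>4 / a\<close> times \<open>early\<close>.\<close>

lemma early_growth:
  assumes t: "0 \<le> t" "t \<le> 2 * \<tau>"
  shows "early t \<le> exp (4 / a * t) * early 0"
proof -
  have main: "\<exists>l. (early has_real_derivative l) (at s within {0..}) \<and> (s \<le> 2 * \<tau> \<longrightarrow> l \<le> 4 / a * early s)" if s: "0 \<le> s" for s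
  proof -
    define Y W Z1 c zy m where "Y = (norm (Bs (pv s)))\<^sup>2" and "W = (norm (Bs (pu s)))\<^sup>2" and "Z1 = (norm (pz s 1))\<^sup>2"
      and "c = inner (Bs (pu s)) (Bs (pv s))" and "zy = inner (pz s 1) (Bs (pv s))"
      and "m = (max 0 (s / \<tau> - 1))\<^sup>2 * (norm (\<zeta> s 1))\<^sup>2"
    have am: "x * y \<le> a * y\<^sup>2 / 4 + x\<^sup>2 / a" for x y :: real
    proof -
      have "0 \<le> (a * y / 2 - x)\<^sup>2 / a" using a_pos by simp
      also have "\<dots> = a * y\<^sup>2 / 4 + x\<^sup>2 / a - x * y" using a_pos by (simp add: power2_eq_square field_simps)
      finally show ?thesis by simp
    qed
    have cb: "c \<le> a * Y / 4 + W / a"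
      using norm_cauchy_schwarz[of "Bs (pu s)" "Bs (pv s)"] am[of "norm (Bs (pu s))" "norm (Bs (pv s))"]
      unfolding c_def Y_def W_def by linarith
    have zb: "- zy \<le> a * Y / 4 + Z1 / a"
      using Cauchy_Schwarz_ineq2[of "pz s 1" "Bs (pv s)"] am[of "norm (pz s 1)" "norm (Bs (pv s))"]
      unfolding zy_def Y_def Z1_def by linarith
    have w0: "wip (\<lambda>_. 0) (pz s) (pz s) = 0" by (simp add: wip_def)
    let ?l = "a * \<tau> / 16 * ((1 / \<tau>) * ((s / \<tau>)\<^sup>2 * Y - m)) + 1 / 2 * (2 * (- a * Y - zy)) + 1 / 2 * (2 * c)
        + \<tau> / a * (- (1 / \<tau>) * (Z1 - W))"
    have d4: "((\<lambda>s. \<tau> / a * wip (\<lambda>_. 1) (pz s) (pz s)) has_real_derivative \<tau> / a * (- (1 / \<tau>) * (Z1 - W))) (at s within {0..})"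
      using DERIV_cmult[OF deriv_delay[OF s weight_one], of "\<tau> / a"] by (simp add: w0 Z1_def W_def)
    have d: "(early has_real_derivative ?l) (at s within {0..})"
      unfolding early_def[abs_def] Y_def m_def zy_def c_def
      by (rule DERIV_add DERIV_cmult deriv_moving_rate[OF s] deriv_velocity[OF s] deriv_displacement[OF s] d4)+
    have "?l \<le> 4 / a * early s" if s2: "s \<le> 2 * \<tau>"
    proof -
      have "(s / \<tau>)\<^sup>2 \<le> 2\<^sup>2" using s s2 tau_pos by (intro power_mono) (auto simp: field_simps)
      then have "(s / \<tau>)\<^sup>2 * Y \<le> 4 * Y" by (intro mult_right_mono) (auto simp: Y_def)
      moreover have "0 \<le> m" by (simp add: m_def)
      ultimately have "a / 16 * ((s / \<tau>)\<^sup>2 * Y - m) \<le> a / 16 * (4 * Y)" using a_pos by (intro mult_left_mono) auto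
      then have 1: "a * \<tau> / 16 * ((1 / \<tau>) * ((s / \<tau>)\<^sup>2 * Y - m)) \<le> a * Y / 4" using tau_pos by (simp add: ac_simps)
      have 2: "\<tau> / a * (- (1 / \<tau>) * (Z1 - W)) = W / a - Z1 / a" using tau_pos a_pos by (simp add: field_simps)
      have 3: "0 \<le> a * Y" using a_pos by (simp add: Y_def)
      have 4: "1 / 2 * (2 * (- a * Y - zy)) = - (a * Y) - zy" "1 / 2 * (2 * c) = c" by simp_all
      have 5: "?l \<le> W / a + W / a" unfolding 2 4 using 1 3 cb zb by linarith
      have "1 / 2 * W \<le> early s"
        using early_nonneg_weight[OF s] a_pos tau_pos
        unfolding early_def W_def wip_1_same by (simp add: add_nonneg_nonneg)
      then have "4 / a * (1 / 2 * W) \<le> 4 / a * early s" using a_pos by (intro mult_left_mono) auto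
      moreover have "4 / a * (1 / 2 * W) = W / a + W / a" by simp
      ultimately show ?thesis using 5 by linarith
    qed
    with d show ?thesis by blast
  qed
  then have "\<forall>s\<in>{0..}. \<exists>l. (early has_real_derivative l) (at s within {0..}) \<and> (s \<le> 2 * \<tau> \<longrightarrow> l \<le> 4 / a * early s)" by simp
  then obtain l where l: "\<forall>s\<in>{0..}. (early has_real_derivative l s) (at s within {0..}) \<and> (s \<le> 2 * \<tau> \<longrightarrow> l s \<le> 4 / a * early s)"
    by (rule bchoice[THEN exE])
  have "early t \<le> exp (4 / a * (t - 0)) * early 0"
    by (rule differential_inequality[where f' = l]) (use l t in auto)
  then show ?thesis by simp
qed

lemma early_bound:
  assumes t: "0 \<le> t" "t \<le> 2 * \<tau>"
  shows "early t \<le> growth * (N (p 0))\<^sup>2"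
proof -
  note b = bounds_at(8)[of 0]
  have "wip (\<lambda>\<rho>. (max 0 (0 / \<tau> - \<rho>))\<^sup>2) (\<zeta> 0) (\<zeta> 0) = 0"
    unfolding wip_def by (rule integral_eq_zero_AE, rule AE_I2) simp
  then have "early 0 = 1 / 2 * ((norm (pv 0))\<^sup>2 + (norm (Bs (pu 0)))\<^sup>2) + \<tau> / (a * \<xi>) * (\<xi> * L2_norm2 (pz 0))"
    unfolding early_def wip_1_same using xi_pos by (simp add: algebra_simps)
  also have "\<dots> \<le> 1 / 2 * (N (p 0))\<^sup>2 + \<tau> / (a * \<xi>) * (N (p 0))\<^sup>2"
    using b xi_pos tau_pos a_pos by (intro add_mono mult_left_mono) auto
  finally have e0: "early 0 \<le> (1 / 2 + \<tau> / (a * \<xi>)) * (N (p 0))\<^sup>2" by (simp add: distrib_right)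
  have nn: "0 \<le> (1 / 2 + \<tau> / (a * \<xi>)) * (N (p 0))\<^sup>2" using xi_pos tau_pos a_pos by simp
  have "early t \<le> exp (4 / a * t) * ((1 / 2 + \<tau> / (a * \<xi>)) * (N (p 0))\<^sup>2)"
    using early_growth[OF t] by (rule order_trans) (rule mult_left_mono[OF e0], simp)
  also have "\<dots> \<le> exp (4 / a * (2 * \<tau>)) * ((1 / 2 + \<tau> / (a * \<xi>)) * (N (p 0))\<^sup>2)"
    using t a_pos nn by (intro mult_right_mono) (auto simp: divide_right_mono)
  finally show ?thesis by (simp add: growth_def)
qed

text \<open>Bridges the time before the decay of the functional sets in, with the same quantity that
  does the smoothing.\<close>

lemma orbit_early:
  assumes t: "0 \<le> t" "t \<le> 2 * \<tau>"
  shows "(N (p t))\<^sup>2 \<le> (2 + \<xi> * a / \<tau>) * (growth * (N (p 0))\<^sup>2)"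
proof -
  define W Vv nz Q where "W = (norm (Bs (pu t)))\<^sup>2" and "Vv = (norm (pv t))\<^sup>2" and "nz = L2_norm2 (pz t)"
    and "Q = wip (\<lambda>\<rho>. (max 0 (t / \<tau> - \<rho>))\<^sup>2) (\<zeta> t) (\<zeta> t)"
  have Q: "0 \<le> a * \<tau> / 16 * Q" using early_nonneg_weight[OF t(1)] a_pos tau_pos unfolding Q_def by simp
  have pos: "0 \<le> W" "0 \<le> Vv" "0 \<le> \<tau> / a * nz" using tau_pos a_pos by (simp_all add: W_def Vv_def nz_def)
  have e: "early t = a * \<tau> / 16 * Q + 1 / 2 * Vv + 1 / 2 * W + \<tau> / a * nz"
    unfolding early_def wip_1_same W_def Vv_def nz_def Q_def ..
  have "W + Vv \<le> 2 * early t" unfolding e using Q pos by argo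
  moreover have nz: "\<tau> / a * nz \<le> early t" unfolding e using Q pos by argo
  moreover have "\<xi> * nz = \<xi> * a / \<tau> * (\<tau> / a * nz)" using tau_pos a_pos by simp
  moreover have "\<xi> * a / \<tau> * (\<tau> / a * nz) \<le> \<xi> * a / \<tau> * early t"
    using nz xi_pos a_pos tau_pos by (intro mult_left_mono) auto
  moreover have "(2 + \<xi> * a / \<tau>) * early t = 2 * early t + \<xi> * a / \<tau> * early t" by (simp add: distrib_right)
  ultimately have "(N (p t))\<^sup>2 \<le> (2 + \<xi> * a / \<tau>) * early t"
    using bounds_at(8)[OF t(1)] unfolding W_def Vv_def nz_def by linarith
  also have "\<dots> \<le> (2 + \<xi> * a / \<tau>) * (growth * (N (p 0))\<^sup>2)"
    using early_bound[OF t] xi_pos a_pos tau_pos by (intro mult_left_mono) auto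
  finally show ?thesis .
qed

text \<open>The three coefficients recover the parts of \<open>early\<close>: 2 for
  \<open>W + Vv\<close>, \<open>16 / (a * \<tau>)\<close> for \<open>n\<close> and
  \<open>a / \<tau>\<close> for \<open>nz\<close>.\<close>

lemma lyapunov_initial:
  "lyapunov (2 * \<tau>) \<le> LC * ((2 + 16 / (a * \<tau>) + a / \<tau>) * (growth * (N (p 0))\<^sup>2))"
proof -
  let ?t = "2 * \<tau>"
  have t: "0 \<le> ?t" using tau_pos by simp
  define W Vv nz n Q where "W = (norm (Bs (pu ?t)))\<^sup>2" and "Vv = (norm (pv ?t))\<^sup>2" and "nz = L2_norm2 (pz ?t)"
    and "n = L2_norm2 (\<zeta> ?t)" and "Q = wip (\<lambda>\<rho>. (max 0 (?t / \<tau> - \<rho>))\<^sup>2) (\<zeta> ?t) (\<zeta> ?t)"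
  have nQ: "n \<le> Q"
    unfolding n_def Q_def wip_1_same[symmetric]
  proof (rule wip_mono[OF orbit_dom(4)[OF t]])
    fix \<rho> :: real assume \<rho>: "\<rho> \<in> {0..1}"
    have "1\<^sup>2 \<le> (max 0 (?t / \<tau> - \<rho>))\<^sup>2" using \<rho> tau_pos by (intro power_mono) auto
    then show "1 \<le> (max 0 (?t / \<tau> - \<rho>))\<^sup>2" by simp
  qed (auto intro!: continuous_intros)
  have pos: "0 \<le> W" "0 \<le> Vv" "0 \<le> \<tau> / a * nz" "0 \<le> n" using tau_pos a_pos by (simp_all add: W_def Vv_def nz_def n_def)
  have an: "a * \<tau> / 16 * n \<le> a * \<tau> / 16 * Q" "0 \<le> a * \<tau> / 16 * n"
    using nQ pos tau_pos a_pos by (auto intro!: mult_left_mono)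
  have e: "early ?t = a * \<tau> / 16 * Q + 1 / 2 * Vv + 1 / 2 * W + \<tau> / a * nz"
    unfolding early_def wip_1_same W_def Vv_def nz_def Q_def ..
  have 1: "W + Vv \<le> 2 * early ?t" "\<tau> / a * nz \<le> early ?t" "a * \<tau> / 16 * n \<le> early ?t" 
    unfolding e using an pos by argo+
  have "a / \<tau> * (\<tau> / a * nz) \<le> a / \<tau> * early ?t" using 1(2) a_pos tau_pos by (intro mult_left_mono) auto
  then have 2: "nz \<le> a / \<tau> * early ?t" using a_pos tau_pos by simp
  have "16 / (a * \<tau>) * (a * \<tau> / 16 * n) \<le> 16 / (a * \<tau>) * early ?t" using 1(3) a_pos tau_pos by (intro mult_left_mono) auto
  then have 3: "n \<le> 16 / (a * \<tau>) * early ?t" using a_pos tau_pos by simp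
  have "Vv + n + W + nz \<le> (2 + 16 / (a * \<tau>) + a / \<tau>) * early ?t" unfolding distrib_right using 1(1) 2 3 by linarith
  also have "\<dots> \<le> (2 + 16 / (a * \<tau>) + a / \<tau>) * (growth * (N (p 0))\<^sup>2)"
    using early_bound[OF t] a_pos tau_pos by (intro mult_left_mono) auto
  finally have "LC * (Vv + n + W + nz) \<le> LC * ((2 + 16 / (a * \<tau>) + a / \<tau>) * (growth * (N (p 0))\<^sup>2))"
    using LC_pos by (intro mult_left_mono) auto
  then show ?thesis using lyapunov_upper[OF t] unfolding W_def Vv_def n_def nz_def by linarith
qed

lemma orbit_late:
  assumes t: "2 * \<tau> \<le> t"
  shows "(N (p t))\<^sup>2 \<le> (2 + 8 * \<xi> / \<tau>) * (exp (- rate * (t - 2 * \<tau>)) *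
    (LC * ((2 + 16 / (a * \<tau>) + a / \<tau>) * (growth * (N (p 0))\<^sup>2))))"
proof -
  have t0: "0 \<le> t" "0 \<le> 2 * \<tau>" using t tau_pos by auto
  define W Vv nz where "W = (norm (Bs (pu t)))\<^sup>2" and "Vv = (norm (pv t))\<^sup>2" and "nz = L2_norm2 (pz t)"
  have pos: "0 \<le> W" "0 \<le> Vv" "0 \<le> \<tau> / 8 * nz" using tau_pos by (simp_all add: W_def Vv_def nz_def)
  have low: "1 / 2 * Vv + 1 / 2 * W + \<tau> / 8 * nz \<le> lyapunov t"
    unfolding W_def Vv_def nz_def by (rule lyapunov_lower[OF t0(1)])
  have "8 * \<xi> / \<tau> * (\<tau> / 8 * nz) \<le> 8 * \<xi> / \<tau> * lyapunov t"
    using low pos xi_pos tau_pos by (intro mult_left_mono) auto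
  then have "\<xi> * nz \<le> 8 * \<xi> / \<tau> * lyapunov t" using tau_pos by simp
  then have "(N (p t))\<^sup>2 \<le> (2 + 8 * \<xi> / \<tau>) * lyapunov t"
    using bounds_at(8)[OF t0(1)] low pos unfolding distrib_right W_def Vv_def nz_def by linarith
  also have "\<dots> \<le> (2 + 8 * \<xi> / \<tau>) * (exp (- rate * (t - 2 * \<tau>)) *
    (LC * ((2 + 16 / (a * \<tau>) + a / \<tau>) * (growth * (N (p 0))\<^sup>2))))"
  proof (rule mult_left_mono)
    show "lyapunov t \<le> exp (- rate * (t - 2 * \<tau>)) * (LC * ((2 + 16 / (a * \<tau>) + a / \<tau>) * (growth * (N (p 0))\<^sup>2)))"
      using lyapunov_decay[OF t0(2) t] by (rule order_trans) (rule mult_left_mono[OF lyapunov_initial], simp)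
  qed (use xi_pos tau_pos in simp)
  finally show ?thesis .
qed

text \<open>The sum of the two constants serves both ranges of \<open>t\<close>; the factor
  \<open>exp (rate * (2 * \<tau>))\<close> keeps the exponential at least 1 up to time
  \<open>2 * \<tau>\<close> and starts the decay from there.\<close>

lemma orbit_decay:
  assumes t: "0 \<le> t"
  shows "(N (p t))\<^sup>2 \<le> ((2 + 8 * \<xi> / \<tau>) * (LC * ((2 + 16 / (a * \<tau>) + a / \<tau>) * growth)) + (2 + \<xi> * a / \<tau>) * growth)
    * exp (rate * (2 * \<tau>)) * exp (- rate * t) * (N (p 0))\<^sup>2"
proof -
  let ?C1 = "(2 + 8 * \<xi> / \<tau>) * (LC * ((2 + 16 / (a * \<tau>) + a / \<tau>) * growth))" and ?C2 = "(2 + \<xi> * a / \<tau>) * growth"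
  let ?e = "exp (rate * (2 * \<tau>)) * exp (- rate * t)"
  have g: "growth > 0" unfolding growth_def using xi_pos tau_pos a_pos by (simp add: add_pos_pos)
  have C: "0 \<le> ?C1" "0 \<le> ?C2" using g LC_pos xi_pos tau_pos a_pos by (auto intro!: mult_nonneg_nonneg add_nonneg_nonneg)
  have ee: "?e = exp (- rate * (t - 2 * \<tau>))" by (simp add: exp_add[symmetric] algebra_simps)
  have "(N (p t))\<^sup>2 \<le> ?C1 * (?e * (N (p 0))\<^sup>2) + ?C2 * (?e * (N (p 0))\<^sup>2)"
  proof (cases "t \<le> 2 * \<tau>")
    case True
    have "1 \<le> ?e" unfolding ee using True rate_pos by (simp add: mult_nonneg_nonpos)
    then have "1 * (N (p 0))\<^sup>2 \<le> ?e * (N (p 0))\<^sup>2" by (intro mult_right_mono) auto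
    then have "?C2 * (1 * (N (p 0))\<^sup>2) \<le> ?C2 * (?e * (N (p 0))\<^sup>2)" by (rule mult_left_mono[OF _ C(2)])
    moreover have "(N (p t))\<^sup>2 \<le> ?C2 * (1 * (N (p 0))\<^sup>2)" using orbit_early[OF t True] by (simp add: mult.assoc)
    moreover have "0 \<le> ?C1 * (?e * (N (p 0))\<^sup>2)" using C(1) by simp
    ultimately show ?thesis by linarith
  next
    case False
    then have "(N (p t))\<^sup>2 \<le> ?C1 * (?e * (N (p 0))\<^sup>2)"
      using orbit_late[of t] unfolding ee by (simp add: mult.assoc mult.left_commute)
    moreover have "0 \<le> ?C2 * (?e * (N (p 0))\<^sup>2)" using C(2) by simp
    ultimately show ?thesis by linarith
  qed
  then show ?thesis by (simp add: algebra_simps)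
qed

end

section \<open>From smooth orbits to all states\<close>

context delayed_wave_semigroup
begin

text \<open>The orbit estimate has constants free of the orbit, and the density error is amplified
  only by the bound \<open>M\<close> of the single operator \<open>T t\<close>. The error is chosen
  after \<open>t\<close>, so \<open>M\<close> leaves no trace in the result. The square root halves
  the rate.\<close>

lemma exponential_decay:
  "\<exists>C \<omega>. C > 0 \<and> \<omega> > 0 \<and> (\<forall>t>0. \<forall>x\<in>X. N (T t x) \<le> C * exp (- \<omega> * t) * N x)"
proof -
  define K where "K = ((2 + 8 * \<xi> / \<tau>) * (LC * ((2 + 16 / (a * \<tau>) + a / \<tau>) * growth)) + (2 + \<xi> * a / \<tau>) * growth)
    * exp (rate * (2 * \<tau>))"
  have g: "growth > 0" unfolding growth_def using xi_pos tau_pos a_pos by (simp add: add_pos_pos)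
  have K: "K > 0" unfolding K_def using g LC_pos xi_pos tau_pos a_pos
    by (intro mult_pos_pos add_pos_pos) (auto intro!: divide_pos_pos mult_pos_pos)
  have orbit: "N (p t) \<le> sqrt K * exp (- (rate / 2) * t) * N (p 0)" if o: "smooth_orbit p q" and t: "0 \<le> t" for p q t
  proof -
    interpret delayed_wave_orbit B DB C0 \<xi> a \<tau> T p q by unfold_locales (rule o)
    have "(N (p t))\<^sup>2 \<le> K * exp (- rate * t) * (N (p 0))\<^sup>2" unfolding K_def by (rule orbit_decay[OF t])
    also have "\<dots> = (sqrt K * exp (- (rate / 2) * t) * N (p 0))\<^sup>2"
    proof -
      have "exp (- (rate / 2) * t) * exp (- (rate / 2) * t) = exp (- rate * t)" by (simp add: exp_add[symmetric])
      moreover have "sqrt K * sqrt K = K" using K by simp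
      moreover have "(x * y * z)\<^sup>2 = (x * x) * (y * y) * z\<^sup>2" for x y z :: real by (simp add: power2_eq_square)
      ultimately show ?thesis by (simp only:)
    qed
    finally show ?thesis by (rule power2_le_imp_le) (use K in simp)
  qed
  have "N (T t x) \<le> sqrt K * exp (- (rate / 2) * t) * N x" if t: "t > 0" and x: "x \<in> X" for t x
  proof (rule field_le_epsilon)
    fix e :: real assume e: "e > 0"
    let ?c = "sqrt K * exp (- (rate / 2) * t)"
    have c: "?c \<ge> 0" using K by simp
    obtain M where M: "\<And>y. y \<in> X \<Longrightarrow> N (T t y) \<le> M * N y" using T_bounded[of t] t by auto
    \<comment> \<open>Balances the density error against both amplifications:
      \<open>\<bar>M\<bar>\<close> for the difference of the states, \<open>?c\<close> for the
      change of the initial norm.\<close>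
    define d where "d = e / (?c + \<bar>M\<bar> + 1)"
    have d: "d > 0" unfolding d_def using e c by (intro divide_pos_pos) auto
    obtain p q where o: "smooth_orbit p q" "norm (J (p 0) - J x) < d" "\<And>s. s \<ge> 0 \<Longrightarrow> J (p s) = J (T s (p 0))"
      using smooth_orbit_dense[OF x d] by blast
    have pX: "p s \<in> X" if "0 \<le> s" for s using o(1) that D_X by (auto simp: smooth_orbit_def)
    have p0: "p 0 \<in> X" by (rule pX) simp
    have dX: "sadd x (sscale (-1) (p 0)) \<in> X" by (rule X_diff[OF x p0])
    have t0: "0 \<le> t" using t by simp
    have "J (T t (sadd x (sscale (-1) (p 0)))) = J (T t x) - J (T t (p 0))" using J_T_lin[OF t0 x p0, of "-1"] by simp
    then have "J (T t x) = J (T t (sadd x (sscale (-1) (p 0)))) + J (p t)" using o(3)[OF t0] by simp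
    then have "N (T t x) \<le> N (T t (sadd x (sscale (-1) (p 0)))) + N (p t)"
      using norm_triangle_ineq[of "J (T t (sadd x (sscale (-1) (p 0))))" "J (p t)"]
      by (simp only: norm_J[OF T_X[OF t0 x], symmetric] norm_J[OF T_X[OF t0 dX], symmetric] norm_J[OF pX[OF t0], symmetric])
    also have "N (T t (sadd x (sscale (-1) (p 0)))) \<le> \<bar>M\<bar> * d"
    proof -
      have "N (sadd x (sscale (-1) (p 0))) \<le> d" using o(2) N_diff[OF x p0] by (simp add: norm_minus_commute)
      then have "M * N (sadd x (sscale (-1) (p 0))) \<le> \<bar>M\<bar> * d" by (intro mult_mono) auto
      then show ?thesis using M[OF dX] by linarith
    qed
    also have "N (p t) \<le> ?c * (N x + d)"
    proof -
      have "N (p 0) \<le> N x + d"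
        using o(2) norm_triangle_ineq2[of "J (p 0)" "J x"] by (simp add: norm_J p0 x)
      then have "?c * N (p 0) \<le> ?c * (N x + d)" by (rule mult_left_mono[OF _ c])
      then show ?thesis using orbit[OF o(1) t0] by linarith
    qed
    also have "\<bar>M\<bar> * d + ?c * (N x + d) \<le> ?c * N x + e"
    proof -
      have "(?c + \<bar>M\<bar> + 1) * d = e" unfolding d_def using c by (intro nonzero_mult_div_cancel_left[of "?c + \<bar>M\<bar> + 1" e, unfolded times_divide_eq_right[symmetric]]) linarith
      moreover have "(?c + \<bar>M\<bar> + 1) * d = ?c * d + \<bar>M\<bar> * d + d" by (simp only: distrib_right mult_1)
      moreover have "?c * (N x + d) = ?c * N x + ?c * d" by (simp only: distrib_left)
      ultimately show ?thesis using d by linarith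
    qed
    finally show "N (T t x) \<le> ?c * N x + e" by simp
  qed
  then show ?thesis using K rate_pos by (intro exI[of _ "sqrt K"] exI[of _ "rate / 2"]) auto
qed

end

theorem theorem4p1:
  fixes B :: "'h1::{real_inner,banach} \<Rightarrow> 'h::{real_inner,banach}"
    and DB :: "'h1 set"
    and C0 a \<tau> \<xi> :: real
    and T :: "real \<Rightarrow> ('h,'h1) state \<Rightarrow> ('h,'h1) state"
  assumes B_lin: "lin_op_on DB B"
    and B_dense: "closure DB = UNIV"
    and C0_pos: "C0 > 0"
    and coercive: "\<forall>v\<in>adj_dom DB B. norm (adj DB B v) \<ge> C0 * norm v"
    and V_complete: "\<forall>f. (\<forall>n. f n \<in> adj_dom DB B) \<and> Cauchy (\<lambda>n. adj DB B (f n)) \<longrightarrow>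
                        (\<exists>v\<in>adj_dom DB B. (\<lambda>n. adj DB B (f n)) \<longlonglongrightarrow> adj DB B v)"
    and V_compact: "\<forall>f::nat \<Rightarrow> 'h. (\<forall>n. f n \<in> adj_dom DB B) \<and> bounded (range (\<lambda>n. adj DB B (f n))) \<longrightarrow>
                        (\<exists>r l. strict_mono r \<and> (f \<circ> r) \<longlonglongrightarrow> l)"
    and a_pos: "a > 0" and tau_pos: "\<tau> > 0" and xi_pos: "\<xi> > 0"
    and xi_big: "\<xi> > 2 * \<tau> / a" and tau_le: "\<tau> \<le> a"
    and T_gen: "C0_semigroup_generated_by (state_space DB B) (state_norm DB B \<xi>) sadd sscale T
                  (opA DB B a \<tau>) (opA_dom DB B a)"
  shows "\<exists>C \<omega>. C > 0 \<and> \<omega> > 0 \<and>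
           (\<forall>t>0. \<forall>x\<in>state_space DB B.
              state_norm DB B \<xi> (T t x) \<le> C * exp (- \<omega> * t) * state_norm DB B \<xi> x)"
proof -
  interpret delayed_wave_semigroup B DB C0 \<xi> a \<tau> T
    by unfold_locales (use assms in auto)
  show ?thesis by (rule exponential_decay)
qed

end
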